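(* Let $d\ge2$ and $\beta\ge0$. Let $\eta:[0,\infty)\to\mathbb{R}$ be continuous, $k$ times differentiable on $(0,\infty)$, where $k$ is an integer with $k>(d+3)/2+\beta$, and suppose that \[\liminf_{r\to\infty}\frac{\eta(r)}{\log r}=\infty\] and that for some $0<\alpha<2$, \[\sup_{0\le m\le k}\ \sup_{r>0}\ \big|r^{-\alpha+m}D^m\eta(r)\big|=A<\infty,\] where $D$ denotes differentiation in $r$. For $t>0$, $x\in\mathbb{R}^d$ let \[K^\beta(t,x)=(2\pi)^{-d}\int_{\mathbb{R}^d}e^{-ix\cdot\xi}|\xi|^\beta e^{-t\eta(|\xi|)}\,d\xi .\] If $\beta\notin\{0,2,4,\dots\}$, then for each $t>0$, \[K^\beta(t,x)\sim\frac{2^\beta\,\Gamma(\frac{d+\beta}{2})}{\pi^{d/2}\,\Gamma(\frac{-\beta}{2})}\,\frac{e^{-t\eta(0)}}{|x|^{d+\beta}}\qquad\text{as }|x|\to\infty.\]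
   Context: $\Gamma$ is the Euler gamma function. $f(x)\sim g(x)$ as $|x|\to\infty$ means $f(x)/g(x)\to 1$. *)

theory Defs
  imports "HOL-Analysis.Analysis" "HOL-Library.Landau_Symbols"
begin

definition Kbeta :: "real \<Rightarrow> (real \<Rightarrow> real) \<Rightarrow> real \<Rightarrow> real^'n::finite \<Rightarrow> complex" where
  "Kbeta \<beta> \<eta> t x =
     complex_of_real ((2 * pi) powr (- real CARD('n))) *
     (LINT \<xi>|lborel. exp (- \<i> * complex_of_real (x \<bullet> \<xi>)) *
        complex_of_real (norm \<xi> powr \<beta> * exp (- t * \<eta> (norm \<xi>))))"

end

theory Submission
  imports Defs "HOL-Probability.Characteristic_Functions"
begin

text \<open>
  Write \<open>f(r) = r\<^sup>\<beta> e\<^sup>-\<^sup>t\<^sup>\<eta>\<^sup>(\<^sup>r\<^sup>)\<close> and \<open>f\<^sub>0 = f\<close>, \<open>f\<^sub>j\<^sub>+\<^sub>1 = - f\<^sub>j' / r\<close>. Slicing balls by hyperplanes and integrating by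
  parts \<open>k\<close> times (each time as an application of Fubini) turns the Fourier transform of \<open>f(|\<xi>|)\<close> in dimension \<open>d\<close> into
  a constant times \<open>\<integral>\<^sub>0\<^sup>\<infinity> r f\<^sub>k(r) \<Psi>(|x|, r) dr\<close> with \<open>\<Psi>(R, r) = \<integral>\<^sub>|\<^sub>s\<^sub>|\<^sub>\<le>\<^sub>r e\<^sup>-\<^sup>i\<^sup>R\<^sup>s (r\<^sup>2 - s\<^sup>2)\<^sup>\<mu> ds\<close> and
  \<open>\<mu> = (d-3)/2 + k\<close>. The hypotheses on \<open>\<eta>\<close> say that \<open>r\<^sup>2\<^sup>k\<^sup>-\<^sup>\<beta> f\<^sub>k(r)\<close> is bounded and tends to
  \<open>e\<^sup>-\<^sup>t\<^sup>\<eta>\<^sup>(\<^sup>0\<^sup>) \<Prod>\<^sub>i\<^sub><\<^sub>k (2i - \<beta>)\<close> as \<open>r \<rightarrow> 0\<close>. Rescaling \<open>r = u / |x|\<close>, the claim follows by dominated convergence: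
  \<open>\<Psi>(1, u)\<close> decays fast enough because \<open>\<mu> > d + \<beta>\<close>. The remaining integral \<open>\<integral>\<^sub>0\<^sup>\<infinity> u\<^sup>\<beta>\<^sup>-\<^sup>2\<^sup>k\<^sup>+\<^sup>1 \<Psi>(1, u) du\<close> does not
  depend on \<open>\<eta>\<close>; it is computed by writing the power of \<open>u\<close> as a mixture of Gaussians.
\<close>

section \<open>Poisson's integral for Bessel functions\<close>

text \<open>The obstacle is that the leading term \<open>r^\<beta> exp(-t \<eta>(0))\<close> of f at
  0, which alone decides the answer, has no convergent Fourier integral, so rescaling f itself by
  |x| leaves nothing integrable to dominate it. Each passage from \<open>f_j\<close> to
  \<open>f_(j+1)\<close> lowers the homogeneity at 0 by 2 and raises the order of Poisson's integral
  by 1; this gains two powers of r at 0 but costs only about one power at infinity. After k passages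
  the rescaled integrand converges absolutely at both ends. The threshold for k matches the decay
  estimate obtained below: \<Psi>(1, u) is bounded by a constant times u^(\<mu>+1) for u \<ge> 1,
  and u^(\<beta>-2k+1) u^(\<mu>+1) is integrable at infinity exactly when \<mu> > d + \<beta>, that
  is k > (d+3)/2 + \<beta>. The factor 1/\<Gamma>(-\<beta>/2) of the claim comes from the product of
  the 2i - \<beta>, which equals 2^k \<Gamma>(k-\<beta>/2)/\<Gamma>(-\<beta>/2); its numerator
  cancels against the limiting integral, so k leaves no trace in the constant. For even \<beta> one
  factor of the product vanishes: |\<xi>|^\<beta> is then a polynomial and has no singularity at
  0.\<close>

text \<open>Poisson's integral: up to a constant this is \<open>(r/R)\<^sup>\<mu>\<^sup>+\<^sup>1\<^sup>/\<^sup>2 J\<^sub>\<mu>\<^sub>+\<^sub>1\<^sub>/\<^sub>2(R r)\<close>.\<close>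

definition bessel_int :: "real \<Rightarrow> real \<Rightarrow> real \<Rightarrow> complex" where
  "bessel_int \<mu> R r = (LBINT s:{-r..r}. cis (- (R * s)) * complex_of_real ((r\<^sup>2 - s\<^sup>2) powr \<mu>))"

lemma borel_measurable_cis [measurable]: "cis \<in> borel_measurable borel"
  by (intro borel_measurable_continuous_onI continuous_intros)

text \<open>The substitution t = 1/2 + s/(2r) gives t(1-t) = (r^2 - s^2)/(4 r^2), so this is Euler's
  Beta integral. The value serves below as the absolute bound for \<open>bessel_int\<close>.\<close>

lemma has_bochner_integral_powr_diff_squares:
  fixes r \<mu> :: real
  assumes "\<mu> > -1" "r > 0"
  shows "has_bochner_integral lborel (\<lambda>s. indicator {-r..r} s *\<^sub>R (r\<^sup>2 - s\<^sup>2) powr \<mu>)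
           (2 * 4 powr \<mu> * Beta (\<mu> + 1) (\<mu> + 1) * r powr (2 * \<mu> + 1))"
proof -
  define g :: "real \<Rightarrow> real" where "g = (\<lambda>t. indicator {0..1} t *\<^sub>R (t powr \<mu> * (1 - t) powr \<mu>))"
  have gi: "integrable lborel g"
    using integrable_Beta[of "\<mu> + 1" "\<mu> + 1"] assms by (simp add: set_integrable_def g_def)
  have g_int: "integral\<^sup>L lborel g = Beta (\<mu> + 1) (\<mu> + 1)"
  proof -
    have "integral\<^sup>L lborel g = (LBINT t:{0..1}. t powr \<mu> * (1 - t) powr \<mu>)"
      by (simp add: set_lebesgue_integral_def g_def)
    also have "\<dots> = integral {0..1} (\<lambda>t. t powr \<mu> * (1 - t) powr \<mu>)"
      using integrable_Beta[of "\<mu> + 1" "\<mu> + 1"] assms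
      by (intro set_borel_integral_eq_integral) simp
    also have "\<dots> = Beta (\<mu> + 1) (\<mu> + 1)"
      using has_integral_Beta_real[of "\<mu> + 1" "\<mu> + 1"] assms by (simp add: integral_unique)
    finally show ?thesis .
  qed
  have *: "(4 * r\<^sup>2) powr \<mu> * g (1/2 + 1 / (2 * r) * s) = indicator {-r..r} s *\<^sub>R (r\<^sup>2 - s\<^sup>2) powr \<mu>" for s
  proof (cases "s \<in> {-r..r}")
    case True
    have a: "0 \<le> 1/2 + 1 / (2 * r) * s" "0 \<le> 1 - (1/2 + 1 / (2 * r) * s)"
      using True assms(2) by (auto simp: field_simps)
    have "(1/2 + 1 / (2 * r) * s) * (1 - (1/2 + 1 / (2 * r) * s)) = (r\<^sup>2 - s\<^sup>2) / (4 * r\<^sup>2)"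
      using assms(2) by (simp add: field_simps power2_eq_square)
    moreover have "0 \<le> r\<^sup>2 - s\<^sup>2" using True assms(2) by (auto simp: abs_le_square_iff[symmetric])
    moreover have "g (1/2 + 1 / (2 * r) * s)
          = ((1/2 + 1 / (2 * r) * s) * (1 - (1/2 + 1 / (2 * r) * s))) powr \<mu>"
      using a unfolding g_def by (subst powr_mult) auto
    ultimately show ?thesis
      using True assms(2) by (simp add: powr_divide)
  next
    case False
    hence "1/2 + 1 / (2 * r) * s \<notin> {0..1}"
      using assms(2) by (auto simp: field_simps)
    thus ?thesis using False by (simp add: g_def)
  qed
  have "integrable lborel (\<lambda>s. g (1/2 + 1 / (2 * r) * s))"
    using gi assms(2) by (intro lborel_integrable_real_affine) auto
  moreover have "Beta (\<mu> + 1) (\<mu> + 1) = 1 / (2 * r) * (LBINT s. g (1/2 + 1 / (2 * r) * s))"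
    using lborel_integral_real_affine[of "1 / (2 * r)" g "1/2"] assms(2) g_int by simp
  ultimately have "has_bochner_integral lborel (\<lambda>s. g (1/2 + 1 / (2 * r) * s)) (2 * r * Beta (\<mu> + 1) (\<mu> + 1))"
    using assms(2) by (simp add: has_bochner_integral_iff)
  hence "has_bochner_integral lborel (\<lambda>s. (4 * r\<^sup>2) powr \<mu> * g (1/2 + 1 / (2 * r) * s))
          ((4 * r\<^sup>2) powr \<mu> * (2 * r * Beta (\<mu> + 1) (\<mu> + 1)))"
    by (intro has_bochner_integral_mult_right)
  moreover have "(4 * r\<^sup>2) powr \<mu> * (2 * r * Beta (\<mu> + 1) (\<mu> + 1))
       = 2 * 4 powr \<mu> * Beta (\<mu> + 1) (\<mu> + 1) * r powr (2 * \<mu> + 1)"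
  proof -
    have "(4 * r\<^sup>2) powr \<mu> = 4 powr \<mu> * r powr (2 * \<mu>)"
      using assms(2) by (simp add: powr_mult powr_powr flip: powr_numeral)
    thus ?thesis using assms(2) by (simp add: powr_add)
  qed
  ultimately show ?thesis unfolding * by metis
qed

lemma set_integrable_powr_diff_squares:
  fixes r \<mu> :: real
  assumes "\<mu> > -1"
  shows "set_integrable lborel {-r..r} (\<lambda>s. (r\<^sup>2 - s\<^sup>2) powr \<mu>)"
proof (cases "r > 0")
  case True
  thus ?thesis using has_bochner_integral_powr_diff_squares[OF assms True]
    by (simp add: set_integrable_def has_bochner_integral_iff)
next
  case False
  have "(\<lambda>s. indicator {-r..r} s *\<^sub>R (r\<^sup>2 - s\<^sup>2) powr \<mu>) = (\<lambda>_. 0)"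
    using False by (auto simp: fun_eq_iff indicator_def)
  thus ?thesis by (simp add: set_integrable_def)
qed

lemma set_integrable_bessel_int:
  fixes r \<mu> :: real
  assumes "\<mu> > -1"
  shows "set_integrable lborel {-r..r} (\<lambda>s. cis (- (R * s)) * complex_of_real ((r\<^sup>2 - s\<^sup>2) powr \<mu>))"
proof (rule set_integrable_bound[OF set_integrable_powr_diff_squares[OF assms, of r]])
  show "set_borel_measurable lborel {-r..r} (\<lambda>s. cis (- (R * s)) * complex_of_real ((r\<^sup>2 - s\<^sup>2) powr \<mu>))"
    unfolding set_borel_measurable_def by measurable
qed (auto simp: norm_mult)

lemma bessel_int_nonpos: "r \<le> 0 \<Longrightarrow> bessel_int \<mu> R r = 0"
proof -
  assume "r \<le> 0"
  hence "(\<lambda>s. indicator {-r..r} s *\<^sub>R (cis (- (R * s)) * complex_of_real ((r\<^sup>2 - s\<^sup>2) powr \<mu>))) = (\<lambda>_. 0)"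
    by (auto simp: fun_eq_iff indicator_def)
  thus ?thesis by (simp add: bessel_int_def set_lebesgue_integral_def)
qed

lemma borel_measurable_bessel_int [measurable]:
  "bessel_int \<mu> R \<in> borel_measurable borel"
proof -
  have "(\<lambda>r. LBINT s. (if - r \<le> s \<and> s \<le> r then 1 else 0) *\<^sub>R
          (cis (- (R * s)) * complex_of_real ((r\<^sup>2 - s\<^sup>2) powr \<mu>))) \<in> borel_measurable borel"
    by measurable
  moreover have "bessel_int \<mu> R = (\<lambda>r. LBINT s. (if - r \<le> s \<and> s \<le> r then 1 else 0) *\<^sub>R
          (cis (- (R * s)) * complex_of_real ((r\<^sup>2 - s\<^sup>2) powr \<mu>)))"
    unfolding bessel_int_def set_lebesgue_integral_def
    by (intro ext Bochner_Integration.integral_cong) (auto simp: indicator_def)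
  ultimately show ?thesis by simp
qed

lemma norm_bessel_int_le:
  assumes "\<mu> > -1" "r \<ge> 0"
  shows "norm (bessel_int \<mu> R r) \<le> 2 * 4 powr \<mu> * Beta (\<mu> + 1) (\<mu> + 1) * r powr (2 * \<mu> + 1)"
proof (cases "r > 0")
  case True
  have "norm (bessel_int \<mu> R r) \<le> (LBINT s:{-r..r}. norm (cis (- (R * s)) * complex_of_real ((r\<^sup>2 - s\<^sup>2) powr \<mu>)))"
    unfolding bessel_int_def
    using integral_norm_bound[of lborel "\<lambda>s. indicator {-r..r} s *\<^sub>R (cis (- (R * s)) * complex_of_real ((r\<^sup>2 - s\<^sup>2) powr \<mu>))"]
    by (simp add: set_lebesgue_integral_def)
  also have "\<dots> = 2 * 4 powr \<mu> * Beta (\<mu> + 1) (\<mu> + 1) * r powr (2 * \<mu> + 1)"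
    using has_bochner_integral_powr_diff_squares[OF assms(1) True]
    by (simp add: norm_mult set_lebesgue_integral_def has_bochner_integral_iff)
  finally show ?thesis .
qed (use assms in \<open>auto simp: bessel_int_nonpos\<close>)

text \<open>Substituting s/R for s reduces every frequency to R = 1, so that growth has to be
  studied in a single variable.\<close>

lemma bessel_int_scale:
  assumes "R > 0" "r \<ge> 0"
  shows "bessel_int \<mu> R r = of_real (R powr (- 2 * \<mu> - 1)) * bessel_int \<mu> 1 (R * r)"
proof -
  let ?g = "\<lambda>s. indicator {-(R * r)..R * r} s *\<^sub>R (cis (- s) * complex_of_real (((R * r)\<^sup>2 - s\<^sup>2) powr \<mu>))"
  have eq: "?g (0 + R * s) = of_real (R powr (2 * \<mu>)) * (indicator {-r..r} s *\<^sub>R (cis (- (R * s)) * complex_of_real ((r\<^sup>2 - s\<^sup>2) powr \<mu>)))" for s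
  proof (cases "s \<in> {-r..r}")
    case True
    have "0 \<le> r\<^sup>2 - s\<^sup>2" using True assms(2) by (auto simp: abs_le_square_iff[symmetric])
    hence "((R * r)\<^sup>2 - (R * s)\<^sup>2) powr \<mu> = R powr (2 * \<mu>) * (r\<^sup>2 - s\<^sup>2) powr \<mu>"
      using assms by (simp add: power_mult_distrib powr_mult powr_powr flip: right_diff_distrib powr_numeral)
    moreover have "-(R * r) \<le> R * s" "R * s \<le> R * r"
      using True assms mult_left_mono[of "-r" s R] mult_left_mono[of s r R] by auto
    ultimately show ?thesis using True by simp
  next
    case False
    hence "\<not> (-(R * r) \<le> R * s \<and> R * s \<le> R * r)"
      using assms mult_le_cancel_left_pos[of R "-r" s] mult_le_cancel_left_pos[of R s r] by auto
    thus ?thesis using False by (auto simp: indicator_def)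
  qed
  have "bessel_int \<mu> 1 (R * r) = R *\<^sub>R (LBINT s. ?g (0 + R * s))"
    using lborel_integral_real_affine[of R ?g 0] assms(1)
    by (simp add: bessel_int_def set_lebesgue_integral_def)
  also have "\<dots> = R *\<^sub>R (of_real (R powr (2 * \<mu>)) * bessel_int \<mu> R r)"
    unfolding eq bessel_int_def set_lebesgue_integral_def by (simp only: integral_mult_right_zero)
  also have "\<dots> = of_real (R powr (2 * \<mu> + 1)) * bessel_int \<mu> R r"
    using assms(1) by (simp add: powr_add scaleR_conv_of_real)
  finally have "of_real (R powr (- 2 * \<mu> - 1)) * bessel_int \<mu> 1 (R * r)
     = of_real (R powr (- 2 * \<mu> - 1) * R powr (2 * \<mu> + 1)) * bessel_int \<mu> R r"
    by simp
  also have "R powr (- 2 * \<mu> - 1) * R powr (2 * \<mu> + 1) = 1"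
    using assms(1) by (simp flip: powr_add)
  finally show ?thesis by simp
qed

section \<open>Growth of \<open>bessel_int \<mu> 1 r\<close> for large r, by integration by parts in
  s\<close>

lemma has_integral_bessel_int:
  assumes "\<mu> > -1"
  shows "((\<lambda>s. cis (- s) * complex_of_real ((r\<^sup>2 - s\<^sup>2) powr \<mu>)) has_integral bessel_int \<mu> 1 r) {-r..r}"
  using set_borel_integral_eq_integral[OF set_integrable_bessel_int[OF assms, of r 1]]
  by (simp add: bessel_int_def has_integral_iff)

text \<open>The integrand is the derivative of exp(-is) \<phi>(s), which vanishes at both ends.
  Differentiability is asked for in the open interval only: for \<phi> = (r^2 - s^2)^\<mu> with 0 <
  \<mu> < 1 the derivative blows up at the ends.\<close>

lemma cis_integral_by_parts:
  fixes \<phi> \<phi>' :: "real \<Rightarrow> real"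
  assumes "r \<ge> 0" "continuous_on {-r..r} \<phi>" "\<phi> r = 0" "\<phi> (-r) = 0"
    and deriv: "\<And>s. s \<in> {-r<..<r} \<Longrightarrow> (\<phi> has_real_derivative \<phi>' s) (at s)"
  shows "((\<lambda>s. cis (- s) * (complex_of_real (\<phi>' s) - \<i> * complex_of_real (\<phi> s))) has_integral 0) {-r..r}"
proof -
  let ?F = "\<lambda>s. cis (- s) * complex_of_real (\<phi> s)"
  have "((\<lambda>s. cis (- s) * (complex_of_real (\<phi>' s) - \<i> * complex_of_real (\<phi> s))) has_integral ?F r - ?F (-r)) {-r..r}"
  proof (rule fundamental_theorem_of_calculus_interior)
    fix s assume "s \<in> {-r<..<r}"
    from deriv[OF this] have "((\<lambda>s. complex_of_real (\<phi> s)) has_vector_derivative complex_of_real (\<phi>' s)) (at s)"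
      by (intro has_vector_derivative_of_real)
    hence 1: "((\<lambda>s. complex_of_real (\<phi> s)) has_derivative (\<lambda>h. h *\<^sub>R complex_of_real (\<phi>' s))) (at s)"
      by (simp add: has_vector_derivative_def)
    show "(?F has_vector_derivative cis (- s) * (complex_of_real (\<phi>' s) - \<i> * complex_of_real (\<phi> s))) (at s)"
      unfolding has_vector_derivative_def
      by (rule derivative_eq_intros 1 refl)+ (auto simp: fun_eq_iff algebra_simps scaleR_conv_of_real)
  qed (use assms in \<open>auto intro!: continuous_intros\<close>)
  thus ?thesis using assms by simp
qed

lemma continuous_on_powr_diff_squares:
  fixes r \<mu> :: real
  assumes "\<mu> > 0"
  shows "continuous_on {-r..r} (\<lambda>s. (r\<^sup>2 - s\<^sup>2) powr \<mu>)"
  using assms by (intro continuous_on_powr' continuous_intros) (auto intro!: abs_le_square_iff[THEN iffD1])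

lemma has_real_derivative_powr_diff_squares:
  fixes r s \<mu> :: real
  assumes "s \<in> {-r<..<r}"
  shows "((\<lambda>s. (r\<^sup>2 - s\<^sup>2) powr \<mu>) has_real_derivative (- 2 * \<mu> * s * (r\<^sup>2 - s\<^sup>2) powr (\<mu> - 1))) (at s)"
proof -
  have "s\<^sup>2 < r\<^sup>2" using assms abs_square_less_1 by (auto intro!: power2_strict_mono)
  thus ?thesis by (auto intro!: derivative_eq_intros)
qed

lemma bessel_int_by_parts:
  assumes "\<mu> > 0" "r > 0"
  shows "((\<lambda>s. cis (- s) * (complex_of_real (- 2 * \<mu> * s * (r\<^sup>2 - s\<^sup>2) powr (\<mu> - 1))
            - \<i> * complex_of_real ((r\<^sup>2 - s\<^sup>2) powr \<mu>))) has_integral 0) {-r..r}"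
  using assms by (intro cis_integral_by_parts continuous_on_powr_diff_squares has_real_derivative_powr_diff_squares) auto

text \<open>One integration by parts followed by |s| \<le> r gains a factor 1/r over the trivial
  bound r^(2\<mu>+1). The two bounds together start the induction on the order.\<close>

lemma norm_bessel_int_le_once:
  assumes "\<mu> > 0" "r > 0"
  shows "norm (bessel_int \<mu> 1 r) \<le> (4 * \<mu> * 4 powr (\<mu> - 1) * Beta \<mu> \<mu>) * r powr (2 * \<mu>)"
proof -
  let ?f = "\<lambda>s. cis (- s) * complex_of_real (- 2 * \<mu> * s * (r\<^sup>2 - s\<^sup>2) powr (\<mu> - 1))"
  have "(?f has_integral (0 + \<i> * bessel_int \<mu> 1 r)) {-r..r}"
    using has_integral_add[OF bessel_int_by_parts[OF assms]
          has_integral_mult_right[OF has_integral_bessel_int[of \<mu> r], of \<i>]] assms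
    by (rule_tac has_integral_eq[rotated]) (auto simp: algebra_simps)
  hence f: "?f integrable_on {-r..r}" "norm (integral {-r..r} ?f) = norm (bessel_int \<mu> 1 r)"
    by (auto simp: has_integral_iff norm_mult)
  let ?g = "\<lambda>s. 2 * \<mu> * r * (r\<^sup>2 - s\<^sup>2) powr (\<mu> - 1)"
  have "((\<lambda>s. (r\<^sup>2 - s\<^sup>2) powr (\<mu> - 1)) has_integral
          (2 * 4 powr (\<mu> - 1) * Beta \<mu> \<mu> * r powr (2 * \<mu> - 1))) {-r..r}"
    using set_borel_integral_eq_integral[OF set_integrable_powr_diff_squares[of "\<mu> - 1" r]]
          has_bochner_integral_powr_diff_squares[of "\<mu> - 1" r] assms
    by (simp add: has_integral_iff set_lebesgue_integral_def has_bochner_integral_iff)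
  from has_integral_mult_right[OF this, of "2 * \<mu> * r"]
  have g: "(?g has_integral (2 * \<mu> * r * (2 * 4 powr (\<mu> - 1) * Beta \<mu> \<mu> * r powr (2 * \<mu> - 1)))) {-r..r}" .
  have "norm (integral {-r..r} ?f) \<le> integral {-r..r} ?g"
  proof (rule integral_norm_bound_integral)
    fix s assume "s \<in> {-r..r}"
    hence "\<bar>s\<bar> \<le> r" by auto
    thus "norm (?f s) \<le> ?g s"
      using assms by (auto simp: norm_mult abs_mult intro!: mult_mono)
  qed (use f g in \<open>auto simp: has_integral_iff\<close>)
  also have "\<dots> = 2 * \<mu> * r * (2 * 4 powr (\<mu> - 1) * Beta \<mu> \<mu> * r powr (2 * \<mu> - 1))"
    using g by (simp add: has_integral_iff)
  also have "\<dots> = (4 * \<mu> * 4 powr (\<mu> - 1) * Beta \<mu> \<mu>) * (r powr 1 * r powr (2 * \<mu> - 1))"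
    using assms by simp
  also have "r powr 1 * r powr (2 * \<mu> - 1) = r powr (2 * \<mu>)"
    by (subst powr_add[symmetric]) simp
  finally show ?thesis using f by simp
qed

text \<open>Two integrations by parts replace \<phi> = (r^2 - s^2)^\<mu> by -\<phi>'', and s^2 = r^2
  - (r^2 - s^2) expresses \<phi>'' through the two lower orders. This is the three-term recurrence
  of Bessel functions.\<close>

lemma bessel_int_recurrence:
  assumes "\<mu> > 1" "r > 0"
  shows "bessel_int \<mu> 1 r = of_real (2 * \<mu> * (2 * \<mu> - 1)) * bessel_int (\<mu> - 1) 1 r
           - of_real (4 * \<mu> * (\<mu> - 1) * r\<^sup>2) * bessel_int (\<mu> - 2) 1 r"
proof -
  define P where "P = (\<lambda>\<nu> s. complex_of_real ((r\<^sup>2 - s\<^sup>2) powr \<nu>))"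
  let ?d = "\<lambda>s. - 2 * \<mu> * s * (r\<^sup>2 - s\<^sup>2) powr (\<mu> - 1)"
  let ?dd = "\<lambda>s. - 2 * \<mu> * (2 * \<mu> - 1) * (r\<^sup>2 - s\<^sup>2) powr (\<mu> - 1) + 4 * \<mu> * (\<mu> - 1) * r\<^sup>2 * (r\<^sup>2 - s\<^sup>2) powr (\<mu> - 2)"
  have 2: "((\<lambda>s. cis (- s) * (complex_of_real (?dd s) - \<i> * complex_of_real (?d s))) has_integral 0) {-r..r}"
  proof (rule cis_integral_by_parts)
    show "continuous_on {-r..r} ?d"
      using assms by (intro continuous_intros continuous_on_powr_diff_squares) auto
    fix s assume s: "s \<in> {-r<..<r}"
    hence pos: "r\<^sup>2 - s\<^sup>2 > 0" by (auto intro!: power2_strict_mono)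
    have split: "(r\<^sup>2 - s\<^sup>2) powr (\<mu> - 1) = (r\<^sup>2 - s\<^sup>2) * (r\<^sup>2 - s\<^sup>2) powr (\<mu> - 2)"
      using pos powr_add[of "r\<^sup>2 - s\<^sup>2" 1 "\<mu> - 2"] by simp
    show "(?d has_real_derivative ?dd s) (at s)"
      by (rule DERIV_cong[OF DERIV_mult[OF DERIV_cmult_Id has_real_derivative_powr_diff_squares[OF s]]])
         (simp add: split, simp add: algebra_simps power2_eq_square)
  qed (use assms in auto)
  have 1: "((\<lambda>s. \<i> * (cis (- s) * (complex_of_real (?d s)
            - \<i> * complex_of_real ((r\<^sup>2 - s\<^sup>2) powr \<mu>)))) has_integral \<i> * 0) {-r..r}"
    using bessel_int_by_parts[of \<mu> r] assms by (intro has_integral_mult_right) auto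
  \<comment> \<open>Adding i times the first identity to the second cancels \<phi>' and leaves the
    integral of exp(-is) (\<phi> + \<phi>'').\<close>
  have "((\<lambda>s. cis (- s) * P \<mu> s + - of_real (2 * \<mu> * (2 * \<mu> - 1)) * (cis (- s) * P (\<mu> - 1) s) +
         of_real (4 * \<mu> * (\<mu> - 1) * r\<^sup>2) * (cis (- s) * P (\<mu> - 2) s)) has_integral 0) {-r..r}"
    using has_integral_add[OF 2 1]
    by (rule_tac has_integral_eq[rotated]) (auto simp: P_def algebra_simps)
  moreover have "((\<lambda>s. cis (- s) * P \<mu> s + - of_real (2 * \<mu> * (2 * \<mu> - 1)) * (cis (- s) * P (\<mu> - 1) s) +
         of_real (4 * \<mu> * (\<mu> - 1) * r\<^sup>2) * (cis (- s) * P (\<mu> - 2) s)) has_integral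
        (bessel_int \<mu> 1 r + - of_real (2 * \<mu> * (2 * \<mu> - 1)) * bessel_int (\<mu> - 1) 1 r
           + of_real (4 * \<mu> * (\<mu> - 1) * r\<^sup>2) * bessel_int (\<mu> - 2) 1 r)) {-r..r}"
    unfolding P_def using assms
    by (intro has_integral_add has_integral_mult_right has_integral_bessel_int) auto
  ultimately have "0 = bessel_int \<mu> 1 r + - of_real (2 * \<mu> * (2 * \<mu> - 1)) * bessel_int (\<mu> - 1) 1 r
           + of_real (4 * \<mu> * (\<mu> - 1) * r\<^sup>2) * bessel_int (\<mu> - 2) 1 r"
    by (rule has_integral_unique)
  thus ?thesis by (simp add: algebra_simps)
qed

text \<open>Raising the order by 1 costs u^2 in the trivial bound, but only u here, because the
  recurrence pays u^2 for a step of two orders. In terms of \<mu> = \<nu> + m the exponent is \<mu>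
  + \<nu> + 1, hence at most \<mu> + 1 once \<nu> \<le> 0.\<close>

lemma bessel_int_decay:
  assumes "\<nu> > -1"
  shows "\<exists>C. \<forall>u\<ge>1. norm (bessel_int (\<nu> + real m) 1 u) \<le> C * u powr (2 * \<nu> + 1 + real m)"
proof (induction m rule: induct_nat_012)
  case 0
  show ?case using norm_bessel_int_le[OF assms]
    by (intro exI[of _ "2 * 4 powr \<nu> * Beta (\<nu> + 1) (\<nu> + 1)"]) auto
next
  case 1
  show ?case using norm_bessel_int_le_once[of "\<nu> + 1"] assms
    by (intro exI[of _ "4 * (\<nu> + 1) * 4 powr \<nu> * Beta (\<nu> + 1) (\<nu> + 1)"]) (auto simp: algebra_simps)
next
  case (ge2 m)
  obtain C0 where C0: "\<And>u. u \<ge> 1 \<Longrightarrow> norm (bessel_int (\<nu> + real m) 1 u) \<le> C0 * u powr (2 * \<nu> + 1 + real m)"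
    using ge2 by blast
  obtain C1 where C1: "\<And>u. u \<ge> 1 \<Longrightarrow> norm (bessel_int (\<nu> + real m + 1) 1 u) \<le> C1 * u powr (2 * \<nu> + 2 + real m)"
    using ge2 by (auto simp: algebra_simps)
  define \<mu> where "\<mu> = \<nu> + real m + 2"
  have \<mu>: "\<mu> > 1" using assms by (simp add: \<mu>_def)
  define a b where "a = 2 * \<mu> * (2 * \<mu> - 1)" and "b = 4 * \<mu> * (\<mu> - 1)"
  have ab: "a \<ge> 0" "b \<ge> 0" using \<mu> by (auto simp: a_def b_def)
  have "norm (bessel_int \<mu> 1 u) \<le> (a * C1 + b * C0) * u powr (2 * \<nu> + 3 + real m)" if u: "u \<ge> 1" for u
  proof -
    have C1_0: "C1 \<ge> 0" using order_trans[OF norm_ge_zero C1[of 1]] by simp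
    have "norm (bessel_int \<mu> 1 u) \<le> norm (of_real a * bessel_int (\<mu> - 1) 1 u) + norm (of_real (b * u\<^sup>2) * bessel_int (\<mu> - 2) 1 u)"
      using \<mu> u by (subst bessel_int_recurrence) (auto simp: a_def b_def intro!: norm_triangle_ineq4)
    also have "\<dots> = a * norm (bessel_int (\<mu> - 1) 1 u) + b * u\<^sup>2 * norm (bessel_int (\<mu> - 2) 1 u)"
      using ab by (simp add: norm_mult del: of_real_mult of_real_power)
    also have "\<dots> \<le> a * (C1 * u powr (2 * \<nu> + 2 + real m)) + b * u\<^sup>2 * (C0 * u powr (2 * \<nu> + 1 + real m))"
      using C0[OF u] C1[OF u] ab by (intro add_mono mult_left_mono) (auto simp: \<mu>_def algebra_simps)
    also have "u\<^sup>2 * (C0 * u powr (2 * \<nu> + 1 + real m)) = C0 * u powr (2 * \<nu> + 3 + real m)"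
      using u powr_add[of u 2 "2 * \<nu> + 1 + real m"] by (simp add: powr_numeral algebra_simps)
    hence "b * u\<^sup>2 * (C0 * u powr (2 * \<nu> + 1 + real m)) = b * (C0 * u powr (2 * \<nu> + 3 + real m))"
      by (simp add: mult.assoc)
    \<comment> \<open>The term of order \<mu> - 1 has one power of u to spare; the term of order
      \<mu> - 2 dictates the exponent.\<close>
    also have "a * (C1 * u powr (2 * \<nu> + 2 + real m)) \<le> a * (C1 * u powr (2 * \<nu> + 3 + real m))"
      using u ab C1_0 by (intro mult_left_mono powr_mono) auto
    finally show ?thesis by (simp add: algebra_simps)
  qed
  moreover have "\<nu> + real (Suc (Suc m)) = \<mu>" "2 * \<nu> + 1 + real (Suc (Suc m)) = 2 * \<nu> + 3 + real m"
    by (simp_all add: \<mu>_def)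
  ultimately show ?case by metis
qed

section \<open>Radial weights integrated against \<open>bessel_int\<close>: truncations and
  Gaussians\<close>

lemma has_bochner_integral_nonneg_has_integral:
  fixes f :: "real \<Rightarrow> real"
  assumes [measurable]: "f \<in> borel_measurable borel" "S \<in> sets borel"
    and nonneg: "\<And>x. x \<in> S \<Longrightarrow> f x \<ge> 0" and I: "(f has_integral I) S"
  shows "has_bochner_integral lborel (\<lambda>x. indicator S x *\<^sub>R f x) I"
proof (rule has_bochner_integral_nn_integral)
  have "((\<lambda>x. indicator S x *\<^sub>R f x) has_integral I) UNIV"
    using I by (simp only: indicator_scaleR_eq_if has_integral_restrict_UNIV)
  moreover show "AE x in lborel. 0 \<le> indicator S x *\<^sub>R f x" "0 \<le> I"
    using nonneg has_integral_nonneg[OF I] by (auto simp: indicator_def)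
  ultimately show "(\<integral>\<^sup>+x. ennreal (indicator S x *\<^sub>R f x) \<partial>lborel) = ennreal I"
    using nn_integral_has_integral_lborel[of "\<lambda>x. indicator S x *\<^sub>R f x" I] nonneg
    by (auto simp: indicator_def)
qed measurable

text \<open>The s-integral of the modulus is a constant times r^(2\<mu>+1), so with the factor w(r)
  r the assumption \<open>int\<close> is absolute integrability of the double integral.\<close>

lemma bessel_int_Fubini:
  fixes w :: "real \<Rightarrow> real"
  assumes \<mu>: "\<mu> > -1" and [measurable]: "w \<in> borel_measurable borel"
    and int: "set_integrable lborel {0<..} (\<lambda>r. w r * r powr (2 * \<mu> + 2))"
  shows "(LBINT r:{0<..}. (w r * r) *\<^sub>R bessel_int \<mu> R r) =
         (LBINT s. (LBINT r:{\<bar>s\<bar><..}. w r * r * (r\<^sup>2 - s\<^sup>2) powr \<mu>) *\<^sub>R cis (- (R * s)))"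
proof -
  define f :: "real \<times> real \<Rightarrow> complex" where
    "f = (\<lambda>(r, s). (if 0 < r \<and> \<bar>s\<bar> \<le> r then w r * r * (r\<^sup>2 - s\<^sup>2) powr \<mu> else 0) *\<^sub>R cis (- (R * s)))"
  have [measurable]: "f \<in> borel_measurable (lborel \<Otimes>\<^sub>M lborel)"
    unfolding f_def by measurable
  have f_eq: "f (r, s) = (indicator {0<..} r * (w r * r)) *\<^sub>R
          (indicator {-r..r} s *\<^sub>R (cis (- (R * s)) * complex_of_real ((r\<^sup>2 - s\<^sup>2) powr \<mu>)))" for r s
    by (auto simp: f_def indicator_def scaleR_conv_of_real)
  have f_eq2: "f (r, s) = complex_of_real (indicator {\<bar>s\<bar><..} r *\<^sub>R (w r * r * (r\<^sup>2 - s\<^sup>2) powr \<mu>)) * cis (- (R * s))" for r s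
    by (auto simp: f_def indicator_def abs_if scaleR_conv_of_real)
  have nf: "norm (f (r, s)) = (indicator {0<..} r * (\<bar>w r\<bar> * r)) *\<^sub>R
          (indicator {-r..r} s *\<^sub>R ((r\<^sup>2 - s\<^sup>2) powr \<mu>))" for r s
    by (auto simp: f_def indicator_def abs_mult)
  let ?C = "2 * 4 powr \<mu> * Beta (\<mu> + 1) (\<mu> + 1)"
  have "(LBINT s. norm (f (r, s))) = ?C * (indicator {0<..} r *\<^sub>R \<bar>w r * r powr (2 * \<mu> + 2)\<bar>)" for r
  proof (cases "r > 0")
    case True
    have "(LBINT s. norm (f (r, s))) = (\<bar>w r\<bar> * r) * (?C * r powr (2 * \<mu> + 1))"
      using has_bochner_integral_powr_diff_squares[OF \<mu> True] True unfolding nf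
      by (simp add: has_bochner_integral_iff)
    also have "r powr (2 * \<mu> + 2) = r * r powr (2 * \<mu> + 1)"
      using True powr_add[of r 1 "2 * \<mu> + 1"] by (simp add: add.commute)
    hence "(\<bar>w r\<bar> * r) * (?C * r powr (2 * \<mu> + 1)) = ?C * \<bar>w r * r powr (2 * \<mu> + 2)\<bar>"
      using True by (simp add: abs_mult)
    finally show ?thesis using True by simp
  qed (simp add: nf)
  moreover have "integrable lborel (\<lambda>r. ?C * (indicator {0<..} r *\<^sub>R \<bar>w r * r powr (2 * \<mu> + 2)\<bar>))"
    using set_integrable_abs[OF int] by (intro integrable_mult_right) (simp add: set_integrable_def)
  ultimately have "integrable lborel (\<lambda>r. LBINT s. norm (f (r, s)))"
    by simp
  moreover have "integrable lborel (\<lambda>s. f (r, s))" for r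
    using set_integrable_bessel_int[OF \<mu>, of r R] unfolding f_eq set_integrable_def
    by (rule integrable_scaleR_right)
  ultimately have fi: "integrable (lborel \<Otimes>\<^sub>M lborel) f"
    by (intro lborel_pair.Fubini_integrable) auto
  have "(LBINT r:{0<..}. (w r * r) *\<^sub>R bessel_int \<mu> R r) = (LBINT r. LBINT s. f (r, s))"
    unfolding f_eq integral_scaleR_right by (simp add: set_lebesgue_integral_def bessel_int_def)
  also have "\<dots> = (LBINT s. LBINT r. f (r, s))"
    using lborel_pair.Fubini_integral[of "\<lambda>r s. f (r, s)"] fi by (simp add: split_def)
  also have "\<dots> = (LBINT s. (LBINT r:{\<bar>s\<bar><..}. w r * r * (r\<^sup>2 - s\<^sup>2) powr \<mu>) *\<^sub>R cis (- (R * s)))"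
    unfolding f_eq2 integral_mult_left_zero integral_complex_of_real set_lebesgue_integral_def
    by (simp only: scaleR_conv_of_real)
  finally show ?thesis .
qed

text \<open>For the weight 1 on r \<le> \<rho>, the inner integral of r (r^2 - s^2)^\<mu> from |s|
  to \<rho> is again a power of \<rho>^2 - s^2, with exponent \<mu> + 1. Thus r times Poisson's
  integral has a primitive of the same kind one order higher, and repeated integration by parts
  stays within this family.\<close>

lemma bessel_int_primitive:
  assumes \<mu>: "\<mu> > -1" and "\<rho> \<ge> 0"
  shows "(LBINT r:{0<..\<rho>}. r *\<^sub>R bessel_int \<mu> R r) = bessel_int (\<mu> + 1) R \<rho> / of_real (2 * (\<mu> + 1))"
proof -
  define w :: "real \<Rightarrow> real" where "w = indicator {..\<rho>}"
  have inner: "(LBINT r:{\<bar>s\<bar><..}. w r * r * (r\<^sup>2 - s\<^sup>2) powr \<mu>)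
       = indicator {-\<rho>..\<rho>} s * (\<rho>\<^sup>2 - s\<^sup>2) powr (\<mu> + 1) / (2 * (\<mu> + 1))" for s
  proof (cases "\<bar>s\<bar> \<le> \<rho>")
    case True
    let ?F = "\<lambda>r. (r\<^sup>2 - s\<^sup>2) powr (\<mu> + 1) / (2 * (\<mu> + 1))"
    have "((\<lambda>r. r * (r\<^sup>2 - s\<^sup>2) powr \<mu>) has_integral ?F \<rho> - ?F \<bar>s\<bar>) {\<bar>s\<bar>..\<rho>}"
    proof (rule fundamental_theorem_of_calculus_interior)
      show "continuous_on {\<bar>s\<bar>..\<rho>} ?F"
        using \<mu> by (intro continuous_intros continuous_on_powr') (auto intro!: abs_le_square_iff[THEN iffD1])
      fix r assume r: "r \<in> {\<bar>s\<bar><..<\<rho>}"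
      hence "s\<^sup>2 < r\<^sup>2" by (auto simp: abs_less_iff intro!: power2_strict_mono)
      thus "(?F has_vector_derivative r * (r\<^sup>2 - s\<^sup>2) powr \<mu>) (at r)"
        using \<mu> unfolding has_real_derivative_iff_has_vector_derivative[symmetric]
        by (auto intro!: derivative_eq_intros simp: divide_simps)
    qed fact
    moreover have "{\<bar>s\<bar>..\<rho>} \<in> sets borel" by simp
    ultimately have "has_bochner_integral lborel (\<lambda>r. indicator {\<bar>s\<bar>..\<rho>} r *\<^sub>R (r * (r\<^sup>2 - s\<^sup>2) powr \<mu>)) (?F \<rho> - ?F \<bar>s\<bar>)"
      by (intro has_bochner_integral_nonneg_has_integral) auto
    moreover have "(LBINT r:{\<bar>s\<bar><..}. w r * r * (r\<^sup>2 - s\<^sup>2) powr \<mu>)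
        = (LBINT r. indicator {\<bar>s\<bar>..\<rho>} r *\<^sub>R (r * (r\<^sup>2 - s\<^sup>2) powr \<mu>))"
      unfolding set_lebesgue_integral_def
      by (intro Bochner_Integration.integral_cong) (auto simp: w_def indicator_def)
    ultimately show ?thesis using True by (simp add: has_bochner_integral_iff abs_le_iff)
  next
    case False
    hence "(\<lambda>r. indicator {\<bar>s\<bar><..} r *\<^sub>R (w r * r * (r\<^sup>2 - s\<^sup>2) powr \<mu>)) = (\<lambda>_. 0)"
      by (auto simp: w_def indicator_def fun_eq_iff)
    moreover have "s \<notin> {-\<rho>..\<rho>}" using False by auto
    ultimately show ?thesis by (simp add: set_lebesgue_integral_def)
  qed
  have "set_integrable lborel {0..\<rho>} (\<lambda>r. r powr (2 * \<mu> + 2))"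
    using \<mu> by (intro borel_integrable_atLeastAtMost' continuous_on_powr' continuous_intros) auto
  hence "set_integrable lborel {0<..} (\<lambda>r. w r * r powr (2 * \<mu> + 2))"
    unfolding set_integrable_def by (rule back_subst[of "integrable lborel"]) (auto simp: w_def indicator_def fun_eq_iff)
  moreover have "w \<in> borel_measurable borel" by (simp add: w_def)
  ultimately have "(LBINT r:{0<..}. (w r * r) *\<^sub>R bessel_int \<mu> R r) =
         (LBINT s. (LBINT r:{\<bar>s\<bar><..}. w r * r * (r\<^sup>2 - s\<^sup>2) powr \<mu>) *\<^sub>R cis (- (R * s)))"
    using \<mu> by (intro bessel_int_Fubini)
  also have "\<dots> = (LBINT s. (indicator {-\<rho>..\<rho>} s *\<^sub>R (cis (- (R * s)) * complex_of_real ((\<rho>\<^sup>2 - s\<^sup>2) powr (\<mu> + 1)))) / of_real (2 * (\<mu> + 1)))"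
    unfolding inner by (simp add: scaleR_conv_of_real mult_ac)
  also have "\<dots> = bessel_int (\<mu> + 1) R \<rho> / of_real (2 * (\<mu> + 1))"
    unfolding bessel_int_def set_lebesgue_integral_def by (rule integral_divide_zero)
  also have "(LBINT r:{0<..}. (w r * r) *\<^sub>R bessel_int \<mu> R r) = (LBINT r:{0<..\<rho>}. r *\<^sub>R bessel_int \<mu> R r)"
    unfolding set_lebesgue_integral_def
    by (intro Bochner_Integration.integral_cong) (auto simp: w_def indicator_def)
  finally show ?thesis .
qed

text \<open>A change of variables in Euler's integral. The absolute value of g' admits decreasing
  substitutions such as 1/(4\<sigma>).\<close>

lemma Gamma_integral_substitution:
  fixes g g' :: "real \<Rightarrow> real"
  assumes z: "z > 0" and S: "S \<in> sets lebesgue" and img: "g ` S = {0<..}" and inj: "inj_on g S"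
    and deriv: "\<And>x. x \<in> S \<Longrightarrow> (g has_real_derivative g' x) (at x within S)"
  shows "((\<lambda>x. \<bar>g' x\<bar> * (g x powr (z - 1) / exp (g x))) has_integral Gamma z) S"
proof -
  let ?f = "\<lambda>t :: real. t powr (z - 1) / exp t"
  have G: "(?f has_integral Gamma z) {0<..}"
  proof (rule iffD1[OF has_integral_spike_set_eq[where S = "{0..}"]])
    show "(?f has_integral Gamma z) {0..}"
      using Gamma_integral_real[of z] z by simp
    have "{t \<in> {0..} - {0<..}. ?f t \<noteq> 0} = {}" by auto
    thus "negligible {t \<in> {0..} - {0<..}. ?f t \<noteq> 0}" by (simp only: negligible_empty)
    have "{t \<in> {0<..} - {0..}. ?f t \<noteq> 0} = {}" by auto
    thus "negligible {t \<in> {0<..} - {0..}. ?f t \<noteq> 0}" by (simp only: negligible_empty)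
  qed
  have "?f absolutely_integrable_on {0<..}"
    using G by (intro nonnegative_absolutely_integrable_1) (auto simp: has_integral_iff)
  hence "?f absolutely_integrable_on g ` S \<and> integral (g ` S) ?f = Gamma z"
    unfolding img using G by (simp add: has_integral_iff)
  hence "(\<lambda>x. \<bar>g' x\<bar> * ?f (g x)) absolutely_integrable_on S \<and>
     integral S (\<lambda>x. \<bar>g' x\<bar> * ?f (g x)) = Gamma z"
    by (subst has_absolute_integral_change_of_variables_1'[OF S deriv inj])
  thus ?thesis
    by (simp add: has_integral_iff absolutely_integrable_on_def)
qed

text \<open>Under v = \<sigma> (r^2 - s^2) the weight exp(-\<sigma> r^2) splits into exp(-\<sigma>
  s^2) exp(-v). So a Gaussian weight in r becomes, after the exchange of integrals, a Gaussian in
  s.\<close>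

lemma has_bochner_integral_gaussian_powr:
  fixes \<sigma> \<mu> s :: real
  assumes \<sigma>: "\<sigma> > 0" and \<mu>: "\<mu> > -1"
  shows "has_bochner_integral lborel
     (\<lambda>r. indicator {\<bar>s\<bar><..} r *\<^sub>R (exp (- \<sigma> * r\<^sup>2) * r * (r\<^sup>2 - s\<^sup>2) powr \<mu>))
     (exp (- \<sigma> * s\<^sup>2) * (Gamma (\<mu> + 1) * \<sigma> powr (- \<mu> - 1) / 2))"
proof -
  let ?g = "\<lambda>r::real. \<sigma> * (r\<^sup>2 - s\<^sup>2)"
  have sq: "s\<^sup>2 < r\<^sup>2" if "\<bar>s\<bar> < r" for r :: real using power_strict_mono[OF that, of 2] by simp
  have img: "?g ` {\<bar>s\<bar><..} = {0<..}"
  proof (intro set_eqI iffI)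
    fix v :: real assume v: "v \<in> {0<..}"
    have *: "\<bar>s\<bar> < sqrt (s\<^sup>2 + v / \<sigma>)"
      using v \<sigma> by (intro real_less_rsqrt) auto
    have "v = ?g (sqrt (s\<^sup>2 + v / \<sigma>))" using v \<sigma> by (simp add: field_simps)
    thus "v \<in> ?g ` {\<bar>s\<bar><..}" using * by (rule_tac image_eqI) (simp_all only: greaterThan_iff)
  qed (use \<sigma> sq in auto)
  have "inj_on ?g {\<bar>s\<bar><..}"
    using \<sigma> by (auto simp: inj_on_def power2_eq_iff)
  hence "((\<lambda>r. \<bar>2 * \<sigma> * r\<bar> * (?g r powr (\<mu> + 1 - 1) / exp (?g r))) has_integral Gamma (\<mu> + 1)) {\<bar>s\<bar><..}"
    using \<mu> img by (intro Gamma_integral_substitution) (auto intro!: derivative_eq_intros)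
  hence "((\<lambda>r. \<bar>2 * \<sigma> * r\<bar> * (?g r powr \<mu> / exp (?g r))) has_integral Gamma (\<mu> + 1)) {\<bar>s\<bar><..}"
    by simp
  hence "((\<lambda>r. exp (- \<sigma> * s\<^sup>2) * (\<sigma> powr (- \<mu> - 1) / 2) * (\<bar>2 * \<sigma> * r\<bar> * (?g r powr \<mu> / exp (?g r))))
           has_integral exp (- \<sigma> * s\<^sup>2) * (\<sigma> powr (- \<mu> - 1) / 2) * Gamma (\<mu> + 1)) {\<bar>s\<bar><..}"
    by (rule has_integral_mult_right)
  hence "((\<lambda>r. exp (- \<sigma> * r\<^sup>2) * r * (r\<^sup>2 - s\<^sup>2) powr \<mu>)
           has_integral exp (- \<sigma> * s\<^sup>2) * (\<sigma> powr (- \<mu> - 1) / 2) * Gamma (\<mu> + 1)) {\<bar>s\<bar><..}"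
  proof (rule has_integral_eq[rotated])
    fix r :: real assume "r \<in> {\<bar>s\<bar><..}"
    hence r: "r > 0" "r\<^sup>2 - s\<^sup>2 > 0" using sq by auto
    have "\<sigma> powr (- \<mu> - 1) * (\<sigma> * \<sigma> powr \<mu>) = 1"
      using \<sigma> powr_add[of \<sigma> 1 \<mu>] powr_add[of \<sigma> "- \<mu> - 1" "1 + \<mu>"] by simp
    moreover have "exp (- \<sigma> * s\<^sup>2) / exp (?g r) = exp (- \<sigma> * r\<^sup>2)"
      by (simp add: algebra_simps flip: exp_diff)
    moreover have "exp (- \<sigma> * s\<^sup>2) * (\<sigma> powr (- \<mu> - 1) / 2) * (\<bar>2 * \<sigma> * r\<bar> * (?g r powr \<mu> / exp (?g r)))
       = (\<sigma> powr (- \<mu> - 1) * (\<sigma> * \<sigma> powr \<mu>)) * (exp (- \<sigma> * s\<^sup>2) / exp (?g r)) * r * (r\<^sup>2 - s\<^sup>2) powr \<mu>"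
      using r \<sigma> by (simp add: powr_mult abs_mult)
    ultimately show "exp (- \<sigma> * s\<^sup>2) * (\<sigma> powr (- \<mu> - 1) / 2) * (\<bar>2 * \<sigma> * r\<bar> * (?g r powr \<mu> / exp (?g r)))
       = exp (- \<sigma> * r\<^sup>2) * r * (r\<^sup>2 - s\<^sup>2) powr \<mu>" by simp
  qed
  thus ?thesis
    by (intro has_bochner_integral_nonneg_has_integral) (auto simp: mult_ac)
qed

lemma cis_gaussian_integral:
  assumes \<sigma>: "\<sigma> > 0"
  shows "(LBINT s. exp (- \<sigma> * s\<^sup>2) *\<^sub>R cis (- s)) = of_real (sqrt pi * \<sigma> powr (-1/2) * exp (- 1 / (4 * \<sigma>)))"
proof -
  \<comment> \<open>With this c the substitution x = c s turns x^2/2 into \<sigma> s^2 and the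
    frequency -1/c into -1, so the characteristic function of the standard normal law
    applies.\<close>
  define c where "c = sqrt (2 * \<sigma>)"
  have c: "c > 0" "c\<^sup>2 = 2 * \<sigma>" using \<sigma> by (auto simp: c_def)
  have "complex_of_real (exp (- (1 / (4 * \<sigma>)))) = char std_normal_distribution (- 1 / c)"
    using c by (simp add: char_std_normal_distribution power_divide)
  also have "\<dots> = (LBINT x. std_normal_density x *\<^sub>R iexp (- 1 / c * x))"
    unfolding char_def by (subst integral_density) (auto simp: normal_density_nonneg)
  also have "\<dots> = c *\<^sub>R (LBINT s. std_normal_density (0 + c * s) *\<^sub>R iexp (- 1 / c * (0 + c * s)))"
    using c by (subst lborel_integral_real_affine[of c _ 0]) auto
  also have "\<dots> = c *\<^sub>R (LBINT s. (1 / sqrt (2 * pi)) *\<^sub>R (exp (- \<sigma> * s\<^sup>2) *\<^sub>R cis (- s)))"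
    using c by (simp add: normal_density_def cis_conv_exp power_mult_distrib)
  also have "\<dots> = (c / sqrt (2 * pi)) *\<^sub>R (LBINT s. exp (- \<sigma> * s\<^sup>2) *\<^sub>R cis (- s))"
    unfolding integral_scaleR_right by simp
  finally have *: "complex_of_real (exp (- (1 / (4 * \<sigma>)))) = (c / sqrt (2 * pi)) *\<^sub>R (LBINT s. exp (- \<sigma> * s\<^sup>2) *\<^sub>R cis (- s))" .
  have "sqrt (2 * pi) / c = sqrt pi * \<sigma> powr (-1/2)"
    using \<sigma> by (simp add: c_def real_sqrt_mult powr_minus powr_half_sqrt field_simps)
  moreover have "(sqrt (2 * pi) / c) *\<^sub>R complex_of_real (exp (- (1 / (4 * \<sigma>)))) = (LBINT s. exp (- \<sigma> * s\<^sup>2) *\<^sub>R cis (- s))"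
    unfolding * using c by simp
  ultimately show ?thesis by (simp add: scaleR_conv_of_real)
qed

lemma bessel_int_gaussian:
  assumes \<sigma>: "\<sigma> > 0" and \<mu>: "\<mu> > -1"
  shows "(LBINT r:{0<..}. (exp (- \<sigma> * r\<^sup>2) * r) *\<^sub>R bessel_int \<mu> 1 r) =
         of_real (sqrt pi * Gamma (\<mu> + 1) / 2 * \<sigma> powr (- \<mu> - 3 / 2) * exp (- 1 / (4 * \<sigma>)))"
proof -
  \<comment> \<open>For s = 0 and exponent \<mu> + 1/2 the Gaussian integral above has integrand
    exp(-\<sigma> r^2) r^(2\<mu>+2), the integrability that the exchange requires.\<close>
  have "integrable lborel (\<lambda>r. indicator {0<..} r *\<^sub>R (exp (- \<sigma> * r\<^sup>2) * r * (r\<^sup>2) powr (\<mu> + 1/2)))"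
    using has_bochner_integral_gaussian_powr[OF \<sigma>, of "\<mu> + 1/2" 0] \<mu> by (simp add: has_bochner_integral_iff)
  moreover have "(\<lambda>r. indicator {0<..} r *\<^sub>R (exp (- \<sigma> * r\<^sup>2) * r * (r\<^sup>2) powr (\<mu> + 1/2)))
     = (\<lambda>r. indicator {0<..} r *\<^sub>R (exp (- \<sigma> * r\<^sup>2) * r powr (2 * \<mu> + 2)))"
  proof
    fix r
    show "indicator {0<..} r *\<^sub>R (exp (- \<sigma> * r\<^sup>2) * r * (r\<^sup>2) powr (\<mu> + 1/2))
       = indicator {0<..} r *\<^sub>R (exp (- \<sigma> * r\<^sup>2) * r powr (2 * \<mu> + 2))"
    proof (cases "r > 0")
      case True
      hence "r powr (2 * \<mu> + 2) = r * (r\<^sup>2) powr (\<mu> + 1/2)"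
        using powr_add[of r 1 "2 * \<mu> + 1"] powr_powr[of r 2 "\<mu> + 1/2"] by (simp add: powr_numeral algebra_simps)
      thus ?thesis by simp
    qed simp
  qed
  ultimately have "set_integrable lborel {0<..} (\<lambda>r. exp (- \<sigma> * r\<^sup>2) * r powr (2 * \<mu> + 2))"
    unfolding set_integrable_def by simp
  hence "(LBINT r:{0<..}. (exp (- \<sigma> * r\<^sup>2) * r) *\<^sub>R bessel_int \<mu> 1 r) =
         (LBINT s. (LBINT r:{\<bar>s\<bar><..}. exp (- \<sigma> * r\<^sup>2) * r * (r\<^sup>2 - s\<^sup>2) powr \<mu>) *\<^sub>R cis (- (1 * s)))"
    using \<mu> by (intro bessel_int_Fubini) auto
  also have "\<dots> = (LBINT s. (Gamma (\<mu> + 1) * \<sigma> powr (- \<mu> - 1) / 2) *\<^sub>R (exp (- \<sigma> * s\<^sup>2) *\<^sub>R cis (- s)))"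
    unfolding set_lebesgue_integral_def
      has_bochner_integral_integral_eq[OF has_bochner_integral_gaussian_powr[OF \<sigma> \<mu>]]
    by (simp add: mult_ac)
  also have "\<dots> = (Gamma (\<mu> + 1) * \<sigma> powr (- \<mu> - 1) / 2) *\<^sub>R of_real (sqrt pi * \<sigma> powr (-1/2) * exp (- 1 / (4 * \<sigma>)))"
    unfolding integral_scaleR_right cis_gaussian_integral[OF \<sigma>] ..
  also have "\<dots> = of_real (sqrt pi * Gamma (\<mu> + 1) / 2 * (\<sigma> powr (- \<mu> - 1) * \<sigma> powr (-1/2)) * exp (- 1 / (4 * \<sigma>)))"
    by (simp add: scaleR_conv_of_real)
  also have "\<sigma> powr (- \<mu> - 1) * \<sigma> powr (-1/2) = \<sigma> powr (- \<mu> - 3 / 2)"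
    by (subst powr_add[symmetric]) (rule arg_cong2[where f = "(powr)"], auto)
  finally show ?thesis .
qed

section \<open>Fourier transforms of balls\<close>

lemma nn_integral_lborel_translate:
  fixes h :: "'a::euclidean_space \<Rightarrow> ennreal"
  assumes [measurable]: "h \<in> borel_measurable borel"
  shows "(\<integral>\<^sup>+z. h (c + z) \<partial>lborel) = (\<integral>\<^sup>+z. h z \<partial>lborel)"
proof -
  have "(\<integral>\<^sup>+z. h z \<partial>lborel) = (\<integral>\<^sup>+z. h z \<partial>distr lborel borel ((+) c))"
    by (simp add: lborel_distr_plus)
  also have "\<dots> = (\<integral>\<^sup>+z. h (c + z) \<partial>lborel)"
    by (subst nn_integral_distr) auto
  finally show ?thesis ..
qed

text \<open>Allows the frequency x to be rotated onto a coordinate axis in the Fourier transform of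
  a ball.\<close>

lemma lborel_distr_orthogonal:
  fixes f :: "'a::euclidean_space \<Rightarrow> 'a"
  assumes f: "orthogonal_transformation f"
  shows "distr lborel borel f = lborel"
proof (rule measure_eqI)
  have lin: "linear f" and bij: "bij f"
    using f orthogonal_transformation_bij orthogonal_transformation_linear by auto
  have [measurable]: "f \<in> borel_measurable borel"
    using linear_continuous_on[of f UNIV] lin
    by (intro borel_measurable_continuous_onI) (auto simp: linear_conv_bounded_linear)
  fix A :: "'a set" assume "A \<in> sets (distr lborel borel f)"
  hence [measurable]: "A \<in> sets borel" by simp
  let ?Q = "ball 0 1 :: 'a set"
  let ?q = "emeasure lborel ?Q"
  have [measurable, simp]: "?Q \<in> sets borel" by (rule borel_open) simp
  \<comment> \<open>Both sides are translation invariant and agree on the unit ball \<open>Q\<close>, so it is enough to evaluate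
    the double integral of \<open>1\<^sub>A(x) 1\<^sub>Q(f z - x)\<close> in both orders.\<close>
  have "emeasure lborel A * ?q = (\<integral>\<^sup>+x. indicator A x * ?q \<partial>lborel)"
    by (simp add: nn_integral_multc)
  also have "\<dots> = (\<integral>\<^sup>+x. \<integral>\<^sup>+z. indicator A x * indicator ?Q (f z - x) \<partial>lborel \<partial>lborel)"
  proof (rule nn_integral_cong)
    fix x :: 'a
    obtain y where y: "f y = x" using bij by (metis bij_pointE)
    have "(\<integral>\<^sup>+z. indicator ?Q (f z - x) \<partial>lborel) = (\<integral>\<^sup>+z. indicator ?Q (- y + z) \<partial>lborel)"
    proof (rule nn_integral_cong)
      fix z
      have "norm (f z - x) = norm (z - y)"
        using y lin f by (metis linear_diff orthogonal_transformation_norm)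
      thus "indicator ?Q (f z - x) = (indicator ?Q (- y + z) :: ennreal)"
        by (simp add: indicator_def)
    qed
    also have "\<dots> = ?q" by (subst nn_integral_lborel_translate) auto
    finally show "indicator A x * ?q = (\<integral>\<^sup>+z. indicator A x * indicator ?Q (f z - x) \<partial>lborel)"
      by (subst nn_integral_cmult) auto
  qed
  also have "\<dots> = (\<integral>\<^sup>+z. \<integral>\<^sup>+x. indicator A x * indicator ?Q (f z - x) \<partial>lborel \<partial>lborel)"
    by (rule lborel_pair.Fubini') measurable
  also have "\<dots> = (\<integral>\<^sup>+z. \<integral>\<^sup>+x. indicator A (f z + x) * indicator ?Q x \<partial>lborel \<partial>lborel)"
  proof (rule nn_integral_cong)
    fix z
    show "(\<integral>\<^sup>+x. indicator A x * indicator ?Q (f z - x) \<partial>lborel) =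
          (\<integral>\<^sup>+x. indicator A (f z + x) * indicator ?Q x \<partial>lborel)"
      by (subst nn_integral_lborel_translate[where c = "f z", symmetric])
         (auto intro!: nn_integral_cong simp: indicator_def)
  qed
  also have "\<dots> = (\<integral>\<^sup>+x. \<integral>\<^sup>+z. indicator A (f z + x) * indicator ?Q x \<partial>lborel \<partial>lborel)"
    by (rule lborel_pair.Fubini') measurable
  also have "\<dots> = (\<integral>\<^sup>+x. emeasure (distr lborel borel f) A * indicator ?Q x \<partial>lborel)"
  proof (rule nn_integral_cong)
    fix x :: 'a
    obtain y where y: "f y = x" using bij by (metis bij_pointE)
    have "(\<integral>\<^sup>+z. indicator A (f z + x) \<partial>lborel) = (\<integral>\<^sup>+z. indicator A (f (y + z)) \<partial>lborel)"
      using y lin by (simp add: linear_add add.commute)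
    also have "\<dots> = (\<integral>\<^sup>+z. indicator A (f z) \<partial>lborel)"
      by (subst nn_integral_lborel_translate) auto
    also have "\<dots> = (\<integral>\<^sup>+z. indicator A z \<partial>distr lborel borel f)"
      by (subst nn_integral_distr) auto
    also have "\<dots> = emeasure (distr lborel borel f) A"
      by simp
    finally show "(\<integral>\<^sup>+z. indicator A (f z + x) * indicator ?Q x \<partial>lborel) = emeasure (distr lborel borel f) A * indicator ?Q x"
      by (subst nn_integral_multc) auto
  qed
  also have "\<dots> = emeasure (distr lborel borel f) A * ?q"
    by (simp add: nn_integral_cmult)
  finally have "emeasure lborel A * ?q = emeasure (distr lborel borel f) A * ?q" .
  moreover have "?q \<noteq> 0" "?q \<noteq> top"
    using unit_ball_vol_pos[of "real DIM('a)"] by (simp_all add: emeasure_ball less_imp_neq[symmetric] del: unit_ball_vol_pos)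
  ultimately show "emeasure (distr lborel borel f) A = emeasure lborel A"
    by (metis ennreal_mult_divide_eq)
qed simp

text \<open>The density at s is the volume of the slice of the ball at height s, a ball of radius
  sqrt(r^2 - s^2) in one dimension less. \<open>lborel\<close> is read as a product measure over
  \<open>Basis\<close> and the coordinate b is split off; the slice then lives over the index set
  \<open>Basis - {b}\<close> and not in a type of its own.\<close>

lemma distr_inner_Basis_ball:
  fixes b :: "'a::euclidean_space"
  assumes b: "b \<in> Basis" and r: "r > 0"
  shows "distr (density lborel (indicator (cball 0 r))) borel (\<lambda>\<xi>. \<xi> \<bullet> b) =
         density lborel (\<lambda>s. ennreal (unit_ball_vol (real DIM('a) - 1) *
            (indicator {-r..r} s * (r\<^sup>2 - s\<^sup>2) powr ((real DIM('a) - 1) / 2))))"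
proof (rule measure_eqI)
  fix A assume "A \<in> sets (distr (density lborel (indicator (cball (0::'a) r))) borel (\<lambda>\<xi>. \<xi> \<bullet> b))"
  hence [measurable]: "A \<in> sets borel" by simp
  have [measurable, simp]: "cball (0 :: 'a) r \<in> sets borel" by (rule borel_closed) simp
  interpret product_sigma_finite "\<lambda>_. lborel :: real measure"
    by standard
  define B :: "'a set" where "B = Basis - {b}"
  have B: "finite B" "b \<notin> B" "insert b B = Basis" using b by (auto simp: B_def)
  have card_B: "real (card B) = real DIM('a) - 1"
    using B by (metis One_nat_def add_diff_cancel_left' card_insert_disjoint of_nat_1 of_nat_Suc plus_1_eq_Suc add.commute diff_add_cancel eq_diff_eq)
  let ?P = "Pi\<^sub>M (insert b B) (\<lambda>_. lborel :: real measure)"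
  define S where "S = {f :: 'a \<Rightarrow> real. sqrt (\<Sum>i\<in>insert b B. (f i)\<^sup>2) \<le> r} \<inter> space ?P"
  have [measurable]: "S \<in> sets ?P"
    unfolding S_def using B(1) by measurable
  have "emeasure (distr (density lborel (indicator (cball 0 r))) borel (\<lambda>\<xi>. \<xi> \<bullet> b)) A
     = (\<integral>\<^sup>+\<xi>. indicator (cball 0 r) \<xi> * indicator A (\<xi> \<bullet> b) \<partial>(lborel :: 'a measure))"
  proof -
    have [measurable]: "(\<lambda>\<xi>::'a. \<xi> \<bullet> b) -` A \<in> sets borel"
      using measurable_sets[of "\<lambda>\<xi>::'a. \<xi> \<bullet> b" borel borel A] by simp
    have "emeasure (distr (density lborel (indicator (cball 0 r))) borel (\<lambda>\<xi>. \<xi> \<bullet> b)) A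
       = emeasure (density lborel (indicator (cball 0 r))) ((\<lambda>\<xi>::'a. \<xi> \<bullet> b) -` A)"
      by (subst emeasure_distr) auto
    also have "\<dots> = (\<integral>\<^sup>+\<xi>. indicator (cball 0 r) \<xi> * indicator ((\<lambda>\<xi>. \<xi> \<bullet> b) -` A) \<xi> \<partial>(lborel :: 'a measure))"
      by (subst emeasure_density) auto
    finally show ?thesis by (simp add: indicator_def)
  qed
  also have "\<dots> = (\<integral>\<^sup>+f. indicator (cball 0 r) (\<Sum>i\<in>Basis. f i *\<^sub>R i :: 'a) * indicator A ((\<Sum>i\<in>Basis. f i *\<^sub>R i) \<bullet> b) \<partial>Pi\<^sub>M Basis (\<lambda>_. lborel))"
    by (subst lborel_eq, subst nn_integral_distr) auto
  also have "\<dots> = (\<integral>\<^sup>+f. indicator S f * indicator A (f b) \<partial>?P)"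
  proof -
    have "indicator (cball 0 r) (\<Sum>i\<in>Basis. f i *\<^sub>R i :: 'a) * indicator A ((\<Sum>i\<in>Basis. f i *\<^sub>R i) \<bullet> b)
       = (indicator S f * indicator A (f b) :: ennreal)" if "f \<in> space ?P" for f :: "'a \<Rightarrow> real"
    proof -
      have "norm (\<Sum>i\<in>Basis. f i *\<^sub>R i :: 'a) = sqrt (\<Sum>i\<in>Basis. (f i)\<^sup>2)"
        by (subst norm_eq_sqrt_inner, subst euclidean_inner) (simp add: power2_eq_square)
      thus ?thesis using b that B by (auto simp: S_def indicator_def)
    qed
    thus ?thesis unfolding B(3) by (intro nn_integral_cong) (auto simp: B(3))
  qed
  also have "\<dots> = (\<integral>\<^sup>+y. \<integral>\<^sup>+x. indicator S (x(b := y)) * indicator A ((x(b := y)) b) \<partial>Pi\<^sub>M B (\<lambda>_. lborel) \<partial>lborel)"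
    by (rule product_nn_integral_insert_rev[OF B(1,2)]) measurable
  also have "\<dots> = (\<integral>\<^sup>+y. indicator A y * (indicator {-r..r} y * emeasure (Pi\<^sub>M B (\<lambda>_. lborel))
      ({f. sqrt (\<Sum>i\<in>B. (f i)\<^sup>2) \<le> sqrt (r\<^sup>2 - y\<^sup>2)} \<inter> space (Pi\<^sub>M B (\<lambda>_. lborel)))) \<partial>lborel)"
  proof (rule nn_integral_cong)
    fix y :: real
    have *: "indicator S (x(b := y)) * indicator A ((x(b := y)) b) = indicator A y * (indicator {-r..r} y *
       indicator ({f. sqrt (\<Sum>i\<in>B. (f i)\<^sup>2) \<le> sqrt (r\<^sup>2 - y\<^sup>2)} \<inter> space (Pi\<^sub>M B (\<lambda>_. lborel))) x :: ennreal)"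
      if x: "x \<in> space (Pi\<^sub>M B (\<lambda>_. lborel))" for x
    proof -
      have "(\<Sum>i\<in>insert b B. ((x(b := y)) i)\<^sup>2) = y\<^sup>2 + (\<Sum>i\<in>B. (x i)\<^sup>2)"
        using B by (subst sum.insert) (auto intro!: sum.cong)
      moreover have "x(b := y) \<in> space ?P" using x by (auto simp: space_PiM PiE_def extensional_def)
      ultimately have 1: "x(b := y) \<in> S \<longleftrightarrow> y\<^sup>2 + (\<Sum>i\<in>B. (x i)\<^sup>2) \<le> r\<^sup>2"
        using r by (auto simp: S_def real_sqrt_le_iff' sum_nonneg)
      have "\<bar>y\<bar> \<le> r" if "y\<^sup>2 + (\<Sum>i\<in>B. (x i)\<^sup>2) \<le> r\<^sup>2"
      proof -
        have "(\<Sum>i\<in>B. (x i)\<^sup>2) \<ge> 0" by (intro sum_nonneg) auto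
        hence "y\<^sup>2 \<le> r\<^sup>2" using that by linarith
        thus ?thesis using r by (simp add: abs_le_square_iff[symmetric])
      qed
      thus ?thesis using 1 x by (auto simp: indicator_def)
    qed
    have "(\<integral>\<^sup>+x. indicator S (x(b := y)) * indicator A ((x(b := y)) b) \<partial>Pi\<^sub>M B (\<lambda>_. lborel)) =
       (\<integral>\<^sup>+x. indicator A y * (indicator {-r..r} y * indicator ({f. sqrt (\<Sum>i\<in>B. (f i)\<^sup>2) \<le> sqrt (r\<^sup>2 - y\<^sup>2)} \<inter> space (Pi\<^sub>M B (\<lambda>_. lborel))) x) \<partial>Pi\<^sub>M B (\<lambda>_. lborel))"
      by (intro nn_integral_cong *)
    also have "\<dots> = indicator A y * (indicator {-r..r} y * emeasure (Pi\<^sub>M B (\<lambda>_. lborel))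
      ({f. sqrt (\<Sum>i\<in>B. (f i)\<^sup>2) \<le> sqrt (r\<^sup>2 - y\<^sup>2)} \<inter> space (Pi\<^sub>M B (\<lambda>_. lborel))))"
      using B(1) by (simp add: nn_integral_cmult)
    finally show "(\<integral>\<^sup>+x. indicator S (x(b := y)) * indicator A ((x(b := y)) b) \<partial>Pi\<^sub>M B (\<lambda>_. lborel)) = \<dots>" .
  qed
  also have "\<dots> = (\<integral>\<^sup>+s. ennreal (unit_ball_vol (real DIM('a) - 1) *
            (indicator {-r..r} s * (r\<^sup>2 - s\<^sup>2) powr ((real DIM('a) - 1) / 2))) * indicator A s \<partial>lborel)"
  proof (rule nn_integral_cong_AE)
    \<comment> \<open>At the end points the slice has radius 0. In dimension 1 the two sides differ
      there: the slice is a point of measure 1, while \<open>0 powr 0 = 0\<close>.\<close>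
    have "AE y in lborel. y \<notin> {-r,r}"
      by (intro AE_not_in countable_imp_null_set_lborel) auto
    thus "AE y in lborel. indicator A y * (indicator {-r..r} y * emeasure (Pi\<^sub>M B (\<lambda>_. lborel))
          ({f. sqrt (\<Sum>i\<in>B. (f i)\<^sup>2) \<le> sqrt (r\<^sup>2 - y\<^sup>2)} \<inter> space (Pi\<^sub>M B (\<lambda>_. lborel)))) =
       ennreal (unit_ball_vol (real DIM('a) - 1) *
            (indicator {-r..r} y * (r\<^sup>2 - y\<^sup>2) powr ((real DIM('a) - 1) / 2))) * indicator A y"
    proof eventually_elim
      case (elim y)
      show ?case
      proof (cases "y \<in> {-r..r}")
        case True
        hence "\<bar>y\<bar> < r" using elim by auto
        hence y: "r\<^sup>2 - y\<^sup>2 > 0" using power_strict_mono[of "\<bar>y\<bar>" r 2] by simp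
        have "(sqrt (r\<^sup>2 - y\<^sup>2)) ^ card B = (r\<^sup>2 - y\<^sup>2) powr ((real DIM('a) - 1) / 2)"
          using y by (simp add: powr_half_sqrt[symmetric] powr_powr card_B[symmetric] flip: powr_realpow)
        thus ?thesis using True y B(1)
          by (subst emeasure_cball_aux) (auto simp: card_B mult_ac)
      qed auto
    qed
  qed
  also have "\<dots> = emeasure (density lborel (\<lambda>s. ennreal (unit_ball_vol (real DIM('a) - 1) *
            (indicator {-r..r} s * (r\<^sup>2 - s\<^sup>2) powr ((real DIM('a) - 1) / 2))))) A"
    by (subst emeasure_density) auto
  finally show "emeasure (distr (density lborel (indicator (cball 0 r))) borel (\<lambda>\<xi>. \<xi> \<bullet> b)) A = \<dots>" .
qed simp

lemma cis_integral_ball: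
  fixes x :: "real ^ 'n"
  assumes r: "r \<ge> 0"
  shows "(LINT \<xi>|lborel. indicator (cball 0 r) \<xi> *\<^sub>R cis (- (x \<bullet> \<xi>))) =
         unit_ball_vol (real CARD('n) - 1) *\<^sub>R bessel_int ((real CARD('n) - 1) / 2) (norm x) r"
proof (cases "r > 0")
  case True
  have [measurable, simp]: "cball (0 :: real ^ 'n) r \<in> sets borel" by (rule borel_closed) simp
  have [measurable]: "(\<lambda>\<xi>. cis (- (norm x * (\<xi> \<bullet> b)))) \<in> borel_measurable borel" for b :: "real ^ 'n"
    by (intro borel_measurable_continuous_onI continuous_intros)
  obtain b :: "real ^ 'n" where b: "b \<in> Basis" using nonempty_Basis by blast
  \<comment> \<open>Vectors of equal norm are related by an orthogonal map; with f sending x to |x|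
    b the phase depends on one coordinate only.\<close>
  have "norm x = norm (norm x *\<^sub>R b)" using b by simp
  then obtain f where f: "orthogonal_transformation f" "f x = norm x *\<^sub>R b"
    using orthogonal_transformation_exists by blast
  have [measurable]: "f \<in> borel_measurable borel"
    using linear_continuous_on[of f UNIV] orthogonal_transformation_linear[OF f(1)]
    by (intro borel_measurable_continuous_onI) (auto simp: linear_conv_bounded_linear)
  have "(LINT \<xi>|lborel. indicator (cball 0 r) \<xi> *\<^sub>R cis (- (x \<bullet> \<xi>))) =
        (LINT \<xi>|lborel. indicator (cball 0 r) (f \<xi>) *\<^sub>R cis (- (norm x * (f \<xi> \<bullet> b))))"
  proof (rule Bochner_Integration.integral_cong)
    fix \<xi> :: "real ^ 'n"
    have "x \<bullet> \<xi> = f x \<bullet> f \<xi>" using f(1) by (simp add: orthogonal_transformation_def)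
    also have "\<dots> = norm x * (f \<xi> \<bullet> b)" by (simp add: f(2) inner_commute)
    finally show "indicator (cball 0 r) \<xi> *\<^sub>R cis (- (x \<bullet> \<xi>)) = indicator (cball 0 r) (f \<xi>) *\<^sub>R cis (- (norm x * (f \<xi> \<bullet> b)))"
      using f(1) by (auto simp: indicator_def orthogonal_transformation_norm)
  qed simp
  also have "\<dots> = (LINT \<xi>|distr lborel borel f. indicator (cball 0 r) \<xi> *\<^sub>R cis (- (norm x * (\<xi> \<bullet> b))))"
    by (subst integral_distr) (auto intro!: borel_measurable_scaleR)
  also have "\<dots> = (LINT \<xi>|lborel. indicator (cball 0 r) \<xi> *\<^sub>R cis (- (norm x * (\<xi> \<bullet> b))))"
    by (simp add: lborel_distr_orthogonal[OF f(1)])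
  also have "\<dots> = (LINT \<xi>|density lborel (indicator (cball 0 r)). cis (- (norm x * (\<xi> \<bullet> b))))"
  proof -
    have "density lborel (indicator (cball 0 r)) = density lborel (\<lambda>\<xi>. ennreal (indicator (cball (0 :: real ^ 'n) r) \<xi>))"
      by (simp add: ennreal_indicator)
    thus ?thesis by (simp add: integral_density)
  qed
  also have "\<dots> = (LINT s|distr (density lborel (indicator (cball 0 r))) borel (\<lambda>\<xi>. \<xi> \<bullet> b). cis (- (norm x * s)))"
    by (subst integral_distr) auto
  also have "\<dots> = (LBINT s. (unit_ball_vol (real CARD('n) - 1) *
            (indicator {-r..r} s * (r\<^sup>2 - s\<^sup>2) powr ((real CARD('n) - 1) / 2))) *\<^sub>R cis (- (norm x * s)))"
    unfolding distr_inner_Basis_ball[OF b True]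
    by (subst integral_density) (auto simp: intro!: AE_I2 mult_nonneg_nonneg unit_ball_vol_nonneg)
  also have "\<dots> = (LBINT s. unit_ball_vol (real CARD('n) - 1) *\<^sub>R
            (indicator {-r..r} s *\<^sub>R (cis (- (norm x * s)) * complex_of_real ((r\<^sup>2 - s\<^sup>2) powr ((real CARD('n) - 1) / 2)))))"
    by (simp add: scaleR_conv_of_real mult_ac)
  also have "\<dots> = unit_ball_vol (real CARD('n) - 1) *\<^sub>R bessel_int ((real CARD('n) - 1) / 2) (norm x) r"
    unfolding integral_scaleR_right bessel_int_def set_lebesgue_integral_def ..
  finally show ?thesis .
next
  case False
  hence "r = 0" using r by simp
  have "(LINT \<xi>|lborel. indicator (cball 0 r) \<xi> *\<^sub>R cis (- (x \<bullet> \<xi>))) = 0"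
  proof (rule integral_eq_zero_AE)
    have "AE \<xi> in lborel. \<xi> \<notin> {0 :: real ^ 'n}"
      by (intro AE_not_in countable_imp_null_set_lborel) auto
    thus "AE \<xi> in lborel. indicator (cball 0 r) \<xi> *\<^sub>R cis (- (x \<bullet> \<xi>)) = 0"
      by eventually_elim (auto simp: \<open>r = 0\<close>)
  qed
  thus ?thesis by (simp add: \<open>r = 0\<close> bessel_int_nonpos)
qed

section \<open>Fourier transforms of radial functions\<close>

lemma set_integral_deriv_at_top:
  fixes f f' :: "real \<Rightarrow> real"
  assumes deriv: "\<And>\<rho>. \<rho> \<ge> r \<Longrightarrow> (f has_real_derivative f' \<rho>) (at \<rho>)"
    and int: "set_integrable lborel {r..} f'" and lim: "(f \<longlongrightarrow> 0) at_top"
  shows "(LBINT \<rho>:{r..}. f' \<rho>) = - f r"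
proof -
  have "((\<lambda>b. LBINT \<rho>:{r..b}. f' \<rho>) \<longlongrightarrow> (LBINT \<rho>:{r..}. f' \<rho>)) at_top"
    by (rule tendsto_set_lebesgue_integral_at_top[OF _ int]) auto
  moreover have "\<forall>\<^sub>F b in at_top. (LBINT \<rho>:{r..b}. f' \<rho>) = f b - f r"
    using eventually_ge_at_top[of r]
  proof eventually_elim
    case (elim b)
    have "set_integrable lborel {r..b} f'"
      by (rule set_integrable_subset[OF int]) auto
    hence "(LBINT \<rho>:{r..b}. f' \<rho>) = integral {r..b} f'"
      by (rule set_borel_integral_eq_integral)
    moreover have "(f' has_integral f b - f r) {r..b}"
      using elim deriv
      by (intro fundamental_theorem_of_calculus)
         (auto simp: has_real_derivative_iff_has_vector_derivative[symmetric] intro: DERIV_subset)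
    ultimately show ?case by (simp add: integral_unique)
  qed
  ultimately have "((\<lambda>b. f b - f r) \<longlongrightarrow> (LBINT \<rho>:{r..}. f' \<rho>)) at_top"
    by (rule Lim_transform_eventually)
  moreover have "((\<lambda>b. f b - f r) \<longlongrightarrow> 0 - f r) at_top"
    by (intro tendsto_intros lim)
  ultimately have "(LBINT \<rho>:{r..}. f' \<rho>) = 0 - f r"
    by (rule tendsto_unique[OF trivial_limit_at_top_linorder])
  thus ?thesis by simp
qed

text \<open>Integration by parts in the form f(N) = - (integral of f' over [N, \<infinity>)),
  followed by Fubini, so that no boundary term at 0 arises. The measure is general because there are
  two applications: R^d with N the norm and W a character, and the half-line with W(r) = r times
  Poisson's integral. As C \<rho>^q bounds the mass of W on N \<le> \<rho>, \<open>int\<close>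
  yields absolute convergence.\<close>

lemma integral_radial_layers:
  fixes N :: "'a \<Rightarrow> real" and W :: "'a \<Rightarrow> complex" and f f' :: "real \<Rightarrow> real"
  assumes M: "sigma_finite_measure M"
    and [measurable]: "N \<in> borel_measurable M" "W \<in> borel_measurable M" "f \<in> borel_measurable borel" "f' \<in> borel_measurable borel"
    and deriv: "\<And>r. r > 0 \<Longrightarrow> (f has_real_derivative f' r) (at r)"
    and lim: "(f \<longlongrightarrow> 0) at_top"
    and N: "AE \<xi> in M. N \<xi> > 0 \<or> W \<xi> = 0"
    and W: "\<And>\<rho>. \<rho> > 0 \<Longrightarrow> integrable M (\<lambda>\<xi>. indicator {\<xi>. N \<xi> \<le> \<rho>} \<xi> *\<^sub>R W \<xi>)"
           "\<And>\<rho>. \<rho> > 0 \<Longrightarrow> (LINT \<xi>|M. norm (indicator {\<xi>. N \<xi> \<le> \<rho>} \<xi> *\<^sub>R W \<xi>)) \<le> C * \<rho> powr q"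
    and int: "set_integrable lborel {0<..} (\<lambda>\<rho>. f' \<rho> * \<rho> powr q)" and q: "q \<ge> 0"
  shows "(LINT \<xi>|M. f (N \<xi>) *\<^sub>R W \<xi>) =
         - (LBINT \<rho>:{0<..}. f' \<rho> *\<^sub>R (LINT \<xi>|M. indicator {\<xi>. N \<xi> \<le> \<rho>} \<xi> *\<^sub>R W \<xi>))"
proof -
  interpret M: sigma_finite_measure M by fact
  interpret P: pair_sigma_finite lborel M ..
  define F where "F = (\<lambda>(\<rho>, \<xi>). (if 0 < \<rho> \<and> N \<xi> \<le> \<rho> then f' \<rho> else 0) *\<^sub>R W \<xi>)"
  have [measurable]: "F \<in> borel_measurable (lborel \<Otimes>\<^sub>M M)"
    unfolding F_def by measurable
  have F1: "F (\<rho>, \<xi>) = (indicator {0<..} \<rho> * f' \<rho>) *\<^sub>R (indicator {\<xi>. N \<xi> \<le> \<rho>} \<xi> *\<^sub>R W \<xi>)" for \<rho> \<xi>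
    by (auto simp: F_def indicator_def)
  have F2: "F (\<rho>, \<xi>) = complex_of_real (indicator {N \<xi>..} \<rho> *\<^sub>R f' \<rho>) * W \<xi>" if "N \<xi> > 0 \<or> W \<xi> = 0" for \<rho> \<xi>
    using that by (auto simp: F_def indicator_def scaleR_conv_of_real)
  have Fi: "integrable (lborel \<Otimes>\<^sub>M M) F"
  proof (rule P.Fubini_integrable)
    have "integrable M (\<lambda>\<xi>. F (\<rho>, \<xi>))" for \<rho>
    proof (cases "\<rho> > 0")
      case True
      thus ?thesis unfolding F1 using W(1) by (intro integrable_scaleR_right) auto
    qed (simp add: F1)
    thus "AE \<rho> in lborel. integrable M (\<lambda>\<xi>. F (\<rho>, \<xi>))" by simp
    show "integrable lborel (\<lambda>\<rho>. LINT \<xi>|M. norm (F (\<rho>, \<xi>)))"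
    proof (rule Bochner_Integration.integrable_bound)
      show "integrable lborel (\<lambda>\<rho>. C * (indicator {0<..} \<rho> *\<^sub>R \<bar>f' \<rho> * \<rho> powr q\<bar>))"
        using set_integrable_abs[OF int] by (intro integrable_mult_right) (simp add: set_integrable_def)
      show "AE \<rho> in lborel. norm (LINT \<xi>|M. norm (F (\<rho>, \<xi>))) \<le> norm (C * (indicator {0<..} \<rho> *\<^sub>R \<bar>f' \<rho> * \<rho> powr q\<bar>))"
      proof (intro AE_I2)
        fix \<rho>
        have "(LINT \<xi>|M. norm (F (\<rho>, \<xi>))) = (indicator {0<..} \<rho> * \<bar>f' \<rho>\<bar>) * (LINT \<xi>|M. norm (indicator {\<xi>. N \<xi> \<le> \<rho>} \<xi> *\<^sub>R W \<xi>))"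
          unfolding F1 norm_scaleR[of "indicator {0<..} \<rho> * f' \<rho>"] by (simp add: abs_mult)
        also have "norm \<dots> \<le> norm (C * (indicator {0<..} \<rho> *\<^sub>R \<bar>f' \<rho> * \<rho> powr q\<bar>))"
        proof (cases "\<rho> > 0")
          case True
          have "\<bar>f' \<rho>\<bar> * (LINT \<xi>|M. norm (indicator {\<xi>. N \<xi> \<le> \<rho>} \<xi> *\<^sub>R W \<xi>)) \<le> \<bar>f' \<rho>\<bar> * (C * \<rho> powr q)"
            using W(2)[OF True] by (intro mult_left_mono) auto
          also have "\<dots> \<le> \<bar>\<dots>\<bar>" by simp
          finally show ?thesis using True by (simp add: abs_mult mult_ac)
        qed simp
        finally show "norm (LINT \<xi>|M. norm (F (\<rho>, \<xi>))) \<le> norm (C * (indicator {0<..} \<rho> *\<^sub>R \<bar>f' \<rho> * \<rho> powr q\<bar>))" .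
      qed
    qed simp
  qed simp
  \<comment> \<open>On [r, \<infinity>) the factor \<rho>^q is at least r^q because q \<ge> 0, so
    integrability of f' \<rho>^q passes to f' itself.\<close>
  have tail: "(LBINT \<rho>:{r..}. f' \<rho>) = - f r" if r: "r > 0" for r
  proof (rule set_integral_deriv_at_top)
    have "set_integrable lborel {r..} (\<lambda>\<rho>. f' \<rho> * \<rho> powr q)"
      using r by (intro set_integrable_subset[OF int]) auto
    hence "set_integrable lborel {r..} (\<lambda>\<rho>. r powr (- q) * (f' \<rho> * \<rho> powr q))"
      by simp
    thus "set_integrable lborel {r..} f'"
    proof (rule set_integrable_bound)
      show "AE \<rho> in lborel. \<rho> \<in> {r..} \<longrightarrow> norm (f' \<rho>) \<le> norm (r powr (- q) * (f' \<rho> * \<rho> powr q))"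
      proof (intro AE_I2 impI)
        fix \<rho> assume \<rho>: "\<rho> \<in> {r..}"
        have "1 = r powr (- q) * r powr q" using r by (simp flip: powr_add)
        also have "\<dots> \<le> r powr (- q) * \<rho> powr q"
          using r \<rho> q by (intro mult_left_mono powr_mono2) auto
        finally have "\<bar>f' \<rho>\<bar> * 1 \<le> \<bar>f' \<rho>\<bar> * (r powr (- q) * \<rho> powr q)" by (intro mult_left_mono) auto
        thus "norm (f' \<rho>) \<le> norm (r powr (- q) * (f' \<rho> * \<rho> powr q))" by (simp add: abs_mult mult_ac)
      qed
    qed (auto simp: set_borel_measurable_def)
  qed (use r deriv lim in auto)
  have "(LBINT \<rho>:{0<..}. f' \<rho> *\<^sub>R (LINT \<xi>|M. indicator {\<xi>. N \<xi> \<le> \<rho>} \<xi> *\<^sub>R W \<xi>)) = (LBINT \<rho>. (LINT \<xi>|M. F (\<rho>, \<xi>)))"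
    unfolding F1 integral_scaleR_right by (simp add: set_lebesgue_integral_def)
  also have "\<dots> = (LINT \<xi>|M. (LBINT \<rho>. F (\<rho>, \<xi>)))"
    using P.Fubini_integral[of "\<lambda>\<rho> \<xi>. F (\<rho>, \<xi>)"] Fi by (simp add: split_def)
  also have "\<dots> = (LINT \<xi>|M. - (f (N \<xi>) *\<^sub>R W \<xi>))"
  proof (rule Bochner_Integration.integral_cong_AE)
    show eq: "AE \<xi> in M. (LBINT \<rho>. F (\<rho>, \<xi>)) = - (f (N \<xi>) *\<^sub>R W \<xi>)"
      using N
    proof eventually_elim
      case (elim \<xi>)
      show ?case
      proof (cases "W \<xi> = 0")
        case False
        hence "N \<xi> > 0" using elim by simp
        have "(LBINT \<rho>. F (\<rho>, \<xi>)) = complex_of_real (LBINT \<rho>:{N \<xi>..}. f' \<rho>) * W \<xi>"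
          unfolding F2[OF elim] integral_mult_left_zero integral_complex_of_real set_lebesgue_integral_def ..
        thus ?thesis using tail[OF \<open>N \<xi> > 0\<close>] by (simp add: scaleR_conv_of_real)
      qed (simp add: F_def)
    qed
    show "(\<lambda>\<xi>. LBINT \<rho>. F (\<rho>, \<xi>)) \<in> borel_measurable M" by measurable
    show "(\<lambda>\<xi>. - (f (N \<xi>) *\<^sub>R W \<xi>)) \<in> borel_measurable M" by measurable
  qed
  finally show ?thesis by simp
qed

text \<open>One integration by parts: the layers of r times Poisson's integral are its primitives,
  of order \<mu> + 1. The exponent 2\<mu> + 3 comes from the crude bound by the length \<rho> times
  the largest size of the integrand on (0, \<rho>].\<close>

lemma bessel_int_integral_step:
  fixes f f' :: "real \<Rightarrow> real"
  assumes \<mu>: "\<mu> > -1"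
    and [measurable]: "f \<in> borel_measurable borel" "f' \<in> borel_measurable borel"
    and deriv: "\<And>r. r > 0 \<Longrightarrow> (f has_real_derivative f' r) (at r)"
    and lim: "(f \<longlongrightarrow> 0) at_top"
    and int: "set_integrable lborel {0<..} (\<lambda>\<rho>. f' \<rho> * \<rho> powr (2 * \<mu> + 3))"
  shows "(LBINT r:{0<..}. (r * f r) *\<^sub>R bessel_int \<mu> R r) =
         - (LBINT r:{0<..}. f' r *\<^sub>R bessel_int (\<mu> + 1) R r) / of_real (2 * (\<mu> + 1))"
proof -
  define W where "W = (\<lambda>r. indicator {0<..} r *\<^sub>R (r *\<^sub>R bessel_int \<mu> R r))"
  have [measurable]: "W \<in> borel_measurable borel" unfolding W_def by measurable
  define C where "C = 2 * 4 powr \<mu> * Beta (\<mu> + 1) (\<mu> + 1)"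
  have C: "norm (bessel_int \<mu> R r) \<le> C * r powr (2 * \<mu> + 1)" if "r \<ge> 0" for r
    unfolding C_def using norm_bessel_int_le[OF \<mu> that] .
  have "C \<ge> 0" using order_trans[OF norm_ge_zero C[of 1]] by simp
  have bound: "norm (indicator {r. r \<le> \<rho>} r *\<^sub>R W r) \<le> indicator {0..\<rho>} r * (C * \<rho> powr (2 * \<mu> + 2))"
    if \<rho>: "\<rho> > 0" for r \<rho>
  proof (cases "0 < r \<and> r \<le> \<rho>")
    case True
    have "r * norm (bessel_int \<mu> R r) \<le> r * (C * r powr (2 * \<mu> + 1))"
      using C[of r] True by (intro mult_left_mono) auto
    also have "\<dots> = C * r powr (2 * \<mu> + 2)"
      using True powr_add[of r 1 "2 * \<mu> + 1"] by (simp add: add.commute)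
    also have "\<dots> \<le> C * \<rho> powr (2 * \<mu> + 2)"
      using True \<mu> \<open>C \<ge> 0\<close> by (intro mult_left_mono powr_mono2) auto
    finally show ?thesis using True by (simp add: W_def)
  next
    case False
    thus ?thesis using \<open>C \<ge> 0\<close> by (auto simp: W_def indicator_def)
  qed
  have int_bound: "integrable lborel (\<lambda>r. indicator {0..\<rho>} r * (C * \<rho> powr (2 * \<mu> + 2)))" for \<rho> :: real
    by (intro integrable_mult_left integrable_real_indicator) (auto simp: emeasure_lborel_Icc_eq)
  have W_int: "integrable lborel (\<lambda>r. indicator {r. r \<le> \<rho>} r *\<^sub>R W r)" if \<rho>: "\<rho> > 0" for \<rho>
    by (rule Bochner_Integration.integrable_bound[OF int_bound[of \<rho>]])
       (use bound[OF \<rho>] \<open>C \<ge> 0\<close> in \<open>auto intro!: AE_I2 simp: abs_mult\<close>)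
  have W_le: "(LBINT r. norm (indicator {r. r \<le> \<rho>} r *\<^sub>R W r)) \<le> C * \<rho> powr (2 * \<mu> + 3)" if \<rho>: "\<rho> > 0" for \<rho>
  proof -
    have "(LBINT r. norm (indicator {r. r \<le> \<rho>} r *\<^sub>R W r)) \<le> (LBINT r. indicator {0..\<rho>} r * (C * \<rho> powr (2 * \<mu> + 2)))"
      using bound[OF \<rho>] by (intro integral_mono integrable_norm W_int[OF \<rho>] int_bound)
    also have "\<dots> = C * (\<rho> * \<rho> powr (2 * \<mu> + 2))" using \<rho> by simp
    also have "\<rho> * \<rho> powr (2 * \<mu> + 2) = \<rho> powr (2 * \<mu> + 3)"
      using \<rho> powr_add[of \<rho> 1 "2 * \<mu> + 2"] by (simp add: add.commute)
    finally show ?thesis .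
  qed
  have "(LBINT r. f r *\<^sub>R W r) = - (LBINT \<rho>:{0<..}. f' \<rho> *\<^sub>R (LBINT r. indicator {r. r \<le> \<rho>} r *\<^sub>R W r))"
  proof (rule integral_radial_layers[where N = "\<lambda>r. r" and q = "2 * \<mu> + 3" and C = C])
    show "AE r in lborel. 0 < r \<or> W r = 0" by (auto simp: W_def indicator_def)
  qed (use \<mu> deriv lim int W_int W_le in \<open>auto intro: sigma_finite_lborel\<close>)
  also have "(LBINT \<rho>:{0<..}. f' \<rho> *\<^sub>R (LBINT r. indicator {r. r \<le> \<rho>} r *\<^sub>R W r))
     = (LBINT \<rho>:{0<..}. f' \<rho> *\<^sub>R (bessel_int (\<mu> + 1) R \<rho> / of_real (2 * (\<mu> + 1))))"
  proof (rule set_lebesgue_integral_cong)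
    have "(LBINT r. indicator {r. r \<le> \<rho>} r *\<^sub>R W r) = bessel_int (\<mu> + 1) R \<rho> / of_real (2 * (\<mu> + 1))" if "\<rho> > 0" for \<rho>
    proof -
      have "(LBINT r. indicator {r. r \<le> \<rho>} r *\<^sub>R W r) = (LBINT r:{0<..\<rho>}. r *\<^sub>R bessel_int \<mu> R r)"
        unfolding set_lebesgue_integral_def W_def
        by (intro Bochner_Integration.integral_cong) (auto simp: indicator_def)
      thus ?thesis using bessel_int_primitive[OF \<mu>] that by simp
    qed
    thus "\<forall>\<rho>. \<rho> \<in> {0<..} \<longrightarrow> f' \<rho> *\<^sub>R (LBINT r. indicator {r. r \<le> \<rho>} r *\<^sub>R W r) =
        f' \<rho> *\<^sub>R (bessel_int (\<mu> + 1) R \<rho> / of_real (2 * (\<mu> + 1)))" by simp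
  qed simp
  also have "\<dots> = (LBINT \<rho>. (indicator {0<..} \<rho> *\<^sub>R (f' \<rho> *\<^sub>R bessel_int (\<mu> + 1) R \<rho>)) / of_real (2 * (\<mu> + 1)))"
    unfolding set_lebesgue_integral_def
    by (intro Bochner_Integration.integral_cong) (auto simp: scaleR_conv_of_real)
  also have "\<dots> = (LBINT \<rho>:{0<..}. f' \<rho> *\<^sub>R bessel_int (\<mu> + 1) R \<rho>) / of_real (2 * (\<mu> + 1))"
    unfolding set_lebesgue_integral_def by (rule integral_divide_zero)
  also have "(LBINT r. f r *\<^sub>R W r) = (LBINT r:{0<..}. (r * f r) *\<^sub>R bessel_int \<mu> R r)"
    unfolding set_lebesgue_integral_def W_def
    by (intro Bochner_Integration.integral_cong) (auto simp: mult_ac)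
  finally show ?thesis by simp
qed

text \<open>The layers of the norm are balls, whose Fourier transforms are known; the exponent in
  \<open>int\<close> is the growth rate of their volume.\<close>

lemma radial_fourier_step:
  fixes f f' :: "real \<Rightarrow> real" and x :: "real ^ 'n"
  assumes [measurable]: "f \<in> borel_measurable borel" "f' \<in> borel_measurable borel"
    and deriv: "\<And>r. r > 0 \<Longrightarrow> (f has_real_derivative f' r) (at r)"
    and lim: "(f \<longlongrightarrow> 0) at_top"
    and int: "set_integrable lborel {0<..} (\<lambda>\<rho>. f' \<rho> * \<rho> powr (real CARD('n)))"
  shows "(LINT \<xi>|lborel. f (norm \<xi>) *\<^sub>R cis (- (x \<bullet> \<xi>))) =
         - (unit_ball_vol (real CARD('n) - 1) *\<^sub>R
             (LBINT r:{0<..}. f' r *\<^sub>R bessel_int ((real CARD('n) - 1) / 2) (norm x) r))"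
proof -
  have ball: "{\<xi> :: real ^ 'n. norm \<xi> \<le> \<rho>} = cball 0 \<rho>" for \<rho> by auto
  have [measurable]: "(\<lambda>\<xi>. cis (- (x \<bullet> \<xi>))) \<in> borel_measurable borel"
    by (intro borel_measurable_continuous_onI continuous_intros)
  have "(LINT \<xi>|lborel. f (norm \<xi>) *\<^sub>R cis (- (x \<bullet> \<xi>))) = - (LBINT \<rho>:{0<..}. f' \<rho> *\<^sub>R
          (LINT \<xi>|lborel. indicator {\<xi> :: real ^ 'n. norm \<xi> \<le> \<rho>} \<xi> *\<^sub>R cis (- (x \<bullet> \<xi>))))"
  proof (rule integral_radial_layers[where q = "real CARD('n)" and C = "unit_ball_vol (real CARD('n))"])
    have "AE \<xi> in lborel. \<xi> \<notin> {0 :: real ^ 'n}"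
      by (intro AE_not_in countable_imp_null_set_lborel) auto
    thus "AE \<xi> in lborel. norm (\<xi> :: real ^ 'n) > 0 \<or> cis (- (x \<bullet> \<xi>)) = 0"
      by eventually_elim auto
    fix \<rho> :: real assume \<rho>: "\<rho> > 0"
    have fin: "emeasure lborel (cball (0 :: real ^ 'n) \<rho>) = ennreal (unit_ball_vol (real CARD('n)) * \<rho> ^ CARD('n))"
      using \<rho> by (subst emeasure_cball) auto
    show "integrable lborel (\<lambda>\<xi> :: real ^ 'n. indicator {\<xi>. norm \<xi> \<le> \<rho>} \<xi> *\<^sub>R cis (- (x \<bullet> \<xi>)))"
      unfolding ball
    proof (rule Bochner_Integration.integrable_bound)
      show "integrable lborel (indicator (cball (0 :: real ^ 'n) \<rho>) :: _ \<Rightarrow> real)"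
        using fin by (intro integrable_real_indicator) auto
      show "(\<lambda>\<xi> :: real ^ 'n. indicator (cball 0 \<rho>) \<xi> *\<^sub>R cis (- (x \<bullet> \<xi>))) \<in> borel_measurable lborel"
        by (intro borel_measurable_scaleR borel_measurable_indicator) (auto simp: borel_closed)
    qed (auto intro!: AE_I2)
    have "(LINT \<xi>|lborel. norm (indicator {\<xi> :: real ^ 'n. norm \<xi> \<le> \<rho>} \<xi> *\<^sub>R cis (- (x \<bullet> \<xi>)))) =
       (LINT \<xi>|lborel. indicator (cball (0 :: real ^ 'n) \<rho>) \<xi>)"
      unfolding ball by simp
    also have "\<dots> = unit_ball_vol (real CARD('n)) * \<rho> powr (real CARD('n))"
      using fin \<rho> by (simp add: measure_def powr_realpow)
    finally show "(LINT \<xi>|lborel. norm (indicator {\<xi> :: real ^ 'n. norm \<xi> \<le> \<rho>} \<xi> *\<^sub>R cis (- (x \<bullet> \<xi>))))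
         \<le> unit_ball_vol (real CARD('n)) * \<rho> powr (real CARD('n))" by simp
  qed (use deriv lim int in \<open>auto intro: sigma_finite_lborel\<close>)
  also have "(LBINT \<rho>:{0<..}. f' \<rho> *\<^sub>R (LINT \<xi>|lborel. indicator {\<xi> :: real ^ 'n. norm \<xi> \<le> \<rho>} \<xi> *\<^sub>R cis (- (x \<bullet> \<xi>))))
     = (LBINT \<rho>:{0<..}. unit_ball_vol (real CARD('n) - 1) *\<^sub>R (f' \<rho> *\<^sub>R bessel_int ((real CARD('n) - 1) / 2) (norm x) \<rho>))"
    unfolding ball by (rule set_lebesgue_integral_cong) (auto simp: cis_integral_ball)
  also have "\<dots> = unit_ball_vol (real CARD('n) - 1) *\<^sub>R
             (LBINT r:{0<..}. f' r *\<^sub>R bessel_int ((real CARD('n) - 1) / 2) (norm x) r)"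
    unfolding set_lebesgue_integral_def by (subst integral_scaleR_right[symmetric]) (simp add: mult_ac)
  finally show ?thesis .
qed

text \<open>The first integration by parts produces the order (d-1)/2 and only the later ones raise
  it, so j + 1 derivatives go with the order (d-1)/2 + j. The constant starts as the volume of the
  unit ball in dimension d - 1; each further step divides it by 2(\<mu>+1), which the functional
  equation of \<Gamma> absorbs.\<close>

lemma radial_fourier_iterated:
  fixes F :: "nat \<Rightarrow> real \<Rightarrow> real" and x :: "real ^ 'n"
  assumes meas [measurable]: "\<And>j. j \<le> k \<Longrightarrow> F j \<in> borel_measurable borel"
    and deriv: "\<And>j r. j < k \<Longrightarrow> r > 0 \<Longrightarrow> (F j has_real_derivative - (r * F (Suc j) r)) (at r)"
    and lim: "\<And>j. j < k \<Longrightarrow> (F j \<longlongrightarrow> 0) at_top"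
    and int: "\<And>j. j < k \<Longrightarrow> set_integrable lborel {0<..} (\<lambda>r. r * F (Suc j) r * r powr (real CARD('n) + 2 * real j))"
    and j: "j < k"
  shows "(LINT \<xi>|lborel. F 0 (norm \<xi>) *\<^sub>R cis (- (x \<bullet> \<xi>))) =
         (pi powr ((real CARD('n) - 1) / 2) / (2 ^ j * Gamma ((real CARD('n) - 1) / 2 + real j + 1))) *\<^sub>R
           (LBINT r:{0<..}. (r * F (Suc j) r) *\<^sub>R bessel_int ((real CARD('n) - 1) / 2 + real j) (norm x) r)"
  using j
proof (induction j)
  case 0
  have "(LINT \<xi>|lborel. F 0 (norm \<xi>) *\<^sub>R cis (- (x \<bullet> \<xi>))) =
         - (unit_ball_vol (real CARD('n) - 1) *\<^sub>R
             (LBINT r:{0<..}. (- (r * F (Suc 0) r)) *\<^sub>R bessel_int ((real CARD('n) - 1) / 2) (norm x) r))"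
  proof (rule radial_fourier_step)
    show "set_integrable lborel {0<..} (\<lambda>\<rho>. - (\<rho> * F (Suc 0) \<rho>) * \<rho> powr real CARD('n))"
      using int[OF 0] by (simp add: set_integrable_def)
    show "F 0 \<in> borel_measurable borel" using meas[of 0] by simp
    have "F (Suc 0) \<in> borel_measurable borel" using meas[of "Suc 0"] 0 by simp
    thus "(\<lambda>r. - (r * F (Suc 0) r)) \<in> borel_measurable borel" by measurable
  qed (use 0 deriv lim in auto)
  thus ?case by (simp add: unit_ball_vol_def set_lebesgue_integral_def)
next
  case (Suc j)
  let ?\<mu> = "(real CARD('n) - 1) / 2 + real j"
  have card: "real CARD('n) \<ge> 1" by (simp add: Suc_leI)
  have \<mu>: "?\<mu> > -1" using card by (simp add: field_simps)
  have "(LBINT r:{0<..}. (r * F (Suc j) r) *\<^sub>R bessel_int ?\<mu> (norm x) r) =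
     - (LBINT r:{0<..}. (- (r * F (Suc (Suc j)) r)) *\<^sub>R bessel_int (?\<mu> + 1) (norm x) r) / of_real (2 * (?\<mu> + 1))"
  proof (rule bessel_int_integral_step[OF \<mu>])
    have eq: "2 * ?\<mu> + 3 = real CARD('n) + 2 * real (Suc j)" by (simp add: field_simps)
    show "set_integrable lborel {0<..} (\<lambda>\<rho>. - (\<rho> * F (Suc (Suc j)) \<rho>) * \<rho> powr (2 * ?\<mu> + 3))"
      unfolding eq using int[OF Suc.prems] by (simp add: set_integrable_def)
    show "F (Suc j) \<in> borel_measurable borel" using meas[of "Suc j"] Suc.prems by simp
    have "F (Suc (Suc j)) \<in> borel_measurable borel" using meas[of "Suc (Suc j)"] Suc.prems by simp
    thus "(\<lambda>r. - (r * F (Suc (Suc j)) r)) \<in> borel_measurable borel" by measurable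
  qed (use Suc.prems deriv lim in auto)
  also have "\<dots> = (1 / (2 * (?\<mu> + 1))) *\<^sub>R (LBINT r:{0<..}. (r * F (Suc (Suc j)) r) *\<^sub>R bessel_int (?\<mu> + 1) (norm x) r)"
    by (simp add: scaleR_conv_of_real set_lebesgue_integral_def)
  finally have *: "(LBINT r:{0<..}. (r * F (Suc j) r) *\<^sub>R bessel_int ?\<mu> (norm x) r) = \<dots>" .
  have "Gamma (?\<mu> + 1 + 1) = (?\<mu> + 1) * Gamma (?\<mu> + 1)"
    using \<mu> by (intro Gamma_plus1) (auto simp: nonpos_Ints_def)
  moreover have "?\<mu> + 1 \<noteq> 0" using \<mu> by simp
  ultimately have "pi powr ((real CARD('n) - 1) / 2) / (2 ^ j * Gamma (?\<mu> + 1)) * (1 / (2 * (?\<mu> + 1)))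
      = pi powr ((real CARD('n) - 1) / 2) / (2 ^ Suc j * Gamma (?\<mu> + 1 + 1))"
    by simp
  thus ?case using Suc.IH Suc.prems unfolding * by (simp add: add_ac)
qed

section \<open>Asymptotics of radial Fourier transforms\<close>

text \<open>With c = r^2 this writes r^(-2a) as a mixture of the Gaussians exp(-\<sigma> r^2) with
  density \<sigma>^(a-1)/\<Gamma>(a).\<close>

lemma has_bochner_integral_Gamma_scale:
  fixes a c :: real
  assumes a: "a > 0" and c: "c > 0"
  shows "has_bochner_integral lborel (\<lambda>\<sigma>. indicator {0<..} \<sigma> *\<^sub>R (\<sigma> powr (a - 1) * exp (- \<sigma> * c)))
           (Gamma a * c powr (- a))"
proof -
  have img: "(\<lambda>\<sigma>. c * \<sigma>) ` {0<..} = {0<..}"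
  proof (intro set_eqI iffI)
    fix v :: real assume "v \<in> {0<..}"
    thus "v \<in> (\<lambda>\<sigma>. c * \<sigma>) ` {0<..}" using c by (intro image_eqI[of _ _ "v / c"]) auto
  qed (use c in auto)
  have "inj_on (\<lambda>\<sigma>. c * \<sigma>) {0<..}" using c by (auto simp: inj_on_def)
  hence "((\<lambda>\<sigma>. \<bar>c\<bar> * ((c * \<sigma>) powr (a - 1) / exp (c * \<sigma>))) has_integral Gamma a) {0<..}"
    using a img by (intro Gamma_integral_substitution) (auto intro!: derivative_eq_intros)
  hence "((\<lambda>\<sigma>. c powr (- a) * (\<bar>c\<bar> * ((c * \<sigma>) powr (a - 1) / exp (c * \<sigma>)))) has_integral c powr (- a) * Gamma a) {0<..}"
    by (rule has_integral_mult_right)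
  hence "((\<lambda>\<sigma>. \<sigma> powr (a - 1) * exp (- \<sigma> * c)) has_integral Gamma a * c powr (- a)) {0<..}"
  proof (subst mult.commute, rule has_integral_eq[rotated])
    fix \<sigma> :: real assume "\<sigma> \<in> {0<..}"
    hence "c powr (- a) * (\<bar>c\<bar> * ((c * \<sigma>) powr (a - 1) / exp (c * \<sigma>)))
       = (c powr (- a) * c powr 1 * c powr (a - 1)) * (\<sigma> powr (a - 1) * exp (- \<sigma> * c))"
      using c by (simp add: powr_mult exp_minus field_simps)
    also have "c powr (- a) * c powr 1 * c powr (a - 1) = 1"
      using c by (simp only: powr_add[symmetric]) simp
    finally show "c powr (- a) * (\<bar>c\<bar> * ((c * \<sigma>) powr (a - 1) / exp (c * \<sigma>))) = \<sigma> powr (a - 1) * exp (- \<sigma> * c)"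
      by simp
  qed
  thus ?thesis by (intro has_bochner_integral_nonneg_has_integral) auto
qed

text \<open>The integral that remains of the mixture once r has been integrated out; v =
  1/(4\<sigma>) makes it Euler's integral.\<close>

lemma has_bochner_integral_Gamma_inverse:
  fixes b :: real
  assumes b: "b > 0"
  shows "has_bochner_integral lborel (\<lambda>\<sigma>. indicator {0<..} \<sigma> *\<^sub>R (\<sigma> powr (- b - 1) * exp (- 1 / (4 * \<sigma>))))
           (4 powr b * Gamma b)"
proof -
  let ?g = "\<lambda>\<sigma> :: real. 1 / (4 * \<sigma>)"
  have img: "?g ` {0<..} = {0<..}"
  proof (intro set_eqI iffI)
    fix v :: real assume "v \<in> {0<..}"
    thus "v \<in> ?g ` {0<..}" by (intro image_eqI[of _ _ "1 / (4 * v)"]) auto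
  qed auto
  have "inj_on ?g {0<..}" by (auto simp: inj_on_def)
  hence "((\<lambda>\<sigma>. \<bar>- 1 / (4 * \<sigma>\<^sup>2)\<bar> * (?g \<sigma> powr (b - 1) / exp (?g \<sigma>))) has_integral Gamma b) {0<..}"
    using b img by (intro Gamma_integral_substitution)
       (auto intro!: derivative_eq_intros simp: power2_eq_square field_simps)
  hence "((\<lambda>\<sigma>. 4 powr b * (\<bar>- 1 / (4 * \<sigma>\<^sup>2)\<bar> * (?g \<sigma> powr (b - 1) / exp (?g \<sigma>)))) has_integral 4 powr b * Gamma b) {0<..}"
    by (rule has_integral_mult_right)
  hence "((\<lambda>\<sigma>. \<sigma> powr (- b - 1) * exp (- 1 / (4 * \<sigma>))) has_integral 4 powr b * Gamma b) {0<..}"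
  proof (rule has_integral_eq[rotated])
    fix \<sigma> :: real assume \<sigma>: "\<sigma> \<in> {0<..}"
    have "?g \<sigma> powr (b - 1) = 4 powr (1 - b) * \<sigma> powr (1 - b)"
      using \<sigma> by (simp add: powr_divide powr_mult powr_diff field_simps)
    hence "4 powr b * (\<bar>- 1 / (4 * \<sigma>\<^sup>2)\<bar> * (?g \<sigma> powr (b - 1) / exp (?g \<sigma>)))
       = (4 powr b * 4 powr (1 - b) * 4 powr (-1)) * (\<sigma> powr (1 - b) * \<sigma> powr (-2)) * exp (- 1 / (4 * \<sigma>))"
      using \<sigma> by (simp add: exp_minus powr_minus field_simps)
    also have "4 powr b * 4 powr (1 - b) * 4 powr (-1) = (1 :: real)"
      by (simp only: powr_add[symmetric]) simp
    also have "\<sigma> powr (1 - b) * \<sigma> powr (-2) = \<sigma> powr (- b - 1)"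
      by (simp only: powr_add[symmetric]) (rule arg_cong2[where f = "(powr)"], auto)
    finally show "4 powr b * (\<bar>- 1 / (4 * \<sigma>\<^sup>2)\<bar> * (?g \<sigma> powr (b - 1) / exp (?g \<sigma>))) = \<sigma> powr (- b - 1) * exp (- 1 / (4 * \<sigma>))"
      by simp
  qed
  thus ?thesis by (intro has_bochner_integral_nonneg_has_integral) auto
qed

lemma set_integrable_powr_piecewise:
  fixes h :: "real \<Rightarrow> real" and a b C D :: real
  assumes [measurable]: "h \<in> borel_measurable borel" and a: "a > -1" and b: "b < -1"
    and small: "\<And>r. 0 < r \<Longrightarrow> r \<le> 1 \<Longrightarrow> \<bar>h r\<bar> \<le> C * r powr a"
    and large: "\<And>r. r \<ge> 1 \<Longrightarrow> \<bar>h r\<bar> \<le> D * r powr b"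
  shows "set_integrable lborel {0<..} h"
proof -
  have 1: "set_integrable lborel {0..1} (\<lambda>r :: real. r powr a)"
    using has_bochner_integral_nonneg_has_integral[OF _ _ _ has_integral_powr_from_0[OF a, of 1]]
    by (simp add: set_integrable_def has_bochner_integral_iff)
  have 2: "set_integrable lborel {1..} (\<lambda>r :: real. r powr b)"
    using has_bochner_integral_nonneg_has_integral[OF _ _ _ has_integral_powr_to_inf[OF b, of 1]]
    by (simp add: set_integrable_def has_bochner_integral_iff)
  have "set_integrable lborel {0<..1} h"
  proof (rule set_integrable_bound)
    show "set_integrable lborel {0<..1} (\<lambda>r. C * r powr a)"
      by (intro set_integrable_mult_right set_integrable_subset[OF 1]) auto
    show "AE r in lborel. r \<in> {0<..1} \<longrightarrow> norm (h r) \<le> norm (C * r powr a)"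
      using small by (auto intro!: AE_I2 order_trans[OF small])
  qed (auto simp: set_borel_measurable_def)
  moreover have "set_integrable lborel {1..} h"
  proof (rule set_integrable_bound)
    show "set_integrable lborel {1..} (\<lambda>r. D * r powr b)"
      by (intro set_integrable_mult_right 2)
    show "AE r in lborel. r \<in> {1..} \<longrightarrow> norm (h r) \<le> norm (D * r powr b)"
      using large by (auto intro!: AE_I2 order_trans[OF large])
  qed (auto simp: set_borel_measurable_def)
  ultimately have "set_integrable lborel ({0<..1} \<union> {1..}) h"
    by (rule set_integrable_Un) auto
  moreover have "{0<..1} \<union> {1..} = {0 :: real<..}" by auto
  ultimately show ?thesis by simp
qed

text \<open>Near 0 the trivial bound u^(2\<mu>+1) is used, which is where positivity of p + 2\<mu> +
  2 enters. At infinity the bound u^(\<mu>+1) is integrable against u^p exactly under the last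
  assumption.\<close>

lemma set_integrable_powr_bessel_int:
  fixes p \<mu> :: real
  assumes "\<mu> > -1" "p + 2 * \<mu> + 2 > 0" "p + 2 * \<mu> + 2 < \<mu>"
  shows "set_integrable lborel {0<..} (\<lambda>u. u powr p * norm (bessel_int \<mu> 1 u))"
proof -
  \<comment> \<open>Rounding up puts \<nu> = \<mu> - m into (-1, 0], so the exponent 2\<nu> + 1 + m
    of the decay estimate is at most \<mu> + 1.\<close>
  define m where "m = nat \<lceil>\<mu>\<rceil>"
  have m: "\<mu> \<le> real m" "real m < \<mu> + 1"
    using assms unfolding m_def by linarith+
  define \<nu> where "\<nu> = \<mu> - real m"
  have "\<nu> > -1" using m by (simp add: \<nu>_def)
  from bessel_int_decay[OF this, of m] obtain D where
    D: "\<And>u. u \<ge> 1 \<Longrightarrow> norm (bessel_int \<mu> 1 u) \<le> D * u powr (2 * \<nu> + 1 + real m)"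
    by (auto simp: \<nu>_def)
  let ?C = "2 * 4 powr \<mu> * Beta (\<mu> + 1) (\<mu> + 1)"
  show ?thesis
  proof (rule set_integrable_powr_piecewise)
    show "p + (2 * \<mu> + 1) > -1" using assms by simp
    show "p + (2 * \<nu> + 1 + real m) < -1" using assms m by (simp add: \<nu>_def)
    fix u :: real
    show "\<bar>u powr p * norm (bessel_int \<mu> 1 u)\<bar> \<le> ?C * u powr (p + (2 * \<mu> + 1))" if "u > 0"
      using mult_left_mono[OF norm_bessel_int_le[OF assms(1), of u 1], of "u powr p"] that
      by (simp add: powr_add mult_ac)
    show "\<bar>u powr p * norm (bessel_int \<mu> 1 u)\<bar> \<le> D * u powr (p + (2 * \<nu> + 1 + real m))" if "u \<ge> 1"
      using mult_left_mono[OF D[OF that], of "u powr p"] that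
      by (simp add: powr_add mult_ac)
  qed auto
qed

text \<open>In u^(1-2a) = u (u^2)^(-a) the second factor is a mixture of Gaussians and the first is
  the factor u that accompanies each Gaussian in \<open>bessel_int_gaussian\<close>. The mixing
  density is positive, so integrating the modulus over \<sigma> returns \<Gamma>(a) times the
  integrand of \<open>int\<close>, which justifies the exchange. The remaining \<sigma>-integral has
  b = \<mu> + 3/2 - a.\<close>

lemma bessel_int_mellin:
  fixes a \<mu> :: real
  assumes a: "a > 0" and \<mu>: "\<mu> > -1" and b: "\<mu> + 3 / 2 - a > 0"
    and int: "set_integrable lborel {0<..} (\<lambda>u. u powr (1 - 2 * a) * norm (bessel_int \<mu> 1 u))"
  shows "(LBINT u:{0<..}. u powr (1 - 2 * a) *\<^sub>R bessel_int \<mu> 1 u) =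
     of_real (sqrt pi * Gamma (\<mu> + 1) / (2 * Gamma a) * 4 powr (\<mu> + 3 / 2 - a) * Gamma (\<mu> + 3 / 2 - a))"
proof -
  define F where "F = (\<lambda>(r, \<sigma>). (if 0 < r \<and> 0 < \<sigma> then \<sigma> powr (a - 1) * exp (- \<sigma> * r\<^sup>2) * r else 0) *\<^sub>R bessel_int \<mu> 1 r)"
  have [measurable]: "F \<in> borel_measurable (lborel \<Otimes>\<^sub>M lborel)"
    unfolding F_def by measurable
  have F1: "F (r, \<sigma>) = complex_of_real (indicator {0<..} \<sigma> *\<^sub>R (\<sigma> powr (a - 1) * exp (- \<sigma> * r\<^sup>2))) * (indicator {0<..} r *\<^sub>R (r *\<^sub>R bessel_int \<mu> 1 r))" for r \<sigma>
    by (auto simp: F_def indicator_def scaleR_conv_of_real)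
  have F2: "F (r, \<sigma>) = (indicator {0<..} \<sigma> *\<^sub>R \<sigma> powr (a - 1)) *\<^sub>R (indicator {0<..} r *\<^sub>R ((exp (- \<sigma> * r\<^sup>2) * r) *\<^sub>R bessel_int \<mu> 1 r))" for r \<sigma>
    by (auto simp: F_def indicator_def mult_ac)
  have pw: "r powr (1 - 2 * a) = (r\<^sup>2) powr (- a) * r" if "r > 0" for r :: real
    using that powr_add[of r 1 "- 2 * a"] powr_powr[of r 2 "- a"] by (simp add: powr_numeral)
  have inner: "has_bochner_integral lborel (\<lambda>\<sigma>. indicator {0<..} \<sigma> *\<^sub>R (\<sigma> powr (a - 1) * exp (- \<sigma> * r\<^sup>2)))
           (Gamma a * (r\<^sup>2) powr (- a))" if "r > 0" for r :: real
    using that a by (intro has_bochner_integral_Gamma_scale) auto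
  have Fi: "integrable (lborel \<Otimes>\<^sub>M lborel) F"
  proof (rule lborel_pair.Fubini_integrable)
    have "integrable lborel (\<lambda>\<sigma>. F (r, \<sigma>))" for r
    proof (cases "r > 0")
      case True
      show ?thesis unfolding F1
        by (intro integrable_mult_left integrable_of_real) (use inner[OF True] in \<open>simp add: has_bochner_integral_iff\<close>)
    qed (simp add: F_def)
    thus "AE r in lborel. integrable lborel (\<lambda>\<sigma>. F (r, \<sigma>))" by simp
    have "(LBINT \<sigma>. norm (F (r, \<sigma>))) = Gamma a * (indicator {0<..} r *\<^sub>R (r powr (1 - 2 * a) * norm (bessel_int \<mu> 1 r)))" for r
    proof (cases "r > 0")
      case True
      have "(LBINT \<sigma>. norm (F (r, \<sigma>))) = (LBINT \<sigma>. (indicator {0<..} \<sigma> *\<^sub>R (\<sigma> powr (a - 1) * exp (- \<sigma> * r\<^sup>2))) * (r * norm (bessel_int \<mu> 1 r)))"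
        unfolding F1 using True by (intro Bochner_Integration.integral_cong) (auto simp: norm_mult indicator_def)
      also have "\<dots> = (Gamma a * (r\<^sup>2) powr (- a)) * (r * norm (bessel_int \<mu> 1 r))"
        unfolding integral_mult_left_zero has_bochner_integral_integral_eq[OF inner[OF True]] ..
      finally show ?thesis using True pw[OF True] by simp
    qed (simp add: F_def)
    thus "integrable lborel (\<lambda>r. LBINT \<sigma>. norm (F (r, \<sigma>)))"
      using int by (simp add: set_integrable_def)
  qed simp
  have "Gamma a *\<^sub>R (LBINT u:{0<..}. u powr (1 - 2 * a) *\<^sub>R bessel_int \<mu> 1 u) = (LBINT r. (LBINT \<sigma>. F (r, \<sigma>)))"
  proof -
    have "(LBINT \<sigma>. F (r, \<sigma>)) = Gamma a *\<^sub>R (indicator {0<..} r *\<^sub>R (r powr (1 - 2 * a) *\<^sub>R bessel_int \<mu> 1 r))" for r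
    proof (cases "r > 0")
      case True
      show ?thesis
        unfolding F1 integral_mult_left_zero integral_complex_of_real has_bochner_integral_integral_eq[OF inner[OF True]]
        using True pw[OF True] by (simp add: scaleR_conv_of_real)
    qed (simp add: F_def)
    thus ?thesis by (simp only: set_lebesgue_integral_def integral_scaleR_right)
  qed
  also have "\<dots> = (LBINT \<sigma>. (LBINT r. F (r, \<sigma>)))"
    using lborel_pair.Fubini_integral[of "\<lambda>r \<sigma>. F (r, \<sigma>)"] Fi by (simp add: split_def)
  also have "\<dots> = (LBINT \<sigma>. complex_of_real (sqrt pi * Gamma (\<mu> + 1) / 2 *
       (indicator {0<..} \<sigma> *\<^sub>R (\<sigma> powr (- (\<mu> + 3 / 2 - a) - 1) * exp (- 1 / (4 * \<sigma>))))))"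
  proof (rule Bochner_Integration.integral_cong)
    fix \<sigma> :: real
    show "(LBINT r. F (r, \<sigma>)) = complex_of_real (sqrt pi * Gamma (\<mu> + 1) / 2 *
       (indicator {0<..} \<sigma> *\<^sub>R (\<sigma> powr (- (\<mu> + 3 / 2 - a) - 1) * exp (- 1 / (4 * \<sigma>)))))"
    proof (cases "\<sigma> > 0")
      case True
      have "(LBINT r. F (r, \<sigma>)) = \<sigma> powr (a - 1) *\<^sub>R (LBINT r:{0<..}. (exp (- \<sigma> * r\<^sup>2) * r) *\<^sub>R bessel_int \<mu> 1 r)"
        unfolding F2 integral_scaleR_right set_lebesgue_integral_def using True by simp
      also have "\<dots> = of_real (sqrt pi * Gamma (\<mu> + 1) / 2 * ((\<sigma> powr (a - 1) * \<sigma> powr (- \<mu> - 3 / 2)) * exp (- 1 / (4 * \<sigma>))))"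
        unfolding bessel_int_gaussian[OF True \<mu>] by (simp add: scaleR_conv_of_real)
      also have "\<sigma> powr (a - 1) * \<sigma> powr (- \<mu> - 3 / 2) = \<sigma> powr (- (\<mu> + 3 / 2 - a) - 1)"
        by (simp only: powr_add[symmetric]) (rule arg_cong2[where f = "(powr)"], auto)
      finally show ?thesis using True by simp
    qed (simp add: F_def)
  qed simp
  also have "\<dots> = of_real (sqrt pi * Gamma (\<mu> + 1) / 2 * (4 powr (\<mu> + 3 / 2 - a) * Gamma (\<mu> + 3 / 2 - a)))"
    unfolding integral_complex_of_real integral_mult_right_zero
      has_bochner_integral_integral_eq[OF has_bochner_integral_Gamma_inverse[OF b]] ..
  finally have "Gamma a *\<^sub>R (LBINT u:{0<..}. u powr (1 - 2 * a) *\<^sub>R bessel_int \<mu> 1 u) = \<dots>" .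
  hence "(1 / Gamma a) *\<^sub>R (Gamma a *\<^sub>R (LBINT u:{0<..}. u powr (1 - 2 * a) *\<^sub>R bessel_int \<mu> 1 u)) =
    (1 / Gamma a) *\<^sub>R of_real (sqrt pi * Gamma (\<mu> + 1) / 2 * (4 powr (\<mu> + 3 / 2 - a) * Gamma (\<mu> + 3 / 2 - a)))"
    by (rule arg_cong)
  thus ?thesis using Gamma_real_pos[OF a] by (simp add: scaleR_conv_of_real field_simps)
qed

section \<open>Rescaling by |x| and passing to the limit\<close>

lemma bessel_int_limit:
  fixes g :: "real \<Rightarrow> real" and p \<mu> g0 :: real
  assumes [measurable]: "g \<in> borel_measurable borel"
    and bound: "\<And>r. r > 0 \<Longrightarrow> \<bar>g r\<bar> \<le> B" and lim: "(g \<longlongrightarrow> g0) (at_right 0)"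
    and int: "set_integrable lborel {0<..} (\<lambda>u. u powr p * norm (bessel_int \<mu> 1 u))"
  shows "((\<lambda>R. LBINT u:{0<..}. (u powr p * g (u / R)) *\<^sub>R bessel_int \<mu> 1 u) \<longlongrightarrow>
           g0 *\<^sub>R (LBINT u:{0<..}. u powr p *\<^sub>R bessel_int \<mu> 1 u)) at_top"
proof -
  have "((\<lambda>R. LBINT u. indicator {0<..} u *\<^sub>R ((u powr p * g (u / R)) *\<^sub>R bessel_int \<mu> 1 u)) \<longlongrightarrow>
           (LBINT u. indicator {0<..} u *\<^sub>R ((u powr p * g0) *\<^sub>R bessel_int \<mu> 1 u))) at_top"
  proof (rule integral_dominated_convergence_at_top)
    show "integrable lborel (\<lambda>u. B * (indicator {0<..} u *\<^sub>R (u powr p * norm (bessel_int \<mu> 1 u))))"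
      using int by (intro integrable_mult_right) (simp add: set_integrable_def)
    show "\<forall>\<^sub>F R in at_top. AE u in lborel. norm (indicator {0<..} u *\<^sub>R ((u powr p * g (u / R)) *\<^sub>R bessel_int \<mu> 1 u))
             \<le> B * (indicator {0<..} u *\<^sub>R (u powr p * norm (bessel_int \<mu> 1 u)))"
      using eventually_gt_at_top[of 0]
    proof eventually_elim
      case (elim R)
      show ?case
      proof (intro AE_I2)
        fix u
        show "norm (indicator {0<..} u *\<^sub>R ((u powr p * g (u / R)) *\<^sub>R bessel_int \<mu> 1 u))
             \<le> B * (indicator {0<..} u *\<^sub>R (u powr p * norm (bessel_int \<mu> 1 u)))"
        proof (cases "u > 0")
          case True
          have "\<bar>g (u / R)\<bar> * (u powr p * norm (bessel_int \<mu> 1 u)) \<le> B * (u powr p * norm (bessel_int \<mu> 1 u))"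
            using bound[of "u / R"] True elim by (intro mult_right_mono) auto
          thus ?thesis using True by (simp add: abs_mult mult_ac)
        qed simp
      qed
    qed
    show "AE u in lborel. ((\<lambda>R. indicator {0<..} u *\<^sub>R ((u powr p * g (u / R)) *\<^sub>R bessel_int \<mu> 1 u)) \<longlongrightarrow>
           indicator {0<..} u *\<^sub>R ((u powr p * g0) *\<^sub>R bessel_int \<mu> 1 u)) at_top"
    proof (intro AE_I2)
      fix u :: real
      show "((\<lambda>R. indicator {0<..} u *\<^sub>R ((u powr p * g (u / R)) *\<^sub>R bessel_int \<mu> 1 u)) \<longlongrightarrow>
           indicator {0<..} u *\<^sub>R ((u powr p * g0) *\<^sub>R bessel_int \<mu> 1 u)) at_top"
      proof (cases "u > 0")
        case True
        have "filterlim (\<lambda>R. u / R) (at_right 0) at_top"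
          using True by (auto intro!: filterlim_at_rightI real_tendsto_divide_at_top tendsto_const filterlim_ident
                 eventually_mono[OF eventually_gt_at_top[of 0]] simp: filterlim_at)
        hence "((\<lambda>R. g (u / R)) \<longlongrightarrow> g0) at_top" by (rule filterlim_compose[OF lim])
        thus ?thesis by (intro tendsto_intros)
      qed simp
    qed
  qed measurable
  also have "(LBINT u. indicator {0<..} u *\<^sub>R ((u powr p * g0) *\<^sub>R bessel_int \<mu> 1 u)) =
     g0 *\<^sub>R (LBINT u:{0<..}. u powr p *\<^sub>R bessel_int \<mu> 1 u)"
    unfolding set_lebesgue_integral_def by (subst integral_scaleR_right[symmetric]) (simp add: mult_ac)
  finally show ?thesis unfolding set_lebesgue_integral_def .
qed

text \<open>The power of R collects -1 from dr, -p from r^p and -2\<mu> - 1 from the scaling of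
  \<open>bessel_int\<close>.\<close>

lemma bessel_int_rescale_integral:
  fixes g :: "real \<Rightarrow> real"
  assumes R: "R > 0"
  shows "(LBINT r:{0<..}. (r powr p * g r) *\<^sub>R bessel_int \<mu> R r) =
         R powr (- p - 2 * \<mu> - 2) *\<^sub>R (LBINT u:{0<..}. (u powr p * g (u / R)) *\<^sub>R bessel_int \<mu> 1 u)"
proof -
  let ?h = "\<lambda>r. indicator {0<..} r *\<^sub>R ((r powr p * g r) *\<^sub>R bessel_int \<mu> R r)"
  have eq: "?h (0 + 1 / R * u) = R powr (- p - 2 * \<mu> - 1) *\<^sub>R
          (indicator {0<..} u *\<^sub>R ((u powr p * g (u / R)) *\<^sub>R bessel_int \<mu> 1 u))" for u
  proof (cases "u > 0")
    case True
    have "R powr (- p - 2 * \<mu> - 1) = R powr (- p) * R powr (- 2 * \<mu> - 1)"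
      by (simp only: powr_add[symmetric]) (rule arg_cong2[where f = "(powr)"], auto)
    moreover have "(u / R) powr p = R powr (- p) * u powr p"
      using True R by (simp add: powr_divide powr_minus field_simps)
    moreover have "bessel_int \<mu> R (u / R) = of_real (R powr (- 2 * \<mu> - 1)) * bessel_int \<mu> 1 u"
      using True R by (subst bessel_int_scale) auto
    ultimately show ?thesis using True R by (simp add: scaleR_conv_of_real)
  next
    case False
    hence "\<not> u / R > 0" using R by (simp add: field_simps)
    thus ?thesis using False by simp
  qed
  have "(LBINT r:{0<..}. (r powr p * g r) *\<^sub>R bessel_int \<mu> R r) = (1 / R) *\<^sub>R (LBINT u. ?h (0 + 1 / R * u))"
    using lborel_integral_real_affine[of "1 / R" ?h 0] R by (simp add: set_lebesgue_integral_def)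
  also have "\<dots> = (R powr (-1) * R powr (- p - 2 * \<mu> - 1)) *\<^sub>R
      (LBINT u:{0<..}. (u powr p * g (u / R)) *\<^sub>R bessel_int \<mu> 1 u)"
    unfolding eq integral_scaleR_right set_lebesgue_integral_def using R by (simp add: powr_minus field_simps)
  also have "R powr (-1) * R powr (- p - 2 * \<mu> - 1) = R powr (- p - 2 * \<mu> - 2)"
    by (simp only: powr_add[symmetric]) (rule arg_cong2[where f = "(powr)"], auto)
  finally show ?thesis .
qed

text \<open>Isolates what the asymptotics use of the radial function: a chain with F_j' = - r
  F_(j+1), decay and integrability along it, and a last member equal to r^(\<beta>-2k) times a
  bounded g with a limit at 0.\<close>

theorem radial_fourier_asymptotics:
  fixes F :: "nat \<Rightarrow> real \<Rightarrow> real" and g :: "real \<Rightarrow> real" and \<beta> g0 B :: real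
  assumes meas: "\<And>j. j \<le> k \<Longrightarrow> F j \<in> borel_measurable borel"
    and deriv: "\<And>j r. j < k \<Longrightarrow> r > 0 \<Longrightarrow> (F j has_real_derivative - (r * F (Suc j) r)) (at r)"
    and lim: "\<And>j. j < k \<Longrightarrow> (F j \<longlongrightarrow> 0) at_top"
    and int: "\<And>j. j < k \<Longrightarrow> set_integrable lborel {0<..} (\<lambda>r. r * F (Suc j) r * r powr (real CARD('n) + 2 * real j))"
    and Fk: "\<And>r. r > 0 \<Longrightarrow> F k r = r powr (\<beta> - 2 * real k) * g r"
    and g: "g \<in> borel_measurable borel" "\<And>r. r > 0 \<Longrightarrow> \<bar>g r\<bar> \<le> B" "(g \<longlongrightarrow> g0) (at_right 0)"
    and \<beta>: "\<beta> \<ge> 0" and k: "real k > (real CARD('n) + 3) / 2 + \<beta>"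
  shows "((\<lambda>x :: real ^ 'n. norm x powr (real CARD('n) + \<beta>) *\<^sub>R (LINT \<xi>|lborel. F 0 (norm \<xi>) *\<^sub>R cis (- (x \<bullet> \<xi>)))) \<longlongrightarrow>
     of_real (pi powr (real CARD('n) / 2) * 2 powr (real CARD('n) + \<beta>) * Gamma ((real CARD('n) + \<beta>) / 2)
        * g0 / (2 ^ k * Gamma (real k - \<beta> / 2)))) at_infinity"
proof -
  define d where "d = real CARD('n)"
  have d: "d \<ge> 1" by (simp add: d_def Suc_leI)
  have "(real CARD('n) + 3) / 2 > 0" by simp
  hence "real k > 0" using k \<beta> by linarith
  then obtain j where j: "k = Suc j" by (cases k) auto
  define \<mu> where "\<mu> = (d - 1) / 2 + real j"
  define p where "p = \<beta> - 2 * real k + 1"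
  have \<mu>: "\<mu> > -1" using d by (auto simp: \<mu>_def field_simps)
  have pm: "p + 2 * \<mu> + 2 = d + \<beta>" by (simp add: p_def \<mu>_def j field_simps)
  \<comment> \<open>This is the hypothesis on k, rewritten with \<mu> = (d-3)/2 + k.\<close>
  have big: "d + \<beta> < \<mu>" using k by (simp add: \<mu>_def j d_def field_simps)
  have pint: "set_integrable lborel {0<..} (\<lambda>u. u powr p * norm (bessel_int \<mu> 1 u))"
    using \<mu> pm big d \<beta> by (intro set_integrable_powr_bessel_int) auto
  define a where "a = real k - \<beta> / 2"
  have a: "a > 0" using k \<beta> d by (simp add: a_def d_def field_simps)
  have pa: "p = 1 - 2 * a" by (simp add: p_def a_def)
  have b: "\<mu> + 3 / 2 - a = (d + \<beta>) / 2" by (simp add: \<mu>_def a_def j field_simps)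
  define c where "c = pi powr ((d - 1) / 2) / (2 ^ j * Gamma (\<mu> + 1))"
  define I where "I = (LBINT u:{0<..}. u powr p *\<^sub>R bessel_int \<mu> 1 u)"
  have I: "I = of_real (sqrt pi * Gamma (\<mu> + 1) / (2 * Gamma a) * 4 powr ((d + \<beta>) / 2) * Gamma ((d + \<beta>) / 2))"
    unfolding I_def pa b[symmetric] using a \<mu> pint b d \<beta> pa by (intro bessel_int_mellin) auto
  have FT: "norm x powr (d + \<beta>) *\<^sub>R (LINT \<xi>|lborel. F 0 (norm \<xi>) *\<^sub>R cis (- (x \<bullet> \<xi>))) =
     c *\<^sub>R (LBINT u:{0<..}. (u powr p * g (u / norm x)) *\<^sub>R bessel_int \<mu> 1 u)" if x: "x \<noteq> 0" for x :: "real ^ 'n"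
  proof -
    have "(LINT \<xi>|lborel. F 0 (norm \<xi>) *\<^sub>R cis (- (x \<bullet> \<xi>))) =
        c *\<^sub>R (LBINT r:{0<..}. (r * F k r) *\<^sub>R bessel_int \<mu> (norm x) r)"
      unfolding c_def \<mu>_def d_def j using meas deriv lim int j by (intro radial_fourier_iterated[where k = k]) auto
    also have "(LBINT r:{0<..}. (r * F k r) *\<^sub>R bessel_int \<mu> (norm x) r) = (LBINT r:{0<..}. (r powr p * g r) *\<^sub>R bessel_int \<mu> (norm x) r)"
    proof (rule set_lebesgue_integral_cong)
      have "r * F k r = r powr p * g r" if "r > 0" for r
        using that powr_add[of r 1 "\<beta> - 2 * real k"] by (simp add: Fk p_def add_ac)
      thus "\<forall>r. r \<in> {0<..} \<longrightarrow> (r * F k r) *\<^sub>R bessel_int \<mu> (norm x) r = (r powr p * g r) *\<^sub>R bessel_int \<mu> (norm x) r" by simp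
    qed simp
    also have "\<dots> = norm x powr (- p - 2 * \<mu> - 2) *\<^sub>R (LBINT u:{0<..}. (u powr p * g (u / norm x)) *\<^sub>R bessel_int \<mu> 1 u)"
      using x by (intro bessel_int_rescale_integral) auto
    also have "- p - 2 * \<mu> - 2 = - (d + \<beta>)" using pm by simp
    finally have "(LINT \<xi>|lborel. F 0 (norm \<xi>) *\<^sub>R cis (- (x \<bullet> \<xi>))) = c *\<^sub>R (norm x powr (- (d + \<beta>)) *\<^sub>R
        (LBINT u:{0<..}. (u powr p * g (u / norm x)) *\<^sub>R bessel_int \<mu> 1 u))" .
    moreover have "norm x powr (d + \<beta>) * norm x powr (- (d + \<beta>)) = 1"
      using x by (simp only: powr_add[symmetric]) simp
    ultimately show ?thesis by simp
  qed
  have "((\<lambda>x :: real ^ 'n. c *\<^sub>R (LBINT u:{0<..}. (u powr p * g (u / norm x)) *\<^sub>R bessel_int \<mu> 1 u)) \<longlongrightarrow> c *\<^sub>R (g0 *\<^sub>R I)) at_infinity"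
    unfolding I_def
    by (intro tendsto_intros filterlim_compose[OF bessel_int_limit[OF g pint] filterlim_norm_at_top])
  moreover have "\<forall>\<^sub>F x :: real ^ 'n in at_infinity. c *\<^sub>R (LBINT u:{0<..}. (u powr p * g (u / norm x)) *\<^sub>R bessel_int \<mu> 1 u)
       = norm x powr (d + \<beta>) *\<^sub>R (LINT \<xi>|lborel. F 0 (norm \<xi>) *\<^sub>R cis (- (x \<bullet> \<xi>)))"
    using eventually_not_equal_at_infinity[of 0] by eventually_elim (simp add: FT)
  ultimately have "((\<lambda>x :: real ^ 'n. norm x powr (d + \<beta>) *\<^sub>R (LINT \<xi>|lborel. F 0 (norm \<xi>) *\<^sub>R cis (- (x \<bullet> \<xi>)))) \<longlongrightarrow> c *\<^sub>R (g0 *\<^sub>R I)) at_infinity"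
    by (rule Lim_transform_eventually)
  \<comment> \<open>\<Gamma>(\<mu>+1) cancels between c and I, the factor sqrt \<pi> of I completes
    \<pi>^((d-1)/2) to \<pi>^(d/2), and the 2 in the denominator of I turns 2^j into 2^k.\<close>
  moreover have "c *\<^sub>R (g0 *\<^sub>R I) = of_real (pi powr (d / 2) * 2 powr (d + \<beta>) * Gamma ((d + \<beta>) / 2) * g0 / (2 ^ k * Gamma a))"
  proof -
    have "Gamma (\<mu> + 1) > 0" "Gamma a > 0" using \<mu> a by auto
    moreover have "pi powr ((d - 1) / 2) * sqrt pi = pi powr (d / 2)"
      unfolding powr_half_sqrt[OF pi_ge_zero, symmetric]
      by (simp only: powr_add[symmetric]) (rule arg_cong2[where f = "(powr)"], auto simp: field_simps)
    moreover have "(4 :: real) powr ((d + \<beta>) / 2) = 2 powr (d + \<beta>)"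
      using powr_powr[of 2 2 "(d + \<beta>) / 2"] by simp
    ultimately show ?thesis unfolding I c_def j by (simp add: scaleR_conv_of_real field_simps flip: of_real_mult)
  qed
  ultimately show ?thesis by (simp add: d_def a_def)
qed

section \<open>Symbol estimates\<close>

text \<open>Functions on \<open>(0, \<infinity>)\<close> whose iterates under \<open>r d/dr\<close>, up to order \<open>n\<close>, are \<open>O(r\<^sup>\<alpha>)\<close> at \<open>0\<close> and of
  polynomial growth at infinity.\<close>

primrec symbol_class :: "real \<Rightarrow> nat \<Rightarrow> (real \<Rightarrow> real) \<Rightarrow> bool" where
  "symbol_class \<alpha> 0 p \<longleftrightarrow> (\<exists>C. \<exists>N::nat. \<forall>r>0. \<bar>p r\<bar> \<le> C * r powr \<alpha> * (1 + r) ^ N)"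
| "symbol_class \<alpha> (Suc n) p \<longleftrightarrow> (\<exists>C. \<exists>N::nat. \<forall>r>0. \<bar>p r\<bar> \<le> C * r powr \<alpha> * (1 + r) ^ N) \<and>
     (\<exists>p'. (\<forall>r>0. (p has_real_derivative p' r) (at r)) \<and> symbol_class \<alpha> n (\<lambda>r. r * p' r))"

lemma symbol_class_bound:
  assumes "symbol_class \<alpha> n p"
  obtains C and N :: nat where "C \<ge> 0" "\<And>r. r > 0 \<Longrightarrow> \<bar>p r\<bar> \<le> C * r powr \<alpha> * (1 + r) ^ N"
proof -
  obtain C and N :: nat where C: "\<forall>r>0. \<bar>p r\<bar> \<le> C * r powr \<alpha> * (1 + r) ^ N"
    using assms by (cases n) auto
  have "\<bar>p r\<bar> \<le> \<bar>C\<bar> * r powr \<alpha> * (1 + r) ^ N" if "r > 0" for r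
    using C[rule_format, OF that] that
    by (elim order_trans) (auto intro!: mult_right_mono)
  thus ?thesis by (intro that[of "\<bar>C\<bar>" N]) auto
qed

lemma symbol_class_SucI:
  assumes "\<exists>C. \<exists>N::nat. \<forall>r>0. \<bar>p r\<bar> \<le> C * r powr \<alpha> * (1 + r) ^ N"
    and "\<And>r. r > 0 \<Longrightarrow> (p has_real_derivative p' r) (at r)" "symbol_class \<alpha> n (\<lambda>r. r * p' r)"
  shows "symbol_class \<alpha> (Suc n) p"
  using assms unfolding symbol_class.simps by blast

lemma symbol_class_pred: "symbol_class \<alpha> (Suc n) p \<Longrightarrow> symbol_class \<alpha> n p"
proof (induction n arbitrary: p)
  case (Suc n)
  obtain p' where "\<forall>r>0. (p has_real_derivative p' r) (at r)" "symbol_class \<alpha> (Suc n) (\<lambda>r. r * p' r)"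
    using Suc.prems symbol_class.simps(2)[of \<alpha> "Suc n" p] by blast
  thus ?case using Suc.IH[of "\<lambda>r. r * p' r"] Suc.prems by auto
qed auto

lemma symbol_class_mono: "symbol_class \<alpha> n p \<Longrightarrow> m \<le> n \<Longrightarrow> symbol_class \<alpha> m p"
  by (induction n) (auto simp: le_Suc_eq simp del: symbol_class.simps dest: symbol_class_pred)

lemma symbol_class_cong:
  assumes "symbol_class \<alpha> n p" "\<And>r. r > 0 \<Longrightarrow> p r = q r"
  shows "symbol_class \<alpha> n q"
proof (cases n)
  case (Suc m)
  obtain p' where p': "\<And>r. r > 0 \<Longrightarrow> (p has_real_derivative p' r) (at r)" "symbol_class \<alpha> m (\<lambda>r. r * p' r)"
    using assms(1) Suc by auto
  have "(q has_real_derivative p' r) (at r)" if "r > 0" for r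
    using p'(1)[OF that]
    by (rule has_field_derivative_transform_within_open[where S = "{0<..}"]) (use that assms(2) in auto)
  thus ?thesis using assms p' Suc by auto
qed (use assms in auto)

lemma symbol_class_add:
  assumes "symbol_class \<alpha> n p" "symbol_class \<alpha> n q"
  shows "symbol_class \<alpha> n (\<lambda>r. p r + q r)"
  using assms
proof (induction n arbitrary: p q)
  have bound: "\<exists>C. \<exists>N::nat. \<forall>r>0. \<bar>p r + q r\<bar> \<le> C * r powr \<alpha> * (1 + r) ^ N"
    if pq: "symbol_class \<alpha> n p" "symbol_class \<alpha> n q" for p q :: "real \<Rightarrow> real" and n
  proof -
    obtain C M where C: "C \<ge> 0" "\<And>r. r > 0 \<Longrightarrow> \<bar>p r\<bar> \<le> C * r powr \<alpha> * (1 + r) ^ M"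
      using symbol_class_bound[OF pq(1)] by blast
    obtain D N where D: "D \<ge> 0" "\<And>r. r > 0 \<Longrightarrow> \<bar>q r\<bar> \<le> D * r powr \<alpha> * (1 + r) ^ N"
      using symbol_class_bound[OF pq(2)] by blast
    have "\<bar>p r + q r\<bar> \<le> (C + D) * r powr \<alpha> * (1 + r) ^ (M + N)" if r: "r > 0" for r
    proof -
      have "\<bar>p r + q r\<bar> \<le> C * r powr \<alpha> * (1 + r) ^ M + D * r powr \<alpha> * (1 + r) ^ N"
        using C(2)[OF r] D(2)[OF r] by linarith
      also have "\<dots> \<le> C * r powr \<alpha> * (1 + r) ^ (M + N) + D * r powr \<alpha> * (1 + r) ^ (M + N)"
        using C(1) D(1) r by (intro add_mono mult_left_mono power_increasing) auto
      finally show ?thesis by (simp add: algebra_simps)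
    qed
    thus ?thesis by blast
  qed
  {
    case 0
    thus ?case using bound[of 0 p q] by simp
  next
    case (Suc n)
    obtain p' where p': "\<And>r. r > 0 \<Longrightarrow> (p has_real_derivative p' r) (at r)" "symbol_class \<alpha> n (\<lambda>r. r * p' r)"
      using Suc.prems by auto
    obtain q' where q': "\<And>r. r > 0 \<Longrightarrow> (q has_real_derivative q' r) (at r)" "symbol_class \<alpha> n (\<lambda>r. r * q' r)"
      using Suc.prems by auto
    have "symbol_class \<alpha> n (\<lambda>r. r * (p' r + q' r))"
      using Suc.IH[OF p'(2) q'(2)] by (simp add: distrib_left)
    moreover have "((\<lambda>r. p r + q r) has_real_derivative p' r + q' r) (at r)" if "r > 0" for r
      by (intro DERIV_add p' q' that)
    ultimately show ?case using bound[OF Suc.prems] by (intro symbol_class_SucI)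
  }
qed

lemma symbol_class_mult:
  assumes "symbol_class \<alpha> n p" "symbol_class \<alpha> n q" and \<alpha>: "\<alpha> \<ge> 0"
  shows "symbol_class \<alpha> n (\<lambda>r. p r * q r)"
  using assms(1,2)
proof (induction n arbitrary: p q)
  have bound: "\<exists>C. \<exists>N::nat. \<forall>r>0. \<bar>p r * q r\<bar> \<le> C * r powr \<alpha> * (1 + r) ^ N"
    if pq: "symbol_class \<alpha> n p" "symbol_class \<alpha> n q" for p q :: "real \<Rightarrow> real" and n
  proof -
    obtain C M where C: "C \<ge> 0" "\<And>r. r > 0 \<Longrightarrow> \<bar>p r\<bar> \<le> C * r powr \<alpha> * (1 + r) ^ M"
      using symbol_class_bound[OF pq(1)] by blast
    obtain D N where D: "D \<ge> 0" "\<And>r. r > 0 \<Longrightarrow> \<bar>q r\<bar> \<le> D * r powr \<alpha> * (1 + r) ^ N"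
      using symbol_class_bound[OF pq(2)] by blast
    \<comment> \<open>A product is O(r^(2\<alpha>)) at 0, better than r^\<alpha>; at infinity the
      surplus r^\<alpha> is moved into the polynomial factor as (1+r)^L.\<close>
    define L where "L = nat \<lceil>\<alpha>\<rceil>"
    have L: "\<alpha> \<le> real L" unfolding L_def by linarith
    have "\<bar>p r * q r\<bar> \<le> (C * D) * r powr \<alpha> * (1 + r) ^ (M + N + L)" if r: "r > 0" for r
    proof -
      have "r powr \<alpha> \<le> (1 + r) powr \<alpha>" using r \<alpha> by (intro powr_mono2) auto
      also have "\<dots> \<le> (1 + r) powr (real L)" using r L by (intro powr_mono) auto
      also have "\<dots> = (1 + r) ^ L" using r by (simp add: powr_realpow)
      finally have le: "r powr \<alpha> \<le> (1 + r) ^ L" .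
      have "\<bar>p r * q r\<bar> \<le> (C * r powr \<alpha> * (1 + r) ^ M) * (D * r powr \<alpha> * (1 + r) ^ N)"
        unfolding abs_mult using C D r by (intro mult_mono) auto
      also have "\<dots> \<le> (C * r powr \<alpha> * (1 + r) ^ M) * (D * (1 + r) ^ L * (1 + r) ^ N)"
        using C D r le by (intro mult_mono) auto
      also have "\<dots> = (C * D) * r powr \<alpha> * (1 + r) ^ (M + N + L)" by (simp add: power_add mult_ac)
      finally show ?thesis .
    qed
    thus ?thesis by blast
  qed
  {
    case 0
    thus ?case using bound[of 0 p q] by simp
  next
    case (Suc n)
    obtain p' where p': "\<And>r. r > 0 \<Longrightarrow> (p has_real_derivative p' r) (at r)" "symbol_class \<alpha> n (\<lambda>r. r * p' r)"
      using Suc.prems by auto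
    obtain q' where q': "\<And>r. r > 0 \<Longrightarrow> (q has_real_derivative q' r) (at r)" "symbol_class \<alpha> n (\<lambda>r. r * q' r)"
      using Suc.prems by auto
    have pq: "symbol_class \<alpha> n p" "symbol_class \<alpha> n q" using Suc.prems symbol_class_pred by blast+
    have "symbol_class \<alpha> n (\<lambda>r. r * (p' r * q r + q' r * p r))"
      using symbol_class_add[OF Suc.IH[OF p'(2) pq(2)] Suc.IH[OF q'(2) pq(1)]]
      by (simp add: distrib_left mult_ac)
    moreover have "((\<lambda>r. p r * q r) has_real_derivative p' r * q r + q' r * p r) (at r)" if "r > 0" for r
      by (intro DERIV_mult p' q' that)
    ultimately show ?case using bound[OF Suc.prems] by (intro symbol_class_SucI)
  }
qed

lemma symbol_class_cmult:
  assumes "symbol_class \<alpha> n p"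
  shows "symbol_class \<alpha> n (\<lambda>r. c * p r)"
  using assms
proof (induction n arbitrary: p)
  have bound: "\<exists>C. \<exists>N::nat. \<forall>r>0. \<bar>c * p r\<bar> \<le> C * r powr \<alpha> * (1 + r) ^ N"
    if p: "symbol_class \<alpha> n p" for p :: "real \<Rightarrow> real" and n
  proof -
    obtain C M where C: "C \<ge> 0" "\<And>r. r > 0 \<Longrightarrow> \<bar>p r\<bar> \<le> C * r powr \<alpha> * (1 + r) ^ M"
      using symbol_class_bound[OF p] by blast
    have "\<bar>c * p r\<bar> \<le> (\<bar>c\<bar> * C) * r powr \<alpha> * (1 + r) ^ M" if "r > 0" for r
      using mult_left_mono[OF C(2)[OF that], of "\<bar>c\<bar>"] by (simp add: abs_mult mult_ac)
    thus ?thesis by blast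
  qed
  {
    case 0
    thus ?case using bound[of 0 p] by simp
  next
    case (Suc n)
    obtain p' where p': "\<And>r. r > 0 \<Longrightarrow> (p has_real_derivative p' r) (at r)" "symbol_class \<alpha> n (\<lambda>r. r * p' r)"
      using Suc.prems by auto
    have "symbol_class \<alpha> n (\<lambda>r. r * (c * p' r))"
      using Suc.IH[OF p'(2)] by (simp add: mult_ac)
    moreover have "((\<lambda>r. c * p r) has_real_derivative c * p' r) (at r)" if "r > 0" for r
      by (intro DERIV_cmult p' that)
    ultimately show ?case using bound[OF Suc.prems] by (intro symbol_class_SucI)
  }
qed

lemma symbol_class_zero: "symbol_class \<alpha> n (\<lambda>_. 0)"
  by (induction n) (auto intro!: exI[of _ 0] exI[of _ "\<lambda>_. 0"])

lemma symbol_class_euler_deriv: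
  assumes "symbol_class \<alpha> (Suc n) p"
  shows "symbol_class \<alpha> n (\<lambda>r. r * deriv p r)"
proof -
  obtain p' where p': "\<And>r. r > 0 \<Longrightarrow> (p has_real_derivative p' r) (at r)" "symbol_class \<alpha> n (\<lambda>r. r * p' r)"
    using assms by auto
  show ?thesis
    by (rule symbol_class_cong[OF p'(2)]) (use DERIV_imp_deriv[OF p'(1)] in auto)
qed

text \<open>With D = d/dr, the identity rD(r^m D^m \<eta>) = m r^m D^m \<eta> + r^(m+1) D^(m+1)
  \<eta> shows that iterates of rD stay in the span of the functions r^m D^m \<eta>, which are the
  ones bounded by hypothesis.\<close>

lemma symbol_class_scaled_derivs:
  fixes \<eta> :: "real \<Rightarrow> real"
  assumes diff: "\<And>m r. m < k \<Longrightarrow> r > 0 \<Longrightarrow> ((deriv ^^ m) \<eta> has_real_derivative (deriv ^^ Suc m) \<eta> r) (at r)"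
    and bound: "\<And>m r. m \<le> k \<Longrightarrow> r > 0 \<Longrightarrow> \<bar>r ^ m * (deriv ^^ m) \<eta> r\<bar> \<le> A * r powr \<alpha>"
    and "m + n \<le> k"
  shows "symbol_class \<alpha> n (\<lambda>r. r ^ m * (deriv ^^ m) \<eta> r)"
  using \<open>m + n \<le> k\<close>
proof (induction n arbitrary: m)
  case 0
  thus ?case using bound[of m] by (simp, intro exI[of _ A], intro exI[of _ 0]) simp
next
  case (Suc n)
  have "\<exists>C. \<exists>N::nat. \<forall>r>0. \<bar>r ^ m * (deriv ^^ m) \<eta> r\<bar> \<le> C * r powr \<alpha> * (1 + r) ^ N"
    using bound[of m] Suc.prems by (intro exI[of _ A], intro exI[of _ 0]) simp
  moreover define p' where "p' = (\<lambda>r. real m * r ^ (m - 1) * (deriv ^^ m) \<eta> r + (deriv ^^ Suc m) \<eta> r * r ^ m)"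
  have "((\<lambda>r. r ^ m * (deriv ^^ m) \<eta> r) has_real_derivative p' r) (at r)" if "r > 0" for r
    unfolding p'_def using diff[of m r] that Suc.prems DERIV_pow[of m r]
    by (intro DERIV_mult) auto
  moreover have "symbol_class \<alpha> n (\<lambda>r. r * p' r)"
  proof -
    have "r * p' r = real m * (r ^ m * (deriv ^^ m) \<eta> r) + r ^ Suc m * (deriv ^^ Suc m) \<eta> r" for r
      unfolding p'_def by (cases m) (auto simp: algebra_simps)
    thus ?thesis using Suc.IH[of m] Suc.IH[of "Suc m"] Suc.prems
      by (auto simp del: funpow.simps intro!: symbol_class_add symbol_class_cmult)
  qed
  ultimately show ?case by (rule symbol_class_SucI)
qed

text \<open>The highest derivative of \<eta> is not assumed continuous; its measurability comes from
  difference quotients with steps 1/(n+1). Extending f by 0 keeps these quotients measurable on the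
  whole line.\<close>

lemma borel_measurable_derivative_Ioi:
  fixes f f' :: "real \<Rightarrow> real"
  assumes deriv: "\<And>r. r > 0 \<Longrightarrow> (f has_real_derivative f' r) (at r)"
  shows "(\<lambda>r. indicator {0<..} r *\<^sub>R f' r) \<in> borel_measurable borel"
proof -
  define f0 where "f0 = (\<lambda>r. indicator {0<..} r *\<^sub>R f r)"
  have [measurable]: "f0 \<in> borel_measurable borel"
    unfolding f0_def using deriv
    by (intro borel_measurable_continuous_on_indicator continuous_at_imp_continuous_on) (auto intro: DERIV_isCont)
  define h where "h = (\<lambda>n. inverse (real (Suc n)))"
  have h: "h \<longlonglongrightarrow> 0" "h n > 0" for n
    unfolding h_def using LIMSEQ_inverse_real_of_nat by auto
  show ?thesis
  proof (rule borel_measurable_LIMSEQ_real)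
    show "(\<lambda>r. indicator {0<..} r * ((f0 (r + h n) - f0 r) / h n)) \<in> borel_measurable borel" for n
      by measurable
    fix r :: real
    show "(\<lambda>n. indicator {0<..} r * ((f0 (r + h n) - f0 r) / h n)) \<longlonglongrightarrow> indicator {0<..} r *\<^sub>R f' r"
    proof (cases "r > 0")
      case True
      have "filterlim h (at 0) sequentially"
        using h by (auto simp: filterlim_at intro!: always_eventually)
           (metis less_irrefl)
      hence "(\<lambda>n. (f (r + h n) - f r) / h n) \<longlonglongrightarrow> f' r"
        by (rule filterlim_compose[OF deriv[OF True, unfolded DERIV_def]])
      moreover have "r + h n > 0" for n using h(2)[of n] True by linarith
      ultimately show ?thesis using True by (simp add: f0_def)
    qed simp
  qed
qed

text \<open>The coefficients in \<open>(-(1/r) d/dr)\<^sup>j (r\<^sup>\<beta> e\<^sup>-\<^sup>t\<^sup>\<eta>) = r\<^sup>\<beta>\<^sup>-\<^sup>2\<^sup>j e\<^sup>-\<^sup>t\<^sup>\<eta> P\<^sub>j\<close>.\<close>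

primrec radial_coeff :: "real \<Rightarrow> real \<Rightarrow> (real \<Rightarrow> real) \<Rightarrow> nat \<Rightarrow> real \<Rightarrow> real" where
  "radial_coeff \<beta> t \<eta> 0 = (\<lambda>_. 1)"
| "radial_coeff \<beta> t \<eta> (Suc j) = (\<lambda>r. (2 * real j - \<beta>) * radial_coeff \<beta> t \<eta> j r
      + t * (r * deriv \<eta> r) * radial_coeff \<beta> t \<eta> j r - r * deriv (radial_coeff \<beta> t \<eta> j) r)"

text \<open>Modulo functions of size r^\<alpha> at 0 the recursion is multiplication by 2j -
  \<beta>: every other term contains r \<eta>' or an Euler derivative of the previous remainder.
  This gives the value of each coefficient at 0. Each step uses up one derivative, whence the order
  \<open>Suc n - j\<close>.\<close>

lemma symbol_class_radial_coeff:
  assumes \<eta>: "symbol_class \<alpha> n (\<lambda>r. r * deriv \<eta> r)" and \<alpha>: "\<alpha> \<ge> 0" and "j \<le> Suc n"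
  shows "symbol_class \<alpha> (Suc n - j) (\<lambda>r. radial_coeff \<beta> t \<eta> j r - (\<Prod>i<j. 2 * real i - \<beta>))"
  using \<open>j \<le> Suc n\<close>
proof (induction j)
  case 0
  have "symbol_class \<alpha> (Suc n) (\<lambda>r. 0)" by (rule symbol_class_zero)
  thus ?case by (simp del: symbol_class.simps)
next
  case (Suc j)
  define m where "m = n - j"
  have m: "Suc n - j = Suc m" "Suc n - Suc j = m" "m \<le> n" using Suc.prems by (auto simp: m_def)
  define c where "c = (\<lambda>j. \<Prod>i<j. 2 * real i - \<beta>)"
  define Q where "Q = (\<lambda>r. radial_coeff \<beta> t \<eta> j r - c j)"
  have Q: "symbol_class \<alpha> (Suc m) Q" using Suc unfolding Q_def c_def m(1)[symmetric] by simp
  have Qm: "symbol_class \<alpha> m Q" by (rule symbol_class_pred[OF Q])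
  have \<eta>m: "symbol_class \<alpha> m (\<lambda>r. r * deriv \<eta> r)" by (rule symbol_class_mono[OF \<eta> m(3)])
  \<comment> \<open>The recursion applied to Q + c_j: the constant (2j - \<beta>) c_j = c_(j+1) is
    subtracted and Euler differentiation annihilates c_j.\<close>
  have "symbol_class \<alpha> m (\<lambda>r. (2 * real j - \<beta>) * Q r + t * ((r * deriv \<eta> r) * Q r) +
      t * c j * (r * deriv \<eta> r) + (-1) * (r * deriv Q r))"
    by (intro symbol_class_add symbol_class_cmult symbol_class_mult Qm \<eta>m \<alpha> symbol_class_euler_deriv Q)
  hence "symbol_class \<alpha> m (\<lambda>r. radial_coeff \<beta> t \<eta> (Suc j) r - c (Suc j))"
  proof (rule symbol_class_cong)
    fix r :: real assume r: "r > 0"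
    obtain q where q: "(Q has_real_derivative q) (at r)" using Q r by auto
    hence "((\<lambda>r. Q r + c j) has_real_derivative q + 0) (at r)"
      by (intro DERIV_add DERIV_const)
    hence "deriv (radial_coeff \<beta> t \<eta> j) r = deriv Q r"
      using DERIV_imp_deriv[OF q] unfolding Q_def by (auto dest!: DERIV_imp_deriv)
    thus "(2 * real j - \<beta>) * Q r + t * ((r * deriv \<eta> r) * Q r) +
      t * c j * (r * deriv \<eta> r) + (-1) * (r * deriv Q r) = radial_coeff \<beta> t \<eta> (Suc j) r - c (Suc j)"
      by (simp add: Q_def c_def algebra_simps)
  qed
  thus ?case unfolding m c_def by simp
qed

section \<open>Decay of exp(-t \<eta>) beyond every power, against polynomially growing
  coefficients\<close>

lemma exp_neg_superlog_decay:
  fixes \<eta> :: "real \<Rightarrow> real"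
  assumes liminf: "Liminf at_top (\<lambda>r. ereal (\<eta> r / ln r)) = \<infinity>" and t: "t > 0"
    and bound: "\<And>r. r > 0 \<Longrightarrow> \<bar>\<eta> r\<bar> \<le> A * r powr \<alpha>" and \<alpha>: "\<alpha> \<ge> 0"
  shows "\<exists>C\<ge>0. \<forall>r\<ge>1. exp (- t * \<eta> r) \<le> C * r powr (- L)"
proof -
  have "\<forall>\<^sub>F r in at_top. ereal (L / t) < ereal (\<eta> r / ln r)"
    using liminf by (intro less_LiminfD) simp
  then obtain r0 where r0: "\<And>r. r \<ge> r0 \<Longrightarrow> L / t < \<eta> r / ln r"
    by (auto simp: eventually_at_top_linorder)
  define r1 where "r1 = max 2 r0"
  have r1: "r1 \<ge> 2" "r1 \<ge> r0" by (auto simp: r1_def)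
  have A: "A \<ge> 0" using bound[of 1] by (simp add: order_trans[OF abs_ge_zero])
  \<comment> \<open>The second entry covers [1, r1], where the liminf gives no information and
    |\<eta>| \<le> A r^\<alpha> is used instead. As L may be negative, r^L is bounded through
    |L|.\<close>
  define C where "C = max 1 (exp (t * (A * r1 powr \<alpha>)) * r1 powr \<bar>L\<bar>)"
  have "exp (- t * \<eta> r) \<le> C * r powr (- L)" if r: "r \<ge> 1" for r
  proof (cases "r \<ge> r1")
    case True
    hence "ln r > 0" using r1 by simp
    hence "L * ln r < t * \<eta> r"
      using r0[of r] True r1 t by (simp add: field_simps)
    hence "exp (- t * \<eta> r) \<le> exp (- L * ln r)" by simp
    also have "\<dots> = 1 * r powr (- L)" using r by (simp add: powr_def)
    also have "\<dots> \<le> C * r powr (- L)" by (intro mult_right_mono) (auto simp: C_def)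
    finally show ?thesis .
  next
    case False
    have "r powr \<alpha> \<le> r1 powr \<alpha>" using False r \<alpha> by (intro powr_mono2) auto
    hence "A * r powr \<alpha> \<le> A * r1 powr \<alpha>" using A by (intro mult_left_mono)
    hence "- \<eta> r \<le> A * r1 powr \<alpha>" using bound[of r] r by simp
    hence 1: "exp (- t * \<eta> r) \<le> exp (t * (A * r1 powr \<alpha>))"
      using t mult_left_mono[of "- \<eta> r" "A * r1 powr \<alpha>" t] by simp
    have "r powr L \<le> r powr \<bar>L\<bar>" using r by (intro powr_mono) auto
    also have "\<dots> \<le> r1 powr \<bar>L\<bar>" using r False by (intro powr_mono2) auto
    finally have "1 \<le> r1 powr \<bar>L\<bar> * r powr (- L)"
      using r by (simp add: powr_minus field_simps)
    hence "exp (t * (A * r1 powr \<alpha>)) * 1 \<le> exp (t * (A * r1 powr \<alpha>)) * (r1 powr \<bar>L\<bar> * r powr (- L))"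
      by (intro mult_left_mono) auto
    also have "\<dots> \<le> C * r powr (- L)"
      unfolding C_def mult.assoc[symmetric] by (intro mult_right_mono) auto
    finally show ?thesis using 1 by linarith
  qed
  moreover have "C \<ge> 0" by (simp add: C_def)
  ultimately show ?thesis by blast
qed

lemma exp_symbol_bounds:
  fixes \<eta> P :: "real \<Rightarrow> real"
  assumes P: "symbol_class \<alpha> n (\<lambda>r. P r - c)" and \<alpha>: "\<alpha> > 0"
    and liminf: "Liminf at_top (\<lambda>r. ereal (\<eta> r / ln r)) = \<infinity>" and t: "t > 0"
    and bound: "\<And>r. r > 0 \<Longrightarrow> \<bar>\<eta> r\<bar> \<le> A * r powr \<alpha>"
  shows "\<exists>B\<ge>0. \<forall>r. 0 < r \<and> r \<le> 1 \<longrightarrow> \<bar>exp (- t * \<eta> r) * P r\<bar> \<le> B"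
    and "\<exists>D\<ge>0. \<forall>r\<ge>1. \<bar>exp (- t * \<eta> r) * P r\<bar> \<le> D * r powr (- L)"
    and "(P \<longlongrightarrow> c) (at_right 0)"
proof -
  obtain C N where C: "C \<ge> 0" "\<And>r. r > 0 \<Longrightarrow> \<bar>P r - c\<bar> \<le> C * r powr \<alpha> * (1 + r) ^ N"
    using symbol_class_bound[OF P] by blast
  have A: "A \<ge> 0" using bound[of 1] by (simp add: order_trans[OF abs_ge_zero])
  have "\<bar>exp (- t * \<eta> r) * P r\<bar> \<le> exp (t * A) * (\<bar>c\<bar> + C * 2 ^ N)" if r: "0 < r" "r \<le> 1" for r
  proof -
    have "r powr \<alpha> \<le> 1" using r \<alpha> by (intro powr_le1) auto
    hence "A * r powr \<alpha> \<le> A" using A by (simp add: mult_left_le)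
    hence "- \<eta> r \<le> A" using bound[of r] r by simp
    hence 1: "exp (- t * \<eta> r) \<le> exp (t * A)"
      using t mult_left_mono[of "- \<eta> r" A t] by simp
    have "C * r powr \<alpha> * (1 + r) ^ N \<le> C * 1 * 2 ^ N"
      using r C \<open>r powr \<alpha> \<le> 1\<close> by (intro mult_mono power_mono) auto
    hence "\<bar>P r\<bar> \<le> \<bar>c\<bar> + C * 2 ^ N" using C(2)[OF r(1)] by simp
    thus ?thesis using 1 unfolding abs_mult by (intro mult_mono) auto
  qed
  thus "\<exists>B\<ge>0. \<forall>r. 0 < r \<and> r \<le> 1 \<longrightarrow> \<bar>exp (- t * \<eta> r) * P r\<bar> \<le> B"
    using C(1) by (intro exI[of _ "exp (t * A) * (\<bar>c\<bar> + C * 2 ^ N)"]) auto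
  \<comment> \<open>The surplus rate \<alpha> + N compensates the growth of P, so that the product
    still decays like r^(-L).\<close>
  obtain E where E: "E \<ge> 0" "\<And>r. r \<ge> 1 \<Longrightarrow> exp (- t * \<eta> r) \<le> E * r powr (- (L + \<alpha> + real N))"
    using exp_neg_superlog_decay[OF liminf t bound, of "L + \<alpha> + real N"] \<alpha> by auto
  have "\<bar>exp (- t * \<eta> r) * P r\<bar> \<le> (E * (\<bar>c\<bar> + C * 2 ^ N)) * r powr (- L)" if r: "r \<ge> 1" for r
  proof -
    have "C * r powr \<alpha> * (1 + r) ^ N \<le> C * r powr \<alpha> * (2 * r) ^ N"
      using r C by (intro mult_mono power_mono) auto
    also have "\<dots> = C * 2 ^ N * r powr (\<alpha> + real N)"
      using r by (simp add: power_mult_distrib powr_add powr_realpow)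
    finally have "\<bar>P r\<bar> \<le> \<bar>c\<bar> * 1 + C * 2 ^ N * r powr (\<alpha> + real N)"
      using C(2)[of r] r by simp
    also have "\<dots> \<le> \<bar>c\<bar> * r powr (\<alpha> + real N) + C * 2 ^ N * r powr (\<alpha> + real N)"
      using r \<alpha> C(1) by (intro add_mono mult_left_mono ge_one_powr_ge_zero) auto
    finally have "\<bar>P r\<bar> \<le> (\<bar>c\<bar> + C * 2 ^ N) * r powr (\<alpha> + real N)" by (simp add: algebra_simps)
    hence "\<bar>exp (- t * \<eta> r) * P r\<bar> \<le> (E * r powr (- (L + \<alpha> + real N))) * ((\<bar>c\<bar> + C * 2 ^ N) * r powr (\<alpha> + real N))"
      unfolding abs_mult using E(1) E(2)[OF r] C(1) by (intro mult_mono) auto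
    also have "\<dots> = E * (\<bar>c\<bar> + C * 2 ^ N) * (r powr (- (L + \<alpha> + real N)) * r powr (\<alpha> + real N))"
      by simp
    also have "r powr (- (L + \<alpha> + real N)) * r powr (\<alpha> + real N) = r powr (- L)"
      by (simp only: powr_add[symmetric]) simp
    finally show ?thesis .
  qed
  thus "\<exists>D\<ge>0. \<forall>r\<ge>1. \<bar>exp (- t * \<eta> r) * P r\<bar> \<le> D * r powr (- L)"
    using C(1) E(1) by (intro exI[of _ "E * (\<bar>c\<bar> + C * 2 ^ N)"]) auto
  have "((\<lambda>r. P r - c) \<longlongrightarrow> 0) (at_right 0)"
  proof (rule tendsto_0_le[where K = 1])
    have "\<forall>\<^sub>F r in at_right 0. 0 \<le> (r :: real)"
      using eventually_at_right_less[of 0] by (rule eventually_mono) simp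
    hence "((\<lambda>r. C * r powr \<alpha> * (1 + r) ^ N) \<longlongrightarrow> C * 0 powr \<alpha> * (1 + 0) ^ N) (at_right 0)"
      using \<alpha> by (intro tendsto_intros) auto
    thus "((\<lambda>r. C * r powr \<alpha> * (1 + r) ^ N) \<longlongrightarrow> 0) (at_right 0)" by simp
    show "\<forall>\<^sub>F r in at_right 0. norm (P r - c) \<le> norm (C * r powr \<alpha> * (1 + r) ^ N) * 1"
      using eventually_at_right_less[of "0::real"]
    proof eventually_elim
      case (elim r)
      thus ?case using C(2)[of r] C(1) by (simp add: abs_mult)
    qed
  qed
  thus "(P \<longlongrightarrow> c) (at_right 0)" by (rule LIM_zero_cancel)
qed

section \<open>The chain for r^\<beta> exp(-t \<eta>(r)) and the resulting constant in the
  asymptotics of \<open>Kbeta\<close>\<close>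

theorem theorem4p1:
  fixes \<eta> :: "real \<Rightarrow> real" and \<beta> \<alpha> t :: real and k :: nat
  assumes d2: "CARD('n::finite) \<ge> 2"
    and beta_nonneg: "\<beta> \<ge> 0"
    and cont: "continuous_on {0..} \<eta>"
    and diff: "\<forall>m<k. \<forall>r>0. ((deriv ^^ m) \<eta> has_real_derivative (deriv ^^ Suc m) \<eta> r) (at r)"
    and k_big: "real k > (real CARD('n) + 3) / 2 + \<beta>"
    and liminf: "Liminf at_top (\<lambda>r. ereal (\<eta> r / ln r)) = \<infinity>"
    and alpha: "0 < \<alpha>" "\<alpha> < 2"
    and bound: "(SUP m\<in>{0..k}. SUP r\<in>{0<..}. ereal \<bar>r powr (- \<alpha> + real m) * (deriv ^^ m) \<eta> r\<bar>) < \<infinity>"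
    and beta_not_even: "\<beta> \<notin> {2 * real n | n. True}"
    and t_pos: "t > 0"
  shows "(\<lambda>x::real^'n. Kbeta \<beta> \<eta> t x) \<sim>[at_infinity]
         (\<lambda>x. complex_of_real
            (2 powr \<beta> * Gamma ((real CARD('n) + \<beta>) / 2) / (pi powr (real CARD('n) / 2) * Gamma (- \<beta> / 2))
             * exp (- t * \<eta> 0) / norm x powr (real CARD('n) + \<beta>)))"
proof -
  define d where "d = real CARD('n)"
  have d: "d \<ge> 2" using d2 by (simp add: d_def)
  have "(real CARD('n) + 3) / 2 > 0" by simp
  hence "real k > 0" using k_big beta_nonneg by linarith
  then obtain k' where k': "k = Suc k'" by (cases k) auto
  obtain A where A: "\<And>m r. m \<le> k \<Longrightarrow> r > 0 \<Longrightarrow> \<bar>r ^ m * (deriv ^^ m) \<eta> r\<bar> \<le> A * r powr \<alpha>"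
  proof -
    define S where "S = (SUP m\<in>{0..k}. SUP r\<in>{0<..}. ereal \<bar>r powr (- \<alpha> + real m) * (deriv ^^ m) \<eta> r\<bar>)"
    have le: "ereal \<bar>r powr (- \<alpha> + real m) * (deriv ^^ m) \<eta> r\<bar> \<le> S" if "m \<le> k" "r > 0" for m r
      unfolding S_def using that by (intro SUP_upper2[of m] SUP_upper2[of r]) auto
    have "S < \<infinity>" using bound by (simp add: S_def)
    \<comment> \<open>Excludes the value -\<infinity>, so that S is a real number.\<close>
    moreover have "S \<ge> 0" using le[of 0 1] by (rule order_trans[rotated]) simp_all
    ultimately obtain A where A: "S = ereal A" by (cases S) auto
    have "\<bar>r ^ m * (deriv ^^ m) \<eta> r\<bar> \<le> A * r powr \<alpha>" if "m \<le> k" "r > 0" for m r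
    proof -
      have "r powr \<alpha> * \<bar>r powr (- \<alpha> + real m) * (deriv ^^ m) \<eta> r\<bar> \<le> r powr \<alpha> * A"
        using le[OF that] A by (intro mult_left_mono) auto
      also have "r powr \<alpha> * \<bar>r powr (- \<alpha> + real m) * (deriv ^^ m) \<eta> r\<bar>
          = \<bar>(r powr \<alpha> * r powr (- \<alpha> + real m)) * (deriv ^^ m) \<eta> r\<bar>"
        by (simp add: abs_mult)
      also have "r powr \<alpha> * r powr (- \<alpha> + real m) = r ^ m"
        using that by (simp add: powr_realpow flip: powr_add)
      finally show ?thesis by (simp only: mult.commute)
    qed
    thus ?thesis using that by blast
  qed
  have \<eta>_bound: "\<bar>\<eta> r\<bar> \<le> A * r powr \<alpha>" if "r > 0" for r using A[of 0 r] that by simp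
  have \<eta>_deriv: "(\<eta> has_real_derivative deriv \<eta> r) (at r)" if "r > 0" for r
    using diff[rule_format, of 0 r] that k' by simp
  \<comment> \<open>Only r \<eta>' enters the coefficients, and it has k' = k - 1 further
    derivatives; \<eta> itself stays in the exponential.\<close>
  have "symbol_class \<alpha> k' (\<lambda>r. r ^ 1 * (deriv ^^ 1) \<eta> r)"
    using diff A k' by (intro symbol_class_scaled_derivs[where k = k and A = A]) auto
  hence E1: "symbol_class \<alpha> k' (\<lambda>r. r * deriv \<eta> r)" by simp
  define P where "P = radial_coeff \<beta> t \<eta>"
  define c where "c = (\<lambda>j. \<Prod>i<j. 2 * real i - \<beta>)"
  have P: "symbol_class \<alpha> (k - j) (\<lambda>r. P j r - c j)" if "j \<le> k" for j
    using symbol_class_radial_coeff[OF E1, of j \<beta> t] alpha that by (simp add: k' P_def c_def)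
  \<comment> \<open>The members f_j of the chain, extended by 0 to make them measurable on the whole
    line.\<close>
  define F where "F = (\<lambda>j r. if r > 0 then r powr (\<beta> - 2 * real j) * (exp (- t * \<eta> r) * P j r) else 0)"
  have deriv: "(F j has_real_derivative - (r * F (Suc j) r)) (at r)" if j: "j < k" and r: "r > 0" for j r
  proof -
    obtain m where m: "k - j = Suc m" using j by (cases "k - j") auto
    obtain q where "((\<lambda>r. P j r - c j) has_real_derivative q) (at r)"
      using P[of j] j r unfolding m by auto
    from DERIV_add[OF this DERIV_const[of "c j"]] have q: "(P j has_real_derivative q) (at r)" by simp
    hence q': "deriv (P j) r = q" by (rule DERIV_imp_deriv)
    have pw: "r powr (\<beta> - 2 * real j - 1) = r * r powr (\<beta> - 2 * real (Suc j))"
             "r powr (\<beta> - 2 * real j) = r * (r * r powr (\<beta> - 2 * real (Suc j)))"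
      using r powr_add[of r 1 "\<beta> - 2 * real (Suc j)"] powr_add[of r 2 "\<beta> - 2 * real (Suc j)"]
      by (simp_all add: powr_numeral power2_eq_square algebra_simps)
    have "((\<lambda>r. r powr (\<beta> - 2 * real j) * (exp (- t * \<eta> r) * P j r)) has_real_derivative - (r * F (Suc j) r)) (at r)"
      by (rule derivative_eq_intros \<eta>_deriv q r refl)+
         (use r in \<open>simp add: F_def P_def[symmetric] q'[unfolded P_def] pw, simp add: P_def algebra_simps q'[unfolded P_def]\<close>)
    thus ?thesis
      by (rule has_field_derivative_transform_within_open[where S = "{0<..}"]) (use r in \<open>auto simp: F_def\<close>)
  qed
  have meas: "F j \<in> borel_measurable borel" if "j \<le> k" for j
  proof (cases j)
    case 0
    have "continuous_on {0<..} (F 0)"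
      using deriv[of 0] k' by (intro continuous_at_imp_continuous_on) (auto intro: DERIV_isCont)
    hence "(\<lambda>r. indicator {0<..} r *\<^sub>R F 0 r) \<in> borel_measurable borel"
      by (intro borel_measurable_continuous_on_indicator) auto
    moreover have "(\<lambda>r. indicator {0<..} r *\<^sub>R F 0 r) = F 0" by (auto simp: F_def fun_eq_iff)
    ultimately show ?thesis using 0 by simp
  next
    case (Suc i)
    \<comment> \<open>F (i+1) is recovered from the derivative of F i by dividing by -r; this also
      covers i + 1 = k, where continuity is not assumed.\<close>
    have "(\<lambda>r. indicator {0<..} r *\<^sub>R (- (r * F (Suc i) r))) \<in> borel_measurable borel"
      using deriv[of i] Suc that by (intro borel_measurable_derivative_Ioi) auto
    hence "(\<lambda>r. - (1 / r) * (indicator {0<..} r *\<^sub>R (- (r * F (Suc i) r)))) \<in> borel_measurable borel"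
      by measurable
    moreover have "(\<lambda>r. - (1 / r) * (indicator {0<..} r *\<^sub>R (- (r * F (Suc i) r)))) = F (Suc i)"
      by (auto simp: F_def fun_eq_iff indicator_def)
    ultimately show ?thesis using Suc by simp
  qed
  note bounds = exp_symbol_bounds[OF P alpha(1) liminf t_pos \<eta>_bound]
  have lim: "(F j \<longlongrightarrow> 0) at_top" if j: "j < k" for j
  proof -
    \<comment> \<open>The rate is chosen so that, multiplied by r^(\<beta>-2j), exactly 1/r
      remains.\<close>
    obtain D where D: "\<And>r. r \<ge> 1 \<Longrightarrow> \<bar>exp (- t * \<eta> r) * P j r\<bar> \<le> D * r powr (- (\<beta> - 2 * real j + 1))"
      using bounds(2)[of j "\<beta> - 2 * real j + 1"] j by auto
    show ?thesis
    proof (rule tendsto_0_le[where K = 1])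
      show "((\<lambda>r :: real. D * (1 / r)) \<longlongrightarrow> 0) at_top"
        by (intro tendsto_mult_right_zero real_tendsto_divide_at_top[OF tendsto_const filterlim_ident])
      show "\<forall>\<^sub>F r in at_top. norm (F j r) \<le> norm (D * (1 / r)) * 1"
        using eventually_ge_at_top[of 1]
      proof eventually_elim
        case (elim r)
        have "\<bar>F j r\<bar> = r powr (\<beta> - 2 * real j) * \<bar>exp (- t * \<eta> r) * P j r\<bar>"
          using elim by (simp add: F_def abs_mult)
        also have "\<dots> \<le> r powr (\<beta> - 2 * real j) * (D * r powr (- (\<beta> - 2 * real j + 1)))"
          by (intro mult_left_mono D elim) auto
        also have "\<dots> = D * (r powr (\<beta> - 2 * real j) * r powr (- (\<beta> - 2 * real j + 1)))" by simp
        also have "r powr (\<beta> - 2 * real j) * r powr (- (\<beta> - 2 * real j + 1)) = 1 / r"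
          using elim by (simp only: powr_add[symmetric]) (simp add: powr_minus field_simps)
        finally have "\<bar>F j r\<bar> \<le> D * (1 / r)" .
        also have "\<dots> \<le> norm (D * (1 / r)) * 1" by (simp only: real_norm_def mult_1_right abs_ge_self)
        finally show ?case by (simp only: real_norm_def)
      qed
    qed
  qed
  have int: "set_integrable lborel {0<..} (\<lambda>r. r * F (Suc j) r * r powr (real CARD('n) + 2 * real j))" if j: "j < k" for j
  proof -
    \<comment> \<open>The total power of r, 1 + (\<beta> - 2(j+1)) + (d + 2j), independent of j: the
      singularity gained by differentiating is offset by the growing weight. Asking for the rate q +
      2 leaves r^(-2) at infinity.\<close>
    define q where "q = \<beta> + d - 1"
    obtain B where B: "\<And>r. 0 < r \<Longrightarrow> r \<le> 1 \<Longrightarrow> \<bar>exp (- t * \<eta> r) * P (Suc j) r\<bar> \<le> B"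
      using bounds(1)[of "Suc j"] j by auto
    obtain D where D: "\<And>r. r \<ge> 1 \<Longrightarrow> \<bar>exp (- t * \<eta> r) * P (Suc j) r\<bar> \<le> D * r powr (- (q + 2))"
      using bounds(2)[of "Suc j" "q + 2"] j by auto
    have eq: "\<bar>r * F (Suc j) r * r powr (real CARD('n) + 2 * real j)\<bar> = r powr q * \<bar>exp (- t * \<eta> r) * P (Suc j) r\<bar>" if "r > 0" for r
    proof -
      have "r powr q = r powr 1 * r powr (\<beta> - 2 * real (Suc j)) * r powr (d + 2 * real j)"
        by (simp only: powr_add[symmetric]) (rule arg_cong2[where f = "(powr)"], auto simp: q_def)
      thus ?thesis using that by (simp add: F_def abs_mult d_def)
    qed
    have [measurable]: "F (Suc j) \<in> borel_measurable borel" using meas[of "Suc j"] j by simp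
    show ?thesis
    proof (rule set_integrable_powr_piecewise)
      show "q > -1" using d beta_nonneg by (simp add: q_def)
      show "q + - (q + 2) < -1" by simp
      show "\<bar>r * F (Suc j) r * r powr (real CARD('n) + 2 * real j)\<bar> \<le> B * r powr q" if "0 < r" "r \<le> 1" for r
        unfolding eq[OF that(1)] using mult_left_mono[OF B[OF that], of "r powr q"] by (simp add: mult_ac)
      show "\<bar>r * F (Suc j) r * r powr (real CARD('n) + 2 * real j)\<bar> \<le> D * r powr (q + - (q + 2))" if "r \<ge> 1" for r
      proof -
        have "r powr q * \<bar>exp (- t * \<eta> r) * P (Suc j) r\<bar> \<le> r powr q * (D * r powr (- (q + 2)))"
          by (intro mult_left_mono D that) auto
        thus ?thesis using that by (subst eq) (auto simp only: powr_add mult_ac)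
      qed
    qed measurable
  qed
  \<comment> \<open>Defining g through F k lets it inherit measurability; on r > 0 it is exp(-t
    \<eta>) P_k.\<close>
  define g where "g = (\<lambda>r. r powr (2 * real k - \<beta>) * F k r)"
  have g_eq: "g r = exp (- t * \<eta> r) * P k r" if "r > 0" for r
    using that by (simp add: g_def F_def mult.assoc[symmetric] powr_add[symmetric])
  have Fk: "F k r = r powr (\<beta> - 2 * real k) * g r" if "r > 0" for r
    using that by (simp add: g_eq F_def)
  have g_meas: "g \<in> borel_measurable borel"
    using meas[of k] unfolding g_def by measurable
  obtain B where B: "\<And>r. r > 0 \<Longrightarrow> \<bar>g r\<bar> \<le> B"
  proof -
    obtain B where B: "\<And>r. 0 < r \<Longrightarrow> r \<le> 1 \<Longrightarrow> \<bar>exp (- t * \<eta> r) * P k r\<bar> \<le> B"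
      using bounds(1)[of k] by auto
    obtain D where D: "\<And>r. r \<ge> 1 \<Longrightarrow> \<bar>exp (- t * \<eta> r) * P k r\<bar> \<le> D * r powr (- 0)"
      using bounds(2)[of k 0] by auto
    have "\<bar>g r\<bar> \<le> max B D" if "r > 0" for r
      using B[of r] D[of r] that by (cases "r \<le> 1") (auto simp: g_eq)
    thus ?thesis using that by blast
  qed
  have g_lim: "(g \<longlongrightarrow> exp (- t * \<eta> 0) * c k) (at_right 0)"
  proof -
    have "(\<eta> \<longlongrightarrow> \<eta> 0) (at_right 0)"
      using cont by (auto simp: continuous_on_def intro: tendsto_within_subset[of _ _ _ "{0..}"])
    hence "((\<lambda>r. exp (- t * \<eta> r) * P k r) \<longlongrightarrow> exp (- t * \<eta> 0) * c k) (at_right 0)"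
      by (intro tendsto_intros bounds(3)) auto
    moreover have "\<forall>\<^sub>F r in at_right 0. exp (- t * \<eta> r) * P k r = g r"
      using eventually_at_right_less[of "0::real"] by eventually_elim (simp add: g_eq)
    ultimately show ?thesis by (rule Lim_transform_eventually)
  qed
  have \<beta>_Ints: "- \<beta> / 2 \<notin> \<int>\<^sub>\<le>\<^sub>0"
  proof
    assume "- \<beta> / 2 \<in> \<int>\<^sub>\<le>\<^sub>0"
    then obtain n where "- \<beta> / 2 = - of_nat n" by (auto elim: nonpos_Ints_cases')
    hence "\<beta> = 2 * real n" by simp
    thus False using beta_not_even by auto
  qed
  have c_k: "c k = 2 ^ k * Gamma (real k - \<beta> / 2) / Gamma (- \<beta> / 2)"
  proof -
    \<comment> \<open>Extracting 2 from every factor leaves the rising factorial of -\<beta>/2, a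
      quotient of \<Gamma>-values because -\<beta>/2 is not a pole.\<close>
    have "c k = (\<Prod>i<k. 2 * (- \<beta> / 2 + real i))" unfolding c_def by (intro prod.cong) auto
    also have "\<dots> = 2 ^ k * pochhammer (- \<beta> / 2) k"
      unfolding prod.distrib pochhammer_prod lessThan_atLeast0 by simp
    also have "pochhammer (- \<beta> / 2) k = Gamma (- \<beta> / 2 + real k) / Gamma (- \<beta> / 2)"
      using \<beta>_Ints by (rule pochhammer_Gamma)
    finally show ?thesis by (simp add: add.commute)
  qed
  have "real k - \<beta> / 2 > 0" using k_big beta_nonneg d by (simp add: d_def field_simps)
  hence Gk: "Gamma (real k - \<beta> / 2) > 0" by simp
  define L where "L = 2 powr \<beta> * Gamma ((d + \<beta>) / 2) / (pi powr (d / 2) * Gamma (- \<beta> / 2)) * exp (- t * \<eta> 0)"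
  define FT where "FT = (\<lambda>x :: real ^ 'n. LINT \<xi>|lborel. F 0 (norm \<xi>) *\<^sub>R cis (- (x \<bullet> \<xi>)))"
  have K: "Kbeta \<beta> \<eta> t x = complex_of_real ((2 * pi) powr (- d)) * FT x" for x :: "real ^ 'n"
  proof -
    \<comment> \<open>At \<xi> = 0 both sides are 0, since \<open>0 powr \<beta> = 0\<close> and F 0
      is extended by 0.\<close>
    have "F 0 (norm \<xi>) *\<^sub>R cis (- (x \<bullet> \<xi>)) = exp (- \<i> * complex_of_real (x \<bullet> \<xi>)) *
        complex_of_real (norm \<xi> powr \<beta> * exp (- t * \<eta> (norm \<xi>)))" for \<xi>
      by (auto simp: F_def P_def cis_conv_exp scaleR_conv_of_real)
    thus ?thesis by (simp add: Kbeta_def FT_def d_def)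
  qed
  have "((\<lambda>x. norm x powr (d + \<beta>) *\<^sub>R FT x) \<longlongrightarrow> of_real (pi powr (d / 2) * 2 powr (d + \<beta>) * Gamma ((d + \<beta>) / 2)
        * (exp (- t * \<eta> 0) * c k) / (2 ^ k * Gamma (real k - \<beta> / 2)))) at_infinity"
    unfolding FT_def d_def
    by (rule radial_fourier_asymptotics[OF meas deriv lim int Fk g_meas B g_lim beta_nonneg k_big])
  hence "((\<lambda>x. complex_of_real ((2 * pi) powr (- d)) * (norm x powr (d + \<beta>) *\<^sub>R FT x)) \<longlongrightarrow>
     complex_of_real ((2 * pi) powr (- d)) * of_real (pi powr (d / 2) * 2 powr (d + \<beta>) * Gamma ((d + \<beta>) / 2)
        * (exp (- t * \<eta> 0) * c k) / (2 ^ k * Gamma (real k - \<beta> / 2)))) at_infinity"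
    by (intro tendsto_intros)
  also have "complex_of_real ((2 * pi) powr (- d)) * of_real (pi powr (d / 2) * 2 powr (d + \<beta>) * Gamma ((d + \<beta>) / 2)
        * (exp (- t * \<eta> 0) * c k) / (2 ^ k * Gamma (real k - \<beta> / 2))) = of_real L"
  proof -
    have "(2 * pi) powr (- d) * (pi powr (d / 2) * 2 powr (d + \<beta>)) = 2 powr \<beta> / pi powr (d / 2)"
      by (simp add: powr_mult powr_minus powr_add field_simps flip: powr_add)
    hence "(2 * pi) powr (- d) * (pi powr (d / 2) * 2 powr (d + \<beta>) * Gamma ((d + \<beta>) / 2)
        * (exp (- t * \<eta> 0) * c k) / (2 ^ k * Gamma (real k - \<beta> / 2))) =
       2 powr \<beta> / pi powr (d / 2) * (Gamma ((d + \<beta>) / 2) * (exp (- t * \<eta> 0) * c k) / (2 ^ k * Gamma (real k - \<beta> / 2)))"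
      by (metis (no_types, opaque_lifting) mult.assoc times_divide_eq_right)
    \<comment> \<open>Here 2^k \<Gamma>(k - \<beta>/2) cancels, and with it every trace of
      k.\<close>
    also have "\<dots> = L" unfolding c_k L_def using Gk by simp
    finally show ?thesis by (simp only: of_real_mult[symmetric])
  qed
  also have "(\<lambda>x. complex_of_real ((2 * pi) powr (- d)) * (norm x powr (d + \<beta>) *\<^sub>R FT x)) =
      (\<lambda>x. of_real (norm x powr (d + \<beta>)) * Kbeta \<beta> \<eta> t x)"
    by (simp add: K scaleR_conv_of_real mult_ac)
  finally have main: "((\<lambda>x :: real ^ 'n. of_real (norm x powr (d + \<beta>)) * Kbeta \<beta> \<eta> t x) \<longlongrightarrow> of_real L) at_infinity" .
  \<comment> \<open>\<open>Gamma\<close> has the value 0 at its poles, so this rests on -\<beta>/2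
    not being one; dividing the limit by L then gives asymptotic equivalence.\<close>
  have "L \<noteq> 0"
    using \<beta>_Ints d beta_nonneg by (auto simp: L_def Gamma_eq_zero_iff nonpos_Ints_def)
  have "((\<lambda>x :: real ^ 'n. of_real (norm x powr (d + \<beta>)) * Kbeta \<beta> \<eta> t x / of_real L) \<longlongrightarrow> of_real L / of_real L) at_infinity"
    using main \<open>L \<noteq> 0\<close> by (intro tendsto_intros) auto
  hence lim1: "((\<lambda>x :: real ^ 'n. of_real (norm x powr (d + \<beta>)) * Kbeta \<beta> \<eta> t x / of_real L) \<longlongrightarrow> 1) at_infinity"
    using \<open>L \<noteq> 0\<close> by simp
  have "(\<lambda>x :: real ^ 'n. Kbeta \<beta> \<eta> t x) \<sim>[at_infinity] (\<lambda>x. complex_of_real (L / norm x powr (d + \<beta>)))"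
  proof (rule asymp_equivI')
    show "((\<lambda>x :: real ^ 'n. Kbeta \<beta> \<eta> t x / complex_of_real (L / norm x powr (d + \<beta>))) \<longlongrightarrow> 1) at_infinity"
      using lim1 by (rule back_subst[of "\<lambda>f. (f \<longlongrightarrow> 1) at_infinity"]) (auto simp: fun_eq_iff mult_ac)
  qed
  thus ?thesis by (simp add: L_def d_def)
qed

end
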